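(* Let $A$ be a polytope in $\mathbb{R}^d$ and let $L$ be a lattice in $\mathbb{R}^d$. Then $A$ tiles at some level $k$ (for some positive integer $k$) by translations with respect to $L$, i.e. $\sum_{\lambda\in L}\chi_A(x-\lambda)=k$ for almost every $x\in\mathbb{R}^d$, if and only if $H_{\Phi}(A,L)=0$ for every $r$-flag $\Phi$ with $0\le r\le d-1$.
   Context: A simplex in $\mathbb{R}^d$ is the convex hull of $d+1$ points not all lying in a hyperplane. A polytope in $\mathbb{R}^d$ is a union of finitely many simplices with pairwise disjoint interiors (not necessarily convex or connected). A lattice $L$ in $\mathbb{R}^d$ is the subgroup generated by $d$ linearly independent vectors. $\chi_A$ denotes the indicator function of $A$. For $0\le r\le d-1$, an $r$-flag $\Phi$ is a sequence of affine subspaces $V_r\subset V_{r+1}\subset\cdots\subset V_{d-1}\subset V_d=\mathbb{R}^d$ with $\dim V_j=j$, together with, for each $r\le j\le d-1$, a designation of one of the two half-spaces of $V_{j+1}$ bounded by $V_j$ as positive and the other as negative. Given a polytope $A$, consider chains of faces $F_r\subset F_{r+1}\subset\cdots\subset F_{d-1}\subset F_d=A$ where $F_j$ is a $j$-dimensional face of $A$ contained in $V_j$ ($r\le j\le d-1$); to each such chain assign $\varepsilon_j=+1$ if $F_{j+1}$ adjoins $V_j$ from the positive side and $\varepsilon_j=-1$ if from the negative side. Define $\omega_\Phi(A)=\sum \varepsilon_r\varepsilon_{r+1}\cdots\varepsilon_{d-1}\,\mathrm{Vol}_r(F_r)$, the sum over all such chains (and $\omega_\Phi(A)=0$ if there is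 none), where $\mathrm{Vol}_r$ is $r$-dimensional volume, and for $r=0$ a $0$-dimensional face is a vertex with volume $1$. The Hadwiger functional is $H_\Phi(A,L)=\sum_{\Psi}\omega_\Psi(A)$, where $\Psi$ runs over all distinct $r$-flags obtainable from $\Phi$ by translating all the subspaces $V_j$, together with their positive and negative half-spaces, by some vector $\lambda\in L$ (each such flag counted once). *)

theory Defs
  imports "HOL-Analysis.Analysis" "HOL-Computational_Algebra.Group_Closure"
begin

text \<open>The predicate \<open>polytope\<close> of the library means a convex polytope. Here polytopes need be neither
  convex nor connected. The empty union is not a polytope.\<close>

definition general_polytope :: "'a::euclidean_space set \<Rightarrow> bool" where
  "general_polytope A \<longleftrightarrow>
     (\<exists>T. finite T \<and> T \<noteq> {} \<and> (\<forall>S\<in>T. int DIM('a) simplex S) \<and>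
          pairwise (\<lambda>S S'. interior S \<inter> interior S' = {}) T \<and> A = \<Union>T)"

definition is_lattice :: "'a::euclidean_space set \<Rightarrow> bool" where
  "is_lattice L \<longleftrightarrow> (\<exists>B. independent B \<and> card B = DIM('a) \<and> L = group_closure B)"

definition tiles_at_level :: "'a::euclidean_space set \<Rightarrow> 'a set \<Rightarrow> nat \<Rightarrow> bool" where
  "tiles_at_level A L k \<longleftrightarrow>
     (AE x in lebesgue. ((\<lambda>l. indicator A (x - l) :: real) has_sum real k) L)"

text \<open>\<open>H\<close> is one of the two closed half-spaces of the affine space \<open>W\<close> bounded by its hyperplane \<open>V\<close>.\<close>

definition half_space_of :: "'a::euclidean_space set \<Rightarrow> 'a set \<Rightarrow> 'a set \<Rightarrow> bool" where
  "half_space_of W V H \<longleftrightarrow> V \<noteq> {} \<and> V \<noteq> W \<and>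
     (\<exists>a b. V = {x\<in>W. a \<bullet> x = b} \<and> H = {x\<in>W. a \<bullet> x \<ge> b})"

definition agree_near :: "'a::metric_space \<Rightarrow> 'a set \<Rightarrow> 'a set \<Rightarrow> bool" where
  "agree_near x P Q \<longleftrightarrow> (\<exists>e>0. P \<inter> ball x e = Q \<inter> ball x e)"

text \<open>The facets of a possibly non-convex polytope \<open>P\<close>, taken within its affine hull: near a point in
  the relative interior of a facet, \<open>P\<close> is a half-space, and the facets are the closures of the connected
  components of the set of all such points. A point at which \<open>P\<close> lies on both sides of a
  hyperplane is therefore not an inner point of a facet in that hyperplane.\<close>

definition facet_points :: "'a::euclidean_space set \<Rightarrow> 'a set" where
  "facet_points P =
     {x. \<exists>V H. half_space_of (affine hull P) V H \<and> x \<in> V \<and> agree_near x P H}"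

definition facets :: "'a::euclidean_space set \<Rightarrow> 'a set set" where
  "facets P = closure ` components (facet_points P)"

definition adjoins_from :: "'a::euclidean_space set \<Rightarrow> 'a set \<Rightarrow> 'a set \<Rightarrow> bool" where
  "adjoins_from P F H \<longleftrightarrow> (\<exists>x\<in>F. agree_near x P H)"

text \<open>The volume of \<open>F\<close> of dimension \<open>aff_dim F\<close>: Lebesgue measure in Cartesian coordinates on the
  affine hull of \<open>F\<close>. It does not depend on the frame chosen, and it is 1 if \<open>F\<close> is a single point.\<close>

definition orthonormal_frame :: "'a::euclidean_space set \<Rightarrow> 'a \<Rightarrow> 'a set \<Rightarrow> bool" where
  "orthonormal_frame V p B \<longleftrightarrow>
     pairwise orthogonal B \<and> (\<forall>b\<in>B. norm b = 1) \<and> V = (\<lambda>v. p + v) ` span B"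

definition rel_volume :: "'a::euclidean_space set \<Rightarrow> real" where
  "rel_volume F =
     (let (p, B) = (SOME (p, B). orthonormal_frame (affine hull F) p B);
          M = (\<Pi>\<^sub>M b\<in>B. (lborel :: real measure))
      in measure M {t \<in> space M. p + (\<Sum>b\<in>B. t b *\<^sub>R b) \<in> F})"

text \<open>A flag is a pair \<open>(V, H)\<close>, where \<open>V j\<close> is the subspace of dimension \<open>j\<close> and \<open>H j\<close> is the positive
  half-space of \<open>V (Suc j)\<close> bounded by \<open>V j\<close>. Both are empty at the unused indices, so that two
  flags are the same exactly if the pairs are equal.\<close>

type_synonym 'a flag = "(nat \<Rightarrow> 'a set) \<times> (nat \<Rightarrow> 'a set)"

definition is_flag :: "nat \<Rightarrow> 'a::euclidean_space flag \<Rightarrow> bool" where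
  "is_flag r \<Phi> \<longleftrightarrow> (case \<Phi> of (V, H) \<Rightarrow>
     (\<forall>j\<in>{r..DIM('a)}. affine (V j) \<and> aff_dim (V j) = int j) \<and> V (DIM('a)) = UNIV \<and>
     (\<forall>j\<in>{r..<DIM('a)}. V j \<subseteq> V (Suc j) \<and> half_space_of (V (Suc j)) (V j) (H j)) \<and>
     (\<forall>j. j \<notin> {r..DIM('a)} \<longrightarrow> V j = {}) \<and> (\<forall>j. j \<notin> {r..<DIM('a)} \<longrightarrow> H j = {}))"

definition translate_flag :: "'a::euclidean_space \<Rightarrow> 'a flag \<Rightarrow> 'a flag" where
  "translate_flag l \<Phi> = (case \<Phi> of (V, H) \<Rightarrow> (\<lambda>j. (+) l ` V j, \<lambda>j. (+) l ` H j))"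

text \<open>A face of a non-convex polytope may meet another face in only a part of a facet of the latter, so
  \<open>F j\<close> is required to be a facet of \<open>F (Suc j)\<close>. For faces of a convex polytope this is the same
  as inclusion.\<close>

definition face_chains :: "nat \<Rightarrow> 'a::euclidean_space flag \<Rightarrow> 'a set \<Rightarrow> (nat \<Rightarrow> 'a set) set" where
  "face_chains r \<Phi> A = (case \<Phi> of (V, H) \<Rightarrow>
     {F. F (DIM('a)) = A \<and>
         (\<forall>j\<in>{r..<DIM('a)}. F j \<in> facets (F (Suc j)) \<and> aff_dim (F j) = int j \<and> F j \<subseteq> V j) \<and>
         (\<forall>j. j \<notin> {r..DIM('a)} \<longrightarrow> F j = {})})"

definition chain_sign :: "'a::euclidean_space flag \<Rightarrow> (nat \<Rightarrow> 'a set) \<Rightarrow> nat \<Rightarrow> real" where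
  "chain_sign \<Phi> F j = (if adjoins_from (F (Suc j)) (F j) (snd \<Phi> j) then 1 else -1)"

definition flag_weight :: "nat \<Rightarrow> 'a::euclidean_space flag \<Rightarrow> 'a set \<Rightarrow> real" where
  "flag_weight r \<Phi> A =
     (\<Sum>F\<in>face_chains r \<Phi> A. (\<Prod>j=r..<DIM('a). chain_sign \<Phi> F j) * rel_volume (F r))"

text \<open>For a polytope \<open>A\<close> only finitely many terms of the sum are non-zero.\<close>

definition hadwiger :: "nat \<Rightarrow> 'a::euclidean_space flag \<Rightarrow> 'a set \<Rightarrow> 'a set \<Rightarrow> real" where
  "hadwiger r \<Phi> A L = (\<Sum>\<^sub>\<infinity>\<Psi>\<in>(\<lambda>l. translate_flag l \<Phi>) ` L. flag_weight r \<Psi> A)"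

end

theory Submission
  imports Defs
begin

text \<open>
  Write \<open>f\<close> for the multiplicity function of the translates of \<open>A\<close>; it is locally a finite sum of
  indicator functions, hence constant on the cells of a locally finite hyperplane arrangement. The jump
  of such a function across a hyperplane, \<open>u (x + t n) - u (x - t n)\<close> for small \<open>t > 0\<close>, is of the same kind.
  Iterating jumps along a flag turns \<open>indicator A\<close> into the signed sum of the indicators of the faces of
  dimension \<open>r\<close> that end the face chains, up to lower-dimensional sets. So a Hadwiger functional is the
  integral, over a slice of \<open>V r\<close> modulo the lattice vectors parallel to it, of the iterated jump of \<open>f\<close>.

  If \<open>f\<close> is constant almost everywhere then all these jumps vanish generically. Conversely, by
  induction on \<open>r\<close> the iterated jump of \<open>f\<close> along an \<open>r\<close>-flag has no jumps across hyperplanes of \<open>V r\<close>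
  and is therefore generically constant, and the vanishing of the functional forces the constant to be 0;
  for \<open>r = d\<close> this says that \<open>f\<close> itself is constant.
\<close>

section \<open>Sets and functions adapted to a hyperplane arrangement\<close>

text \<open>Every identity between functions here holds only at generic points, and it must survive
  restriction to a hyperplane, where the next jump is taken. Null sets do not survive it: a sequence
  of parallel copies converging to \<open>V\<close> is null and spoils the jump at every point of
  \<open>V\<close>. The exceptional sets are therefore contained, within each ball, in finitely many
  proper hyperplane sections (\<open>thin\<close>); those different from \<open>V\<close> cut
  \<open>V\<close> properly, and the jump across \<open>V\<close> steps over \<open>V\<close>
  itself.

  Absence of jumps yields constancy because a segment between two generic points can be tilted away
  from all sets of codimension 2; then it meets one hyperplane section at a time, at points where
  the jump is known to be 0.

  Integrals over \<open>V r\<close> are taken over a slab, \<open>V r\<close> times a unit cube,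
  inside the whole space. The lattice vectors parallel to \<open>V r\<close> may have any rank, so
  that a compact fundamental domain need not exist; a weight whose translates sum to 1, with
  positive mass \<kappa>, takes its place. The functional is then \<open>c * \<kappa>\<close> for
  the generic value \<open>c\<close> of the jump, and its vanishing gives
  \<open>c = 0\<close>.\<close>

definition aval :: "'a::euclidean_space \<times> real \<Rightarrow> 'a \<Rightarrow> real" where
  "aval h x = fst h \<bullet> x - snd h"

text \<open>The cells of the arrangement. \<open>sgn\<close> keeps the zero sign apart, so that
  faces of lower dimension are cells of their own and half-spaces, open or closed, are unions of
  cells.\<close>

definition same_side :: "('a::euclidean_space \<times> real) set \<Rightarrow> 'a \<Rightarrow> 'a \<Rightarrow> bool" where
  "same_side \<Sigma> x y \<longleftrightarrow> (\<forall>h\<in>\<Sigma>. sgn (aval h x) = sgn (aval h y))"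

definition adapted_on :: "('a::euclidean_space \<times> real) set \<Rightarrow> 'a set \<Rightarrow> ('a \<Rightarrow> 'b) \<Rightarrow> bool" where
  "adapted_on \<Sigma> X u \<longleftrightarrow> (\<forall>x\<in>X. \<forall>y\<in>X. same_side \<Sigma> x y \<longrightarrow> u x = u y)"

abbreviation adapted :: "('a::euclidean_space \<times> real) set \<Rightarrow> 'a set \<Rightarrow> bool" where
  "adapted \<Sigma> S \<equiv> adapted_on \<Sigma> UNIV (\<lambda>x. x \<in> S)"

text \<open>The multiplicity function of infinitely many translates is governed by infinitely many
  hyperplanes, of which finitely many matter in each ball.\<close>

definition locally_adapted :: "('a::euclidean_space \<Rightarrow> 'b) \<Rightarrow> bool" where
  "locally_adapted u \<longleftrightarrow> (\<forall>R. \<exists>\<Sigma>. finite \<Sigma> \<and> adapted_on \<Sigma> (ball 0 R) u)"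

lemma aval_add: "aval h (x + z) = aval h x + fst h \<bullet> z"
  by (simp add: aval_def inner_add_right)

lemma aval_diff_inner: "aval h x - aval h y = fst h \<bullet> (x - y)"
  by (simp add: aval_def inner_diff_right)

lemma aval_line: "aval h (x + t *\<^sub>R (y - x)) = (1 - t) * aval h x + t * aval h y"
  by (simp add: aval_def inner_add_right inner_diff_right algebra_simps)

lemma continuous_on_aval [continuous_intros]: "continuous_on S (aval h)"
  unfolding aval_def by (intro continuous_intros)

lemma same_side_refl [simp]: "same_side \<Sigma> x x"
  by (simp add: same_side_def)

lemma same_side_sym: "same_side \<Sigma> x y \<Longrightarrow> same_side \<Sigma> y x"
  by (simp add: same_side_def)

lemma same_side_zeroD: "same_side \<Sigma> x y \<Longrightarrow> h \<in> \<Sigma> \<Longrightarrow> aval h x = 0 \<longleftrightarrow> aval h y = 0"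
  unfolding same_side_def by (drule (1) bspec) (auto simp: sgn_real_def split: if_splits)

lemma adapted_onD: "adapted_on \<Sigma> X u \<Longrightarrow> x \<in> X \<Longrightarrow> y \<in> X \<Longrightarrow> same_side \<Sigma> x y \<Longrightarrow> u x = u y"
  unfolding adapted_on_def by blast

lemma adapted_on_mono: "adapted_on \<Sigma> X u \<Longrightarrow> \<Sigma> \<subseteq> \<Sigma>' \<Longrightarrow> X' \<subseteq> X \<Longrightarrow> adapted_on \<Sigma>' X' u"
  unfolding adapted_on_def same_side_def by (meson subsetD)

lemma adapted_on_imp_locally_adapted: "finite \<Sigma> \<Longrightarrow> adapted_on \<Sigma> UNIV u \<Longrightarrow> locally_adapted u"
  unfolding locally_adapted_def by (meson adapted_on_mono order_refl subset_UNIV)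

lemma eventually_sgn_aval:
  assumes "aval h x \<noteq> 0"
  shows "\<forall>\<^sub>F y in nhds x. sgn (aval h y) = sgn (aval h x)"
proof -
  have t: "(aval h \<longlongrightarrow> aval h x) (nhds x)"
    using continuous_on_aval[of UNIV h] by (simp add: continuous_on_def tendsto_at_iff_tendsto_nhds)
  show ?thesis
  proof (cases "aval h x > 0")
    case True
    then show ?thesis using order_tendstoD(1)[OF t True] by (auto elim: eventually_mono)
  next
    case False
    with assms have "aval h x < 0" by simp
    then show ?thesis using order_tendstoD(2)[OF t, of 0] by (auto elim: eventually_mono)
  qed
qed

text \<open>Two points of one cell have neighbourhoods of the same shape: the hyperplanes through
  \<open>x\<close> are those through \<open>y\<close> and see the same shift, and the others keep
  their sign nearby. Closures, jumps and facet points inherit adaptedness through this.\<close>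

lemma eventually_same_side_translate:
  assumes "finite \<Sigma>" "same_side \<Sigma> x y"
  shows "\<forall>\<^sub>F z in nhds 0. same_side \<Sigma> (x + z) (y + z)"
proof -
  have tr: "filterlim (\<lambda>z. w + z) (nhds w) (nhds 0)" for w :: 'a
    using tendsto_add[OF tendsto_const[of w] filterlim_ident[of "nhds 0"]] by simp
  have "\<forall>\<^sub>F z in nhds 0. sgn (aval h (x + z)) = sgn (aval h (y + z))" if "h \<in> \<Sigma>" for h
  proof (cases "aval h x = 0")
    case True
    then have "aval h y = 0" using assms(2) that same_side_zeroD by blast
    then show ?thesis using True by (simp add: aval_add)
  next
    case False
    then have "aval h y \<noteq> 0" using assms(2) that same_side_zeroD by blast
    have "\<forall>\<^sub>F z in nhds 0. sgn (aval h (x + z)) = sgn (aval h x)"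
      using eventually_compose_filterlim[OF eventually_sgn_aval[OF False] tr] .
    moreover have "\<forall>\<^sub>F z in nhds 0. sgn (aval h (y + z)) = sgn (aval h y)"
      using eventually_compose_filterlim[OF eventually_sgn_aval[OF \<open>aval h y \<noteq> 0\<close>] tr] .
    ultimately show ?thesis
      by eventually_elim (use assms(2) that in \<open>simp add: same_side_def\<close>)
  qed
  then show ?thesis unfolding same_side_def using assms(1) by (simp add: eventually_ball_finite)
qed

lemma eventually_nhds_0_norm: "(\<forall>\<^sub>F z in nhds (0::'a::real_normed_vector). P z) \<longleftrightarrow> (\<exists>e>0. \<forall>z. norm z < e \<longrightarrow> P z)"
  by (simp add: eventually_nhds_metric)

lemma same_side_translate:
  assumes "finite \<Sigma>" "same_side \<Sigma> x y"
  obtains e where "e > 0" "\<And>z. norm z < e \<Longrightarrow> same_side \<Sigma> (x + z) (y + z)"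
  using eventually_same_side_translate[OF assms] unfolding eventually_nhds_0_norm by blast

section \<open>Cells: convexity, measurability, finiteness\<close>

lemma convex_same_side: "convex {y. same_side \<Sigma> x y}"
proof -
  have "{y. same_side \<Sigma> x y} = (\<Inter>h\<in>\<Sigma>. {y. sgn (aval h x) = sgn (aval h y)})"
    by (auto simp: same_side_def)
  moreover have "convex {y. sgn (aval h x) = sgn (aval h y)}" for h
  proof -
    consider "aval h x > 0" | "aval h x = 0" | "aval h x < 0" by linarith
    then show ?thesis
    proof cases
      case 1
      then have "{y. sgn (aval h x) = sgn (aval h y)} = {y. fst h \<bullet> y > snd h}"
        by (auto simp: aval_def sgn_real_def split: if_splits)
      then show ?thesis by (simp add: convex_halfspace_gt)
    next
      case 2
      then have "{y. sgn (aval h x) = sgn (aval h y)} = {y. fst h \<bullet> y = snd h}"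
        by (auto simp: aval_def sgn_real_def split: if_splits)
      then show ?thesis by (simp add: convex_hyperplane)
    next
      case 3
      then have "{y. sgn (aval h x) = sgn (aval h y)} = {y. fst h \<bullet> y < snd h}"
        by (auto simp: aval_def sgn_real_def split: if_splits)
      then show ?thesis by (simp add: convex_halfspace_lt)
    qed
  qed
  ultimately show ?thesis by (simp add: convex_INT)
qed

lemma borel_same_side: 
  assumes "finite \<Sigma>" shows "{y. same_side \<Sigma> x y} \<in> sets borel"
proof -
  have [measurable]: "aval h \<in> borel_measurable borel" for h :: "'a \<times> real"
    by (intro borel_measurable_continuous_onI continuous_on_aval)
  have "{y. same_side \<Sigma> x y} = {y \<in> space borel. \<forall>h\<in>\<Sigma>. sgn (aval h x) = sgn (aval h y)}"
    by (auto simp: same_side_def)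
  also have "\<dots> \<in> sets borel"
    using assms by measurable
  finally show ?thesis .
qed

lemma finite_same_side_classes:
  assumes "finite \<Sigma>" shows "finite (range (\<lambda>x. {y. same_side \<Sigma> x y}))"
proof -
  define c where "c s = {y. \<forall>h\<in>\<Sigma>. s h = sgn (aval h y)}" for s :: "'a \<times> real \<Rightarrow> real"
  have "range (\<lambda>x. {y. same_side \<Sigma> x y}) \<subseteq> c ` (\<Sigma> \<rightarrow>\<^sub>E {-1,0,1})"
  proof clarify
    fix x
    have "{y. same_side \<Sigma> x y} = c (\<lambda>h\<in>\<Sigma>. sgn (aval h x))"
      by (auto simp: c_def same_side_def)
    moreover have "(\<lambda>h\<in>\<Sigma>. sgn (aval h x)) \<in> \<Sigma> \<rightarrow>\<^sub>E {-1,0,1}"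
      by (auto simp: sgn_real_def)
    ultimately show "{y. same_side \<Sigma> x y} \<in> c ` (\<Sigma> \<rightarrow>\<^sub>E {-1,0,1})" by blast
  qed
  then show ?thesis
    by (rule finite_subset) (intro finite_imageI finite_PiE assms, auto)
qed

text \<open>Such a set is a union of cells. All faces of all dimensions are adapted to the same
  \<Sigma> as the polytope, so this makes the face chains finite in number, as well as the
  translated flags that have any.\<close>

lemma finite_adapted_sets:
  assumes "finite \<Sigma>" shows "finite {S. adapted \<Sigma> S}"
proof -
  have "{S. adapted \<Sigma> S} \<subseteq> Union ` Pow (range (\<lambda>x. {y. same_side \<Sigma> x y}))"
  proof clarify
    fix S :: "'a set" assume S: "adapted \<Sigma> S"
    have "S = \<Union> ((\<lambda>x. {y. same_side \<Sigma> x y}) ` S)"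
      using adapted_onD[OF S] by auto
    then show "S \<in> Union ` Pow (range (\<lambda>x. {y. same_side \<Sigma> x y}))" by blast
  qed
  then show ?thesis
    by (rule finite_subset) (simp add: finite_same_side_classes assms)
qed

lemma adapted_on_finite_range:
  assumes "finite \<Sigma>" "adapted_on \<Sigma> UNIV u" shows "finite (range u)"
proof -
  have "u x \<in> (\<lambda>K. u (SOME z. z \<in> K)) ` range (\<lambda>x. {y. same_side \<Sigma> x y})" for x
  proof -
    have "same_side \<Sigma> x (SOME z. z \<in> {y. same_side \<Sigma> x y})"
      using someI[of "\<lambda>z. z \<in> {y. same_side \<Sigma> x y}" x] by simp
    then have "u x = u (SOME z. z \<in> {y. same_side \<Sigma> x y})"
      using adapted_onD[OF assms(2)] by blast
    then show ?thesis by (rule image_eqI) (rule rangeI)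
  qed
  then have "range u \<subseteq> (\<lambda>K. u (SOME z. z \<in> K)) ` range (\<lambda>x. {y. same_side \<Sigma> x y})" by (rule image_subsetI)
  then show ?thesis by (rule finite_subset) (intro finite_imageI[OF finite_same_side_classes[OF assms(1)]])
qed

lemma adapted_on_borel_measurable:
  fixes u :: "'a::euclidean_space \<Rightarrow> real"
  assumes "finite \<Sigma>" "adapted_on \<Sigma> UNIV u" shows "u \<in> borel_measurable borel"
proof (rule measurable_piecewise_restrict[where C="range (\<lambda>x. {y. same_side \<Sigma> x y})"])
  show "countable (range (\<lambda>x. {y. same_side \<Sigma> x y}))"
    using finite_same_side_classes[OF assms(1)] countable_finite by blast
  show "C \<inter> space borel \<in> sets borel" if "C \<in> range (\<lambda>x. {y. same_side \<Sigma> x y})" for C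
    using that borel_same_side[OF assms(1)] by auto
  show "space borel \<subseteq> \<Union> (range (\<lambda>x. {y. same_side \<Sigma> x y}))" using same_side_refl by auto
  fix C assume "C \<in> range (\<lambda>x. {y. same_side \<Sigma> x y})"
  then obtain x where C: "C = {y. same_side \<Sigma> x y}" by blast
  have "u \<in> measurable (restrict_space borel C) borel \<longleftrightarrow> (\<lambda>_. u x) \<in> measurable (restrict_space borel C) borel"
    by (rule measurable_cong) (use adapted_onD[OF assms(2), of x] in \<open>auto simp: C space_restrict_space\<close>)
  then show "u \<in> measurable (restrict_space borel C) borel" by simp
qed

section \<open>Operations that preserve adaptedness\<close>

lemma adapted_closure:
  assumes "finite \<Sigma>" "adapted \<Sigma> S" shows "adapted \<Sigma> (closure S)"
proof -
  have "y \<in> closure S" if x: "x \<in> closure S" and xy: "same_side \<Sigma> x y" for x y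
  proof -
    obtain e where e: "e > 0" "\<And>z. norm z < e \<Longrightarrow> same_side \<Sigma> (x + z) (y + z)"
      using same_side_translate[OF assms(1) xy] by blast
    show ?thesis unfolding closure_approachable
    proof safe
      fix \<epsilon> :: real assume "\<epsilon> > 0"
      then obtain s where s: "s \<in> S" "dist s x < min e \<epsilon>"
        using x e(1) unfolding closure_approachable by (metis min_less_iff_conj)
      \<comment> \<open>The point \<open>s\<close> of \<open>S\<close> near \<open>x\<close> is
        carried towards \<open>y\<close> by the shift \<open>y - x\<close>, which keeps it in its
        cell and hence in \<open>S\<close>.\<close>
      then have "same_side \<Sigma> s (y + (s - x))"
        using e(2)[of "s - x"] by (simp add: dist_norm)
      then have "y + (s - x) \<in> S" using adapted_onD[OF assms(2)] s(1) by blast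
      then show "\<exists>z\<in>S. dist z y < \<epsilon>"
        using s(2) by (intro bexI[of _ "y + (s - x)"]) (auto simp: dist_norm)
    qed
  qed
  then show ?thesis unfolding adapted_on_def using same_side_sym by blast
qed

text \<open>A cell is convex, hence connected, and so lies in a single component.\<close>

lemma adapted_component:
  assumes "adapted \<Sigma> S" "C \<in> components S" shows "adapted \<Sigma> C"
proof -
  have "y \<in> C" if x: "x \<in> C" and xy: "same_side \<Sigma> x y" for x y
  proof -
    have "{y. same_side \<Sigma> x y} \<subseteq> S"
      using adapted_onD[OF assms(1)] x in_components_subset[OF assms(2)] by blast
    then show ?thesis
      using components_maximal[OF assms(2) convex_connected[OF convex_same_side[of \<Sigma> x]]] x xy same_side_refl
      by blast
  qed
  then show ?thesis unfolding adapted_on_def using same_side_sym by blast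
qed

lemma adapted_polyhedron:
  assumes "polyhedron S" obtains \<Sigma> where "finite \<Sigma>" "adapted \<Sigma> S"
proof -
  obtain F where F: "finite F" "S = \<Inter>F" "\<forall>h\<in>F. \<exists>a b. a \<noteq> 0 \<and> h = {x. a \<bullet> x \<le> b}"
    using assms unfolding polyhedron_def by blast
  then obtain a b where ab: "\<And>h. h \<in> F \<Longrightarrow> h = {x. a h \<bullet> x \<le> b h}" by metis
  have "adapted ((\<lambda>h. (a h, b h)) ` F) S"
  proof -
    have "y \<in> h" if "same_side ((\<lambda>h. (a h, b h)) ` F) x y" "h \<in> F" "x \<in> h" for x y h
    proof -
      have "a h \<bullet> x \<le> b h" using ab that by blast
      moreover have "sgn (a h \<bullet> x - b h) = sgn (a h \<bullet> y - b h)"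
        using that by (auto simp: same_side_def aval_def)
      ultimately have "a h \<bullet> y \<le> b h" by (auto simp: sgn_real_def split: if_splits)
      then show ?thesis using ab that by blast
    qed
    then show ?thesis unfolding adapted_on_def F(2) using same_side_sym by blast
  qed
  then show thesis using that F(1) by blast
qed

lemma adapted_general_polytope:
  assumes "general_polytope A" obtains \<Sigma> where "finite \<Sigma>" "adapted \<Sigma> A"
proof -
  obtain T where T: "finite T" "\<forall>S\<in>T. int DIM('a) simplex S" "A = \<Union>T"
    using assms unfolding general_polytope_def by blast
  have "\<forall>S\<in>T. \<exists>\<Sigma>. finite \<Sigma> \<and> adapted \<Sigma> S"
    using T(2) by (metis adapted_polyhedron polytope_imp_polyhedron simplex_imp_polytope)
  then obtain g where g: "\<And>S. S \<in> T \<Longrightarrow> finite (g S) \<and> adapted (g S) S" by metis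
  have "adapted (\<Union>(g ` T)) A"
  proof -
    have "y \<in> A" if "same_side (\<Union>(g ` T)) x y" "x \<in> A" for x y
    proof -
      from that(2) obtain S where S: "S \<in> T" "x \<in> S" unfolding T(3) by blast
      then have "same_side (g S) x y" using that(1) by (auto simp: same_side_def)
      then show ?thesis using adapted_onD[of "g S" UNIV "\<lambda>x. x \<in> S" x y] S g T(3) by auto
    qed
    then show ?thesis unfolding adapted_on_def using same_side_sym by blast
  qed
  then show thesis using that g T(1) by blast
qed

lemma adapted_on_indicator: "adapted \<Sigma> S \<Longrightarrow> adapted_on \<Sigma> UNIV (indicator S :: 'a::euclidean_space \<Rightarrow> real)"
  unfolding adapted_on_def indicator_def by (intro ballI impI arg_cong[where f=of_bool]) blast

section \<open>Generic points and jumps\<close>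

definition vanishes_on :: "'a::euclidean_space \<times> real \<Rightarrow> 'a set \<Rightarrow> bool" where
  "vanishes_on h W \<longleftrightarrow> (\<forall>x\<in>W. aval h x = 0)"

text \<open>Only the part of \<open>N\<close> in \<open>W\<close> is constrained. Finiteness is
  asked for ball by ball, since a periodic function has infinitely many exceptional
  hyperplanes.\<close>

definition thin :: "'a::euclidean_space set \<Rightarrow> 'a set \<Rightarrow> bool" where
  "thin W N \<longleftrightarrow> (\<forall>R. \<exists>\<Theta>. finite \<Theta> \<and> (\<forall>h\<in>\<Theta>. \<not> vanishes_on h W) \<and>
     (\<forall>x\<in>W. norm x < R \<longrightarrow> (\<forall>h\<in>\<Theta>. aval h x \<noteq> 0) \<longrightarrow> x \<notin> N))"

lemma thinD:
  assumes "thin W N"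
  shows "\<exists>\<Theta>. finite \<Theta> \<and> (\<forall>h\<in>\<Theta>. \<not> vanishes_on h W) \<and>
    (\<forall>x\<in>W. norm x < R \<longrightarrow> (\<forall>h\<in>\<Theta>. aval h x \<noteq> 0) \<longrightarrow> x \<notin> N)"
  by (rule spec[OF assms[unfolded thin_def]])

lemma thinI:
  assumes "\<And>R. \<exists>\<Theta>. finite \<Theta> \<and> (\<forall>h\<in>\<Theta>. \<not> vanishes_on h W) \<and>
    (\<forall>x\<in>W. norm x < R \<longrightarrow> (\<forall>h\<in>\<Theta>. aval h x \<noteq> 0) \<longrightarrow> x \<notin> N)"
  shows "thin W N"
  unfolding thin_def by (rule allI) (rule assms)

lemma thin_subset:
  assumes "thin W N" "W \<inter> N' \<subseteq> N" shows "thin W N'"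
proof (rule thinI)
  fix R
  from thinD[OF assms(1), of R]
  show "\<exists>\<Theta>. finite \<Theta> \<and> (\<forall>h\<in>\<Theta>. \<not> vanishes_on h W) \<and>
    (\<forall>x\<in>W. norm x < R \<longrightarrow> (\<forall>h\<in>\<Theta>. aval h x \<noteq> 0) \<longrightarrow> x \<notin> N')"
    by (elim ex_forward conjE) (use assms(2) in blast)
qed

lemma thin_Un:
  assumes "thin W N" "thin W N'" shows "thin W (N \<union> N')"
proof (rule thinI)
  fix R
  obtain \<Theta> where "finite \<Theta>" "\<forall>h\<in>\<Theta>. \<not> vanishes_on h W"
    "\<forall>x\<in>W. norm x < R \<longrightarrow> (\<forall>h\<in>\<Theta>. aval h x \<noteq> 0) \<longrightarrow> x \<notin> N"
    using thinD[OF assms(1), of R] by blast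
  moreover obtain \<Theta>' where "finite \<Theta>'" "\<forall>h\<in>\<Theta>'. \<not> vanishes_on h W"
    "\<forall>x\<in>W. norm x < R \<longrightarrow> (\<forall>h\<in>\<Theta>'. aval h x \<noteq> 0) \<longrightarrow> x \<notin> N'"
    using thinD[OF assms(2), of R] by blast
  ultimately show "\<exists>\<Theta>. finite \<Theta> \<and> (\<forall>h\<in>\<Theta>. \<not> vanishes_on h W) \<and>
    (\<forall>x\<in>W. norm x < R \<longrightarrow> (\<forall>h\<in>\<Theta>. aval h x \<noteq> 0) \<longrightarrow> x \<notin> N \<union> N')"
    by (intro exI[of _ "\<Theta> \<union> \<Theta>'"]) auto
qed

lemma eventually_at_right_affine:
  fixes x n :: "'a::real_normed_vector"
  assumes "\<forall>\<^sub>F z in nhds x. P z"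
  shows "\<forall>\<^sub>F t in at_right 0. P (x + t *\<^sub>R n)"
proof (rule eventually_compose_filterlim[OF assms])
  have "((\<lambda>t::real. x + t *\<^sub>R n) \<longlongrightarrow> x + 0 *\<^sub>R n) (at_right 0)"
    by (intro tendsto_intros)
  then show "((\<lambda>t::real. x + t *\<^sub>R n) \<longlongrightarrow> x) (at_right 0)" by simp
qed

lemma eventually_at_right_in_open:
  fixes x n :: "'a::real_normed_vector"
  assumes "open X" "x \<in> X"
  shows "\<forall>\<^sub>F t in at_right 0. x + t *\<^sub>R n \<in> X"
  using eventually_at_right_affine[OF eventually_nhds_in_open[OF assms]] .

lemma affine_line: "affine W \<Longrightarrow> x \<in> W \<Longrightarrow> y \<in> W \<Longrightarrow> x + t *\<^sub>R (y - x) \<in> W"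
  using mem_affine_3_minus[of W x y x t] by simp

text \<open>Being off a hyperplane is an open condition, so a point that is good for \<Theta> stays
  good while it is pushed slightly towards a point of \<open>W\<close> at which the new functional
  is not 0.\<close>

lemma generic_point_exists:
  assumes "affine W" "x \<in> W" "e > 0" "finite \<Theta>" "\<forall>h\<in>\<Theta>. \<not> vanishes_on h W"
  shows "\<exists>y\<in>W \<inter> ball x e. \<forall>h\<in>\<Theta>. aval h y \<noteq> 0"
  using assms(4,5)
proof (induction \<Theta> rule: finite_induct)
  case empty
  then show ?case using assms(2,3) by auto
next
  case (insert h \<Theta>)
  then obtain y where y: "y \<in> W" "y \<in> ball x e" "\<forall>h\<in>\<Theta>. aval h y \<noteq> 0" by auto
  show ?case
  proof (cases "aval h y = 0")
    case False
    then show ?thesis using y by auto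
  next
    case True
    obtain w where w: "w \<in> W" "aval h w \<noteq> 0" using insert.prems by (auto simp: vanishes_on_def)
    have "\<forall>\<^sub>F t in at_right 0. y + t *\<^sub>R (w - y) \<in> ball x e"
      by (rule eventually_at_right_in_open) (use y in auto)
    moreover have "\<forall>\<^sub>F t in at_right 0. \<forall>k\<in>\<Theta>. aval k (y + t *\<^sub>R (w - y)) \<noteq> 0"
    proof (rule eventually_ball_finite[OF \<open>finite \<Theta>\<close>], rule ballI)
      fix k assume "k \<in> \<Theta>"
      then have k: "aval k y \<noteq> 0" using y by blast
      show "\<forall>\<^sub>F t in at_right 0. aval k (y + t *\<^sub>R (w - y)) \<noteq> 0"
        using eventually_at_right_affine[OF eventually_sgn_aval[OF k], of "w - y"] k
        by (auto elim: eventually_mono simp: sgn_0_0)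
    qed
    moreover have "\<forall>\<^sub>F t in at_right (0::real). t > 0" by (simp add: eventually_at_right_less)
    ultimately have "\<forall>\<^sub>F t in at_right (0::real). \<exists>y\<in>W \<inter> ball x e. \<forall>h\<in>insert h \<Theta>. aval h y \<noteq> 0"
    proof eventually_elim
      case (elim t)
      have "aval h (y + t *\<^sub>R (w - y)) \<noteq> 0" using elim w True by (simp add: aval_line)
      then show ?case using elim affine_line[OF assms(1) y(1) w(1)] by blast
    qed
    then show ?thesis by (simp add: trivial_limit_at_right_real eventually_const)
  qed
qed

lemma thin_dense:
  assumes "affine W" "x \<in> W" "e > 0" "thin W N"
  shows "\<exists>y\<in>W \<inter> ball x e. y \<notin> N"
proof -
  obtain \<Theta> where \<Theta>: "finite \<Theta>" "\<forall>h\<in>\<Theta>. \<not> vanishes_on h W"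
    "\<forall>y\<in>W. norm y < norm x + e \<longrightarrow> (\<forall>h\<in>\<Theta>. aval h y \<noteq> 0) \<longrightarrow> y \<notin> N"
    using thinD[OF assms(4), of "norm x + e"] by blast
  obtain y where y: "y \<in> W \<inter> ball x e" "\<forall>h\<in>\<Theta>. aval h y \<noteq> 0"
    using generic_point_exists[OF assms(1-3) \<Theta>(1,2)] by blast
  have "norm y < norm x + e"
    using y(1) norm_triangle_ineq2[of y x] by (auto simp: dist_norm norm_minus_commute)
  then show ?thesis using \<Theta>(3) y by blast
qed

lemma aval_proportional:
  assumes "affine W" and V: "V = {x\<in>W. aval h0 x = 0}" "V \<noteq> {}" and "\<not> vanishes_on h0 W" "vanishes_on h V"
  obtains \<kappa> where "\<And>w. w \<in> W \<Longrightarrow> aval h w = \<kappa> * aval h0 w"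
proof -
  obtain x0 where x0: "x0 \<in> W" "aval h0 x0 = 0" "aval h x0 = 0" using V assms(5) by (auto simp: vanishes_on_def)
  obtain w0 where w0: "w0 \<in> W" "aval h0 w0 \<noteq> 0" using assms(4) by (auto simp: vanishes_on_def)
  have "aval h y = (aval h w0 / aval h0 w0) * aval h0 y" if y: "y \<in> W" for y
  proof -
    define \<tau> where "\<tau> = aval h0 y / aval h0 w0"
    \<comment> \<open>\<open>z\<close> is the point of \<open>V\<close> reached from
      \<open>y\<close> in the direction \<open>x0 - w0\<close>; the factor \<tau> makes
      \<open>h0\<close> vanish there. Along this direction both functionals change at rates fixed by
      their values at \<open>w0\<close>.\<close>
    define z where "z = y + \<tau> *\<^sub>R (x0 - w0)"
    have "z \<in> W" unfolding z_def by (rule mem_affine_3_minus[OF assms(1) y x0(1) w0(1)])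
    have av: "aval k z = aval k y + \<tau> * (aval k x0 - aval k w0)" for k
      by (simp add: z_def aval_add aval_diff_inner)
    have "aval h0 z = 0" using w0 x0 by (simp add: av \<tau>_def)
    then have "aval h z = 0" using \<open>z \<in> W\<close> V assms(5) by (auto simp: vanishes_on_def)
    then show ?thesis using x0 by (simp add: av \<tau>_def)
  qed
  then show thesis using that by blast
qed

text \<open>Near \<open>p\<close> only functionals that vanish at \<open>p\<close> can change sign;
  these vanish on \<open>V\<close> and are multiples of \<open>h0\<close> on \<open>W\<close>. So
  inside \<open>W\<close> the arrangement looks like the single hyperplane \<open>V\<close>
  there.\<close>

lemma same_side_near_generic_point:
  assumes "affine W" and V: "V = {x\<in>W. aval h0 x = 0}" "p \<in> V" and "\<not> vanishes_on h0 W"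
    and "finite \<Sigma>" "\<And>h. h \<in> \<Sigma> \<Longrightarrow> aval h p = 0 \<Longrightarrow> vanishes_on h V"
  obtains e where "e > 0"
    "\<And>x y. x \<in> W \<Longrightarrow> y \<in> W \<Longrightarrow> dist p x < e \<Longrightarrow> dist p y < e \<Longrightarrow> sgn (aval h0 x) = sgn (aval h0 y) \<Longrightarrow> same_side \<Sigma> x y"
proof -
  have "\<forall>\<^sub>F z in nhds p. \<forall>h\<in>\<Sigma>. aval h p \<noteq> 0 \<longrightarrow> sgn (aval h z) = sgn (aval h p)"
    by (rule eventually_ball_finite[OF assms(5)]) (metis (mono_tags, lifting) eventually_sgn_aval eventually_mono always_eventually)
  then obtain e where e: "e > 0" "\<And>z h. dist z p < e \<Longrightarrow> h \<in> \<Sigma> \<Longrightarrow> aval h p \<noteq> 0 \<Longrightarrow> sgn (aval h z) = sgn (aval h p)"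
    unfolding eventually_nhds_metric by blast
  have "same_side \<Sigma> x y" if xy: "x \<in> W" "y \<in> W" "dist p x < e" "dist p y < e" "sgn (aval h0 x) = sgn (aval h0 y)" for x y
    unfolding same_side_def
  proof
    fix h assume h: "h \<in> \<Sigma>"
    show "sgn (aval h x) = sgn (aval h y)"
    proof (cases "aval h p = 0")
      case True
      then have "vanishes_on h V" using assms(6) h by blast
      then obtain \<kappa> where "\<And>w. w \<in> W \<Longrightarrow> aval h w = \<kappa> * aval h0 w"
        using aval_proportional[OF assms(1) V(1) _ assms(4)] V(2) by blast
      then show ?thesis using xy by (simp add: sgn_mult)
    next
      case False
      then show ?thesis using e(2)[OF _ h] xy by (simp add: dist_commute)
    qed
  qed
  then show thesis using that e(1) by blast
qed

text \<open>For locally adapted \<open>u\<close> the difference is constant for small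
  \<open>t\<close> (\<open>eventually_jump\<close>), so that the limit is attained; where no limit
  exists the value is arbitrary.\<close>

definition jump :: "'a::euclidean_space \<Rightarrow> ('a \<Rightarrow> real) \<Rightarrow> 'a \<Rightarrow> real" where
  "jump n u x = Lim (at_right 0) (\<lambda>t. u (x + t *\<^sub>R n) - u (x - t *\<^sub>R n))"

lemma jump_eqI:
  assumes "\<forall>\<^sub>F t in at_right 0. u (x + t *\<^sub>R n) - u (x - t *\<^sub>R n) = c"
  shows "jump n u x = c"
  unfolding jump_def by (intro tendsto_Lim tendsto_eventually assms) simp

lemma jump_cong:
  assumes "\<forall>\<^sub>F t in at_right 0. u (x + t *\<^sub>R n) - u (x - t *\<^sub>R n) = v (y + t *\<^sub>R n) - v (y - t *\<^sub>R n)"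
  shows "jump n u x = jump n v y"
  unfolding jump_def Topological_Spaces.Lim_def using tendsto_cong[OF assms] by simp

lemma eventually_at_right_in_open_minus:
  fixes x n :: "'a::real_normed_vector"
  assumes "open X" "x \<in> X"
  shows "\<forall>\<^sub>F t in at_right 0. x - t *\<^sub>R n \<in> X"
  using eventually_at_right_in_open[OF assms, of "- n"] by simp

lemma jump_local:
  assumes "open X" "x \<in> X" "\<And>y. y \<in> X \<Longrightarrow> u y = v y"
  shows "jump n u x = jump n v x"
proof (rule jump_cong)
  show "\<forall>\<^sub>F t in at_right 0. u (x + t *\<^sub>R n) - u (x - t *\<^sub>R n) = v (x + t *\<^sub>R n) - v (x - t *\<^sub>R n)"
    using eventually_at_right_in_open[OF assms(1,2), of n] eventually_at_right_in_open_minus[OF assms(1,2), of n]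
    by eventually_elim (use assms(3) in simp)
qed

lemma jump_translate: "jump n (\<lambda>x. u (x + l)) x = jump n u (x + l)"
  unfolding jump_def by (simp add: algebra_simps)

lemma jump_const [simp]: "jump n (\<lambda>_. c) x = 0"
  by (rule jump_eqI) simp

text \<open>Equal small shifts of \<open>x\<close> and \<open>y\<close> stay in a common cell, so
  the one-sided values agree. No new hyperplane enters, which lets one \<Sigma> serve for all
  iterated jumps.\<close>

lemma adapted_on_jump:
  assumes "finite \<Sigma>" "open X" "adapted_on \<Sigma> X u"
  shows "adapted_on \<Sigma> X (jump n u)"
  unfolding adapted_on_def
proof (intro ballI impI)
  fix x y assume xy: "x \<in> X" "y \<in> X" "same_side \<Sigma> x y"
  have e: "\<forall>\<^sub>F t in at_right 0. u (x + t *\<^sub>R n) = u (y + t *\<^sub>R n)" for n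
    using eventually_at_right_affine[OF eventually_same_side_translate[OF assms(1) xy(3)], of n]
      eventually_at_right_in_open[OF assms(2) xy(1), of n] eventually_at_right_in_open[OF assms(2) xy(2), of n]
    by eventually_elim (use assms(3) in \<open>auto intro: adapted_onD\<close>)
  show "jump n u x = jump n u y"
  proof (rule jump_cong)
    show "\<forall>\<^sub>F t in at_right 0. u (x + t *\<^sub>R n) - u (x - t *\<^sub>R n) = u (y + t *\<^sub>R n) - u (y - t *\<^sub>R n)"
      using e[of n] e[of "- n"] by eventually_elim simp
  qed
qed

lemma locally_adapted_jump:
  assumes "locally_adapted u" shows "locally_adapted (jump n u)"
  using assms adapted_on_jump unfolding locally_adapted_def by (metis open_ball)

lemma locally_adapted_eventually_const:
  assumes "locally_adapted u" shows "\<exists>c. \<forall>\<^sub>F t in at_right 0. u (x + t *\<^sub>R n) = c"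
proof -
  obtain \<Sigma> where \<Sigma>: "finite \<Sigma>" "adapted_on \<Sigma> (ball 0 (norm x + 1)) u"
    using spec[OF assms[unfolded locally_adapted_def]] by blast
  \<comment> \<open>A functional that vanishes at \<open>x\<close> takes, for small
    \<open>t\<close>, the sign of its slope along \<open>n\<close>; any other one keeps its
    sign.\<close>
  have sg: "\<forall>\<^sub>F t in at_right 0. sgn (aval h (x + t *\<^sub>R n)) = (if aval h x = 0 then sgn (fst h \<bullet> n) else sgn (aval h x))" for h
  proof (cases "aval h x = 0")
    case True
    have "\<forall>\<^sub>F t in at_right (0::real). t > 0" by (simp add: eventually_at_right_less)
    then show ?thesis by eventually_elim (simp add: True aval_add sgn_mult)
  next
    case False
    then show ?thesis using eventually_at_right_affine[OF eventually_sgn_aval[OF False]] by simp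
  qed
  have "\<forall>\<^sub>F t in at_right 0. (\<forall>h\<in>\<Sigma>. sgn (aval h (x + t *\<^sub>R n)) = (if aval h x = 0 then sgn (fst h \<bullet> n) else sgn (aval h x)))
      \<and> x + t *\<^sub>R n \<in> ball 0 (norm x + 1)"
    using \<Sigma>(1) sg by (intro eventually_conj eventually_ball_finite eventually_at_right_in_open) auto
  then obtain b where b: "b > 0" "\<And>t. 0 < t \<Longrightarrow> t < b \<Longrightarrow> (\<forall>h\<in>\<Sigma>. sgn (aval h (x + t *\<^sub>R n)) = (if aval h x = 0 then sgn (fst h \<bullet> n) else sgn (aval h x)))
      \<and> x + t *\<^sub>R n \<in> ball 0 (norm x + 1)"
    unfolding eventually_at_right_field by blast
  have "u (x + t *\<^sub>R n) = u (x + (b/2) *\<^sub>R n)" if "0 < t" "t < b" for t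
    by (rule adapted_onD[OF \<Sigma>(2)]) (use b(2)[OF that] b(2)[of "b/2"] b(1) in \<open>auto simp: same_side_def\<close>)
  then have "\<forall>\<^sub>F t in at_right 0. u (x + t *\<^sub>R n) = u (x + (b/2) *\<^sub>R n)"
    unfolding eventually_at_right_field using b(1) by blast
  then show ?thesis by blast
qed

lemma eventually_jump:
  assumes "locally_adapted u"
  shows "\<forall>\<^sub>F t in at_right 0. u (x + t *\<^sub>R n) - u (x - t *\<^sub>R n) = jump n u x"
proof -
  obtain c d where "\<forall>\<^sub>F t in at_right 0. u (x + t *\<^sub>R n) = c" "\<forall>\<^sub>F t in at_right 0. u (x + t *\<^sub>R (- n)) = d"
    using locally_adapted_eventually_const[OF assms] by blast
  then have cd: "\<forall>\<^sub>F t in at_right 0. u (x + t *\<^sub>R n) - u (x - t *\<^sub>R n) = c - d"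
    by eventually_elim simp
  then show ?thesis using jump_eqI[OF cd] by simp
qed

lemma jump_sum:
  assumes "finite I" "\<And>i. i \<in> I \<Longrightarrow> locally_adapted (u i)"
  shows "jump n (\<lambda>x. \<Sum>i\<in>I. c i * u i x) x = (\<Sum>i\<in>I. c i * jump n (u i) x)"
proof (rule jump_eqI)
  have "\<forall>\<^sub>F t in at_right 0. \<forall>i\<in>I. u i (x + t *\<^sub>R n) - u i (x - t *\<^sub>R n) = jump n (u i) x"
    by (intro eventually_ball_finite ballI assms eventually_jump)
  then show "\<forall>\<^sub>F t in at_right 0. (\<Sum>i\<in>I. c i * u i (x + t *\<^sub>R n)) - (\<Sum>i\<in>I. c i * u i (x - t *\<^sub>R n)) = (\<Sum>i\<in>I. c i * jump n (u i) x)"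
  proof eventually_elim
    case (elim t)
    have "(\<Sum>i\<in>I. c i * u i (x + t *\<^sub>R n)) - (\<Sum>i\<in>I. c i * u i (x - t *\<^sub>R n)) = (\<Sum>i\<in>I. c i * (u i (x + t *\<^sub>R n) - u i (x - t *\<^sub>R n)))"
      by (simp add: sum_subtractf right_diff_distrib)
    then show ?case using elim by simp
  qed
qed

definition crosses :: "'a::euclidean_space set \<Rightarrow> 'a set \<Rightarrow> 'a set \<Rightarrow> 'a \<Rightarrow> bool" where
  "crosses W V H n \<longleftrightarrow> V \<noteq> {} \<and> (\<forall>x\<in>W. x + n \<in> W) \<and>
     (\<exists>h. V = {x\<in>W. aval h x = 0} \<and> H = {x\<in>W. aval h x \<ge> 0} \<and> fst h \<bullet> n > 0)"

lemma affine_translate_scale: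
  assumes "affine W" "\<And>x. x \<in> W \<Longrightarrow> x + n \<in> W" "x \<in> W" shows "x + t *\<^sub>R n \<in> W"
  using affine_line[OF assms(1) assms(3) assms(2)[OF assms(3)], of t] by simp

lemma not_vanishes_on_crossed:
  assumes "V = {x\<in>W. aval h x = 0}" "V \<noteq> {}" "\<forall>x\<in>W. x + n \<in> W" "fst h \<bullet> n > 0"
  shows "\<not> vanishes_on h W"
proof -
  obtain x where x: "x \<in> W" "aval h x = 0" using assms by blast
  then have "aval h (x + n) \<noteq> 0" using assms(4) by (simp add: aval_add)
  then show ?thesis using x assms(3) by (auto simp: vanishes_on_def)
qed

text \<open>A functional in \<Theta> that vanishes on \<open>V\<close> is a non-zero multiple of
  \<open>h0\<close> on \<open>W\<close>, so it is non-zero as soon as \<open>V\<close> is left along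
  \<open>n\<close>. The remaining functionals cut \<open>V\<close> properly; at a point off their
  zeros they stay non-zero nearby. Hence the points on both sides avoid the zeros of
  \<Theta>.\<close>

lemma thin_jump:
  assumes "affine W" "crosses W V H n" "thin W {x. u x \<noteq> v x}"
  shows "thin V {x. jump n u x \<noteq> jump n v x}"
proof (rule thinI)
  fix R
  obtain h0 where h0: "V = {x\<in>W. aval h0 x = 0}" "fst h0 \<bullet> n > 0" and V: "V \<noteq> {}" and n: "\<forall>x\<in>W. x + n \<in> W"
    using assms(2) unfolding crosses_def by blast
  have nv: "\<not> vanishes_on h0 W" by (rule not_vanishes_on_crossed[OF h0(1) V n h0(2)])
  obtain \<Theta> where \<Theta>: "finite \<Theta>" "\<forall>h\<in>\<Theta>. \<not> vanishes_on h W"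
    "\<forall>x\<in>W. norm x < R \<longrightarrow> (\<forall>h\<in>\<Theta>. aval h x \<noteq> 0) \<longrightarrow> x \<notin> {x. u x \<noteq> v x}"
    using thinD[OF assms(3), of R] by blast
  have "jump n u p = jump n v p" if p: "p \<in> V" "norm p < R" "\<forall>h\<in>{h\<in>\<Theta>. \<not> vanishes_on h V}. aval h p \<noteq> 0" for p
  proof -
    have pW: "p \<in> W" using p h0 by blast
    have ne: "\<forall>\<^sub>F t in at_right 0. aval h (p + t *\<^sub>R m) \<noteq> 0" if h: "h \<in> \<Theta>" and m: "m = n \<or> m = - n" for h m
    proof (cases "vanishes_on h V")
      case True
      obtain \<kappa> where \<kappa>: "\<And>w. w \<in> W \<Longrightarrow> aval h w = \<kappa> * aval h0 w"
        using aval_proportional[OF assms(1) h0(1) V nv True] by blast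
      have "\<kappa> \<noteq> 0" using \<kappa> \<Theta>(2) h by (auto simp: vanishes_on_def)
      have mW: "p + t *\<^sub>R m \<in> W" for t
        using m affine_translate_scale[OF assms(1) _ pW, of n t] affine_translate_scale[OF assms(1) _ pW, of n "-t"] n by auto
      have "aval h0 p = 0" using p h0 by blast
      have "\<forall>\<^sub>F t in at_right (0::real). t > 0" by (simp add: eventually_at_right_less)
      then show ?thesis
        by eventually_elim (use \<open>\<kappa> \<noteq> 0\<close> h0(2) m \<open>aval h0 p = 0\<close> \<kappa>[OF mW] in \<open>auto simp: aval_add\<close>)
    next
      case False
      then have "aval h p \<noteq> 0" using p(3) h by blast
      then show ?thesis using eventually_at_right_affine[OF eventually_sgn_aval[OF \<open>aval h p \<noteq> 0\<close>], of m]
        by (auto elim: eventually_mono simp: sgn_0_0)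
    qed
    have eq: "\<forall>\<^sub>F t in at_right 0. u (p + t *\<^sub>R m) = v (p + t *\<^sub>R m)" if m: "m = n \<or> m = - n" for m
    proof -
      have "\<forall>\<^sub>F t in at_right 0. \<forall>h\<in>\<Theta>. aval h (p + t *\<^sub>R m) \<noteq> 0"
        by (intro eventually_ball_finite \<Theta> ballI ne m)
      moreover have "\<forall>\<^sub>F t in at_right 0. p + t *\<^sub>R m \<in> ball 0 R"
        by (rule eventually_at_right_in_open) (use p in auto)
      ultimately show ?thesis
      proof eventually_elim
        case (elim t)
        have "p + t *\<^sub>R m \<in> W"
          using m affine_translate_scale[OF assms(1) _ pW, of n t] affine_translate_scale[OF assms(1) _ pW, of n "-t"] n by auto
        then show ?case using bspec[OF \<Theta>(3), of "p + t *\<^sub>R m"] elim by auto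
      qed
    qed
    have "\<forall>\<^sub>F t in at_right 0. u (p + t *\<^sub>R n) - u (p - t *\<^sub>R n) = v (p + t *\<^sub>R n) - v (p - t *\<^sub>R n)"
      using eq[OF disjI1[OF refl]] eq[OF disjI2[OF refl]] by eventually_elim simp
    then show ?thesis by (rule jump_cong)
  qed
  then show "\<exists>\<Theta>. finite \<Theta> \<and> (\<forall>h\<in>\<Theta>. \<not> vanishes_on h V) \<and>
    (\<forall>x\<in>V. norm x < R \<longrightarrow> (\<forall>h\<in>\<Theta>. aval h x \<noteq> 0) \<longrightarrow> x \<notin> {x. jump n u x \<noteq> jump n v x})"
    using \<Theta>(1) by (intro exI[of _ "{h\<in>\<Theta>. \<not> vanishes_on h V}"]) auto
qed

section \<open>Functions without jumps\<close>

(* Affine functionals are pairs; quantifiers over them must not be split into components. *)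
declare split_paired_All [simp del] split_paired_Ex [simp del]

lemma crosses_hyperplane_exists:
  assumes "affine W" "V = {x\<in>W. aval h x = 0}" "V \<noteq> {}" "\<not> vanishes_on h W"
  shows "\<exists>n. fst h \<bullet> n > 0 \<and> crosses W V {x\<in>W. aval h x \<ge> 0} n"
proof -
  obtain x0 where x0: "x0 \<in> W" "aval h x0 = 0" using assms by blast
  obtain w where w: "w \<in> W" "aval h w \<noteq> 0" using assms(4) by (auto simp: vanishes_on_def)
  \<comment> \<open>The factor \<open>aval h w\<close> turns \<open>w - x0\<close> to the positive
    side: \<open>h\<close> grows along \<open>n\<close> by a square.\<close>
  define n where "n = aval h w *\<^sub>R (w - x0)"
  have "fst h \<bullet> n = aval h w * aval h w"
    using x0 by (simp add: n_def aval_diff_inner[symmetric])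
  then have "fst h \<bullet> n > 0" using w by (metis not_real_square_gt_zero)
  moreover have "x + n \<in> W" if "x \<in> W" for x
    unfolding n_def using mem_affine_3_minus[OF assms(1) that w(1) x0(1)] .
  ultimately show ?thesis unfolding crosses_def using assms(2,3) by blast
qed

lemma locally_const_at_generic_point:
  assumes \<Sigma>: "finite \<Sigma>" "adapted_on \<Sigma> (ball 0 R) u"
    and p: "p \<in> W" "norm p < R" "\<And>h. h \<in> \<Sigma> \<Longrightarrow> \<not> vanishes_on h W \<Longrightarrow> aval h p \<noteq> 0"
  shows "\<exists>e>0. \<forall>z\<in>W. dist z p < e \<longrightarrow> norm z < R \<and> u z = u p"
proof -
  define \<Sigma>' where "\<Sigma>' = {h\<in>\<Sigma>. \<not> vanishes_on h W}"
  have "\<forall>\<^sub>F z in nhds p. \<forall>h\<in>\<Sigma>'. sgn (aval h z) = sgn (aval h p)"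
    using \<Sigma>(1) p(3) by (intro eventually_ball_finite ballI eventually_sgn_aval) (auto simp: \<Sigma>'_def)
  moreover have "\<forall>\<^sub>F z in nhds p. z \<in> ball 0 R" by (rule eventually_nhds_in_open) (use p in auto)
  ultimately have "\<forall>\<^sub>F z in nhds p. z \<in> W \<longrightarrow> norm z < R \<and> u z = u p"
  proof eventually_elim
    case (elim z)
    have "same_side \<Sigma> z p" if "z \<in> W"
      unfolding same_side_def
    proof
      fix h assume "h \<in> \<Sigma>"
      show "sgn (aval h z) = sgn (aval h p)"
      proof (cases "vanishes_on h W")
        case True
        then show ?thesis using that p(1) by (simp add: vanishes_on_def)
      next
        case False
        then show ?thesis using elim(1) \<open>h \<in> \<Sigma>\<close> unfolding \<Sigma>'_def by blast
      qed
    qed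
    then show ?case using adapted_onD[OF \<Sigma>(2), of z p] elim(2) p(2) by simp
  qed
  then show ?thesis unfolding eventually_nhds_metric by blast
qed

text \<open>Both points are joined by a line in \<open>W\<close>. The end \<open>y\<close> is first
  moved to a nearby \<open>y'\<close> so that the line meets each hyperplane section only where no
  second one passes and the jump is known to be 0; then \<open>u\<close> keeps its value at each
  crossing.\<close>

lemma zero_jumps_imp_const_on_ball:
  fixes u :: "'a::euclidean_space \<Rightarrow> real"
  assumes W: "affine W" and u: "locally_adapted u"
    and zj: "\<And>V H n. crosses W V H n \<Longrightarrow> thin V {x. jump n u x \<noteq> 0}"
    and \<Sigma>: "finite \<Sigma>" "adapted_on \<Sigma> (ball 0 R) u"
    and x: "x \<in> W" "norm x < R" "\<And>h. h \<in> \<Sigma> \<Longrightarrow> \<not> vanishes_on h W \<Longrightarrow> aval h x \<noteq> 0"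
    and y: "y \<in> W" "norm y < R" "\<And>h. h \<in> \<Sigma> \<Longrightarrow> \<not> vanishes_on h W \<Longrightarrow> aval h y \<noteq> 0"
  shows "u x = u y"
proof -
  define \<Sigma>' where "\<Sigma>' = {h\<in>\<Sigma>. \<not> vanishes_on h W}"
  define V where "V h = {x\<in>W. aval h x = 0}" for h
  define good where "good h n \<Theta> \<longleftrightarrow> fst h \<bullet> n > 0 \<and> crosses W (V h) {x\<in>W. aval h x \<ge> 0} n \<and> finite \<Theta> \<and>
      (\<forall>k\<in>\<Theta>. \<not> vanishes_on k (V h)) \<and>
      (\<forall>z\<in>V h. norm z < R \<longrightarrow> (\<forall>k\<in>\<Theta>. aval k z \<noteq> 0) \<longrightarrow> jump n u z = 0)" for h n \<Theta>
  have "\<exists>n \<Theta>. good h n \<Theta>" if "h \<in> \<Sigma>'" "V h \<noteq> {}" for h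
  proof -
    have "\<not> vanishes_on h W" using that by (simp add: \<Sigma>'_def)
    from crosses_hyperplane_exists[OF W V_def[of h] that(2) this]
    obtain n where n: "fst h \<bullet> n > 0" "crosses W (V h) {x\<in>W. aval h x \<ge> 0} n" by blast
    from thinD[OF zj[OF n(2)], of R] obtain \<Theta> where "finite \<Theta>" "\<forall>k\<in>\<Theta>. \<not> vanishes_on k (V h)"
      "\<forall>z\<in>V h. norm z < R \<longrightarrow> (\<forall>k\<in>\<Theta>. aval k z \<noteq> 0) \<longrightarrow> z \<notin> {x. jump n u x \<noteq> 0}" by blast
    then have "good h n \<Theta>" using n by (simp add: good_def)
    then show ?thesis by blast
  qed
  then obtain n \<Theta> where "\<And>h. h \<in> \<Sigma>' \<Longrightarrow> V h \<noteq> {} \<Longrightarrow> good h (n h) (\<Theta> h)" by metis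
  note n\<Theta> = this[unfolded good_def]
  \<comment> \<open>The points of \<open>V h\<close> that the line has to avoid: those where the
    jump may be non-zero, and those on a second hyperplane section.\<close>
  define \<Xi> where "\<Xi> h = \<Theta> h \<union> {k\<in>\<Sigma>. \<not> vanishes_on k (V h)}" for h
  \<comment> \<open>\<open>\<psi> h \<theta>\<close> vanishes at \<open>x\<close> and wherever
    \<open>h\<close> and \<theta> both vanish: its zeros form the hyperplane through
    \<open>x\<close> that contains the set of codimension 2 to be avoided. A line from
    \<open>x\<close> to a point off it leaves it at once, and \<open>x\<close> itself is off
    \<open>h\<close>.\<close>
  define \<psi> where "\<psi> h \<theta> = (aval h x *\<^sub>R fst \<theta> - aval \<theta> x *\<^sub>R fst h, aval h x * snd \<theta> - aval \<theta> x * snd h)" for h \<theta>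
  have \<psi>: "aval (\<psi> h \<theta>) z = aval h x * aval \<theta> z - aval \<theta> x * aval h z" for h \<theta> z
    by (simp add: \<psi>_def aval_def inner_diff_left algebra_simps)
  define \<Psi> where "\<Psi> = (\<Union>h\<in>{h\<in>\<Sigma>'. V h \<noteq> {}}. \<psi> h ` \<Xi> h)"
  have fin: "finite \<Psi>" unfolding \<Psi>_def \<Xi>_def using \<Sigma>(1) n\<Theta> by (auto simp: \<Sigma>'_def)
  have \<Psi>nv: "\<not> vanishes_on k W" if "k \<in> \<Psi>" for k
  proof -
    from that[unfolded \<Psi>_def] obtain h \<theta> where h: "h \<in> \<Sigma>'" "V h \<noteq> {}" "\<theta> \<in> \<Xi> h" "k = \<psi> h \<theta>" by blast
    then have "\<not> vanishes_on \<theta> (V h)" using n\<Theta>[of h] by (auto simp: \<Xi>_def)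
    then obtain z where "z \<in> W" "aval h z = 0" "aval \<theta> z \<noteq> 0" by (auto simp: vanishes_on_def V_def)
    moreover have "aval h x \<noteq> 0" using x(3)[of h] h(1) unfolding \<Sigma>'_def by blast
    ultimately have "aval k z \<noteq> 0" "z \<in> W" using h(4) \<psi> by auto
    then show ?thesis by (auto simp: vanishes_on_def)
  qed
  have near: "\<exists>e>0. \<forall>z\<in>W. dist z p < e \<longrightarrow> norm z < R \<and> u z = u p"
    if "p \<in> W" "norm p < R" "\<And>h. h \<in> \<Sigma>' \<Longrightarrow> aval h p \<noteq> 0" for p
    by (rule locally_const_at_generic_point[OF \<Sigma> that(1,2)]) (use that(3) in \<open>auto simp: \<Sigma>'_def\<close>)
  obtain e where e: "e > 0" "\<And>z. z \<in> W \<Longrightarrow> dist z y < e \<Longrightarrow> norm z < R \<and> u z = u y"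
  proof -
    have "\<exists>e>0. \<forall>z\<in>W. dist z y < e \<longrightarrow> norm z < R \<and> u z = u y"
      by (rule near) (use y in \<open>auto simp: \<Sigma>'_def\<close>)
    then show thesis using that by blast
  qed
  have "\<exists>z\<in>W \<inter> ball y e. \<forall>h\<in>\<Psi> \<union> \<Sigma>'. aval h z \<noteq> 0"
    using \<Sigma>(1) fin \<Psi>nv by (intro generic_point_exists W y e) (auto simp: \<Sigma>'_def)
  then obtain y' where y'0: "y' \<in> W \<inter> ball y e" "\<forall>h\<in>\<Psi> \<union> \<Sigma>'. aval h y' \<noteq> 0" by blast
  have y': "y' \<in> W" "norm y' < R" "u y' = u y" "\<And>h. h \<in> \<Psi> \<Longrightarrow> aval h y' \<noteq> 0" "\<And>h. h \<in> \<Sigma>' \<Longrightarrow> aval h y' \<noteq> 0"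
    using y'0 e(2)[of y'] by (auto simp: dist_commute)
  define \<Lambda> where "\<Lambda> = range (\<lambda>t. x + t *\<^sub>R (y' - x))"
  have \<Lambda>aff: "affine \<Lambda>"
  proof -
    have "\<Lambda> = affine hull {x, y'}"
      unfolding affine_hull_2 \<Lambda>_def
    proof (intro set_eqI iffI)
      fix z assume "z \<in> range (\<lambda>t. x + t *\<^sub>R (y' - x))"
      then obtain t where "z = x + t *\<^sub>R (y' - x)" by blast
      then have "z = (1 - t) *\<^sub>R x + t *\<^sub>R y'" by (simp add: algebra_simps)
      then show "z \<in> {u *\<^sub>R x + v *\<^sub>R y' |u v. u + v = 1}" by force
    next
      fix z assume "z \<in> {u *\<^sub>R x + v *\<^sub>R y' |u v. u + v = 1}"
      then obtain s t where "z = s *\<^sub>R x + t *\<^sub>R y'" "s + t = 1" by blast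
      then have "s = 1 - t" by simp
      with \<open>z = s *\<^sub>R x + t *\<^sub>R y'\<close> have "z = x + t *\<^sub>R (y' - x)" by (simp add: algebra_simps)
      then show "z \<in> range (\<lambda>t. x + t *\<^sub>R (y' - x))" by blast
    qed
    then show ?thesis by simp
  qed
  have \<Lambda>W: "\<Lambda> \<subseteq> W" unfolding \<Lambda>_def using affine_line[OF W x(1) y'(1)] by blast
  have x\<Lambda>: "x \<in> \<Lambda>" unfolding \<Lambda>_def by (rule range_eqI[of _ _ 0]) simp
  have y\<Lambda>: "y' \<in> \<Lambda>" unfolding \<Lambda>_def by (rule range_eqI[of _ _ 1]) simp
  define S where "S = \<Lambda> \<inter> ball 0 R"
  have conn: "connected S"
    unfolding S_def by (intro convex_connected convex_Int affine_imp_convex \<Lambda>aff convex_ball)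
  have "u y' = u x"
  \<comment> \<open>The values of \<open>u\<close> are compared only at points of the chord off the
    hyperplanes of \<open>\<Sigma>'\<close>. These are dense in the chord, and the last subgoal
    shows that near any \<open>p\<close> they all give the same value.\<close>
  proof (rule connected_induction[OF conn, of "\<lambda>z. \<forall>h\<in>\<Sigma>'. aval h z \<noteq> 0" "\<lambda>z. u z = u x" x y'])
    show "x \<in> S" "y' \<in> S" using x y' x\<Lambda> y\<Lambda> by (auto simp: S_def)
    show "\<forall>h\<in>\<Sigma>'. aval h x \<noteq> 0" using x(3) by (auto simp: \<Sigma>'_def)
    show "\<forall>h\<in>\<Sigma>'. aval h y' \<noteq> 0" using y'(5) by blast
    show "u x = u x" ..
  next
    fix T a assume T: "openin (top_of_set S) T" "a \<in> T"
    obtain O' where O': "open O'" "T = S \<inter> O'" using T(1) by (auto simp: openin_open)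
    have "open (O' \<inter> ball 0 R)" "a \<in> O' \<inter> ball 0 R" using O' T(2) by (auto simp: S_def)
    then obtain e where e: "e > 0" "ball a e \<subseteq> O' \<inter> ball 0 R" using open_contains_ball by blast
    have "\<not> vanishes_on h \<Lambda>" if "h \<in> \<Sigma>'" for h
      using x(3)[of h] x\<Lambda> that unfolding \<Sigma>'_def vanishes_on_def by blast
    then have "\<exists>z\<in>\<Lambda> \<inter> ball a e. \<forall>h\<in>\<Sigma>'. aval h z \<noteq> 0"
      using \<Sigma>(1) e T(2) O'(2) by (intro generic_point_exists \<Lambda>aff) (auto simp: S_def \<Sigma>'_def)
    then show "\<exists>z. z \<in> T \<and> (\<forall>h\<in>\<Sigma>'. aval h z \<noteq> 0)"
      using e(2) O'(2) unfolding S_def by blast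
  next
    fix p assume "p \<in> S"
    then have p: "p \<in> \<Lambda>" "p \<in> W" "norm p < R" using \<Lambda>W by (auto simp: S_def)
    have "\<exists>e>0. \<exists>c. \<forall>z\<in>S. dist z p < e \<longrightarrow> (\<forall>h\<in>\<Sigma>'. aval h z \<noteq> 0) \<longrightarrow> u z = c"
    proof (cases "\<forall>h\<in>\<Sigma>'. aval h p \<noteq> 0")
      case True
      then show ?thesis using near[OF p(2,3)] \<Lambda>W unfolding S_def by blast
    next
      case False
      then obtain h0 where h0: "h0 \<in> \<Sigma>'" "aval h0 p = 0" by blast
      have pV: "p \<in> V h0" using h0 p by (simp add: V_def)
      note n0 = n\<Theta>[OF h0(1)]
      have avoid: "aval \<theta> p \<noteq> 0" if "\<theta> \<in> \<Xi> h0" for \<theta>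
      proof
        assume "aval \<theta> p = 0"
        then have z: "aval (\<psi> h0 \<theta>) p = 0" using h0(2) by (simp add: \<psi>)
        \<comment> \<open>Along the line \<open>\<psi> h0 \<theta>\<close> is proportional to
          \<open>t\<close>, as it vanishes at \<open>x\<close>. A zero at \<open>p\<close> and a
          non-zero value at \<open>y'\<close> leave only \<open>p = x\<close>, which is off
          \<open>h0\<close>.\<close>
        obtain t where t: "p = x + t *\<^sub>R (y' - x)" using p(1) by (auto simp: \<Lambda>_def)
        have "aval (\<psi> h0 \<theta>) p = t * aval (\<psi> h0 \<theta>) y'" unfolding t aval_line by (simp add: \<psi>)
        moreover have "aval (\<psi> h0 \<theta>) y' \<noteq> 0" using y'(4) h0 pV that unfolding \<Psi>_def by blast
        ultimately have "t = 0" using z by simp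
        then have "p = x" using t by simp
        then show False using h0 x(3)[of h0] unfolding \<Sigma>'_def by blast
      qed
      have nv: "\<not> vanishes_on h0 W" using h0 by (simp add: \<Sigma>'_def)
      obtain e where e: "e > 0" "\<And>x y. x \<in> W \<Longrightarrow> y \<in> W \<Longrightarrow> dist p x < e \<Longrightarrow> dist p y < e \<Longrightarrow> sgn (aval h0 x) = sgn (aval h0 y) \<Longrightarrow> same_side \<Sigma> x y"
      proof (rule same_side_near_generic_point[OF W V_def pV nv \<Sigma>(1)])
        show "vanishes_on h (V h0)" if "h \<in> \<Sigma>" "aval h p = 0" for h
          using avoid[of h] that by (auto simp: \<Xi>_def)
      qed blast
      have j: "jump (n h0) u p = 0" 
      proof -
        have "\<forall>k\<in>\<Theta> h0. aval k p \<noteq> 0" using avoid unfolding \<Xi>_def by blast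
        then show ?thesis using n0 pV p(3) by blast
      qed
      have "\<forall>\<^sub>F t in at_right 0. u (p + t *\<^sub>R n h0) - u (p - t *\<^sub>R n h0) = 0"
        using eventually_jump[OF u, of p "n h0"] j by simp
      moreover have "\<forall>\<^sub>F t in at_right 0. p + t *\<^sub>R n h0 \<in> ball p e \<inter> ball 0 R"
        by (rule eventually_at_right_in_open) (use e(1) p(3) in auto)
      moreover have "\<forall>\<^sub>F t in at_right 0. p - t *\<^sub>R n h0 \<in> ball p e \<inter> ball 0 R"
        by (rule eventually_at_right_in_open_minus) (use e(1) p(3) in auto)
      moreover have "\<forall>\<^sub>F t in at_right (0::real). t > 0" by (simp add: eventually_at_right_less)
      ultimately have "\<forall>\<^sub>F t in at_right 0. 0 < t \<and> p + t *\<^sub>R n h0 \<in> ball p e \<inter> ball 0 R \<and> p - t *\<^sub>R n h0 \<in> ball p e \<inter> ball 0 R \<and> u (p + t *\<^sub>R n h0) = u (p - t *\<^sub>R n h0)"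
        by eventually_elim simp
      then obtain t where t: "0 < t" "p + t *\<^sub>R n h0 \<in> ball p e \<inter> ball 0 R" "p - t *\<^sub>R n h0 \<in> ball p e \<inter> ball 0 R" "u (p + t *\<^sub>R n h0) = u (p - t *\<^sub>R n h0)"
        using eventually_happens'[OF trivial_limit_at_right_real] by blast
      have nW: "\<And>x. x \<in> W \<Longrightarrow> x + n h0 \<in> W" using n0 pV unfolding crosses_def by blast
      have tW: "p + t *\<^sub>R n h0 \<in> W" "p - t *\<^sub>R n h0 \<in> W"
        using affine_translate_scale[OF W nW p(2), of t] affine_translate_scale[OF W nW p(2), of "-t"] by auto
      have pos: "fst h0 \<bullet> n h0 > 0" using n0 pV by blast
      have s: "aval h0 (p + t *\<^sub>R n h0) > 0" using pos t(1) h0(2) by (simp add: aval_add)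
      have s': "aval h0 (p - t *\<^sub>R n h0) < 0" using pos t(1) h0(2) aval_add[of h0 p "- (t *\<^sub>R n h0)"] by simp
      \<comment> \<open>Near \<open>p\<close>, \<open>u\<close> has one value on each side of
        \<open>V h0\<close>, attained at \<open>p + t n\<close> and \<open>p - t n\<close>; the zero
        jump makes the two equal.\<close>
      have "u z = u (p + t *\<^sub>R n h0)" if z: "z \<in> S" "dist z p < e" "\<forall>h\<in>\<Sigma>'. aval h z \<noteq> 0" for z
      proof -
        have zW: "z \<in> W" "z \<in> ball 0 R" using z \<Lambda>W by (auto simp: S_def)
        have "aval h0 z \<noteq> 0" using z h0 by blast
        then consider "aval h0 z > 0" | "aval h0 z < 0" by linarith
        then show ?thesis
        proof cases
          case 1
          have "same_side \<Sigma> z (p + t *\<^sub>R n h0)"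
            by (rule e(2)) (use zW tW z t 1 s in \<open>auto simp: dist_commute\<close>)
          then show ?thesis using adapted_onD[OF \<Sigma>(2)] zW t by blast
        next
          case 2
          have "same_side \<Sigma> z (p - t *\<^sub>R n h0)"
            by (rule e(2)) (use zW tW z t 2 s' in \<open>auto simp: dist_commute\<close>)
          then have "u z = u (p - t *\<^sub>R n h0)" using adapted_onD[OF \<Sigma>(2)] zW t by blast
          then show ?thesis using t(4) by simp
        qed
      qed
      then show ?thesis using e(1) by blast
    qed
    then obtain e c where ec: "e > 0" "\<forall>z\<in>S. dist z p < e \<longrightarrow> (\<forall>h\<in>\<Sigma>'. aval h z \<noteq> 0) \<longrightarrow> u z = c" by blast
    have "openin (top_of_set S) (S \<inter> ball p e)" by (simp add: openin_open_Int)
    moreover have "p \<in> S \<inter> ball p e" using \<open>p \<in> S\<close> ec(1) by simp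
    moreover have "\<forall>z\<in>S \<inter> ball p e. \<forall>z'\<in>S \<inter> ball p e. (\<forall>h\<in>\<Sigma>'. aval h z \<noteq> 0) \<and> (\<forall>h\<in>\<Sigma>'. aval h z' \<noteq> 0) \<and> u z = u x \<longrightarrow> u z' = u x"
    proof (intro ballI impI)
      fix z z' assume "z \<in> S \<inter> ball p e" "z' \<in> S \<inter> ball p e"
        and a: "(\<forall>h\<in>\<Sigma>'. aval h z \<noteq> 0) \<and> (\<forall>h\<in>\<Sigma>'. aval h z' \<noteq> 0) \<and> u z = u x"
      then have "u z = c" "u z' = c" using ec(2) by (auto simp: dist_commute)
      then show "u z' = u x" using a by simp
    qed
    ultimately show "\<exists>T. openin (top_of_set S) T \<and> p \<in> T \<and> (\<forall>z\<in>T. \<forall>z'\<in>T. (\<forall>h\<in>\<Sigma>'. aval h z \<noteq> 0) \<and> (\<forall>h\<in>\<Sigma>'. aval h z' \<noteq> 0) \<and> u z = u x \<longrightarrow> u z' = u x)"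
      by blast
  qed
  then show ?thesis using y'(3) by simp
qed

text \<open>The constants on different balls agree because all larger balls share generic points
  with the fixed ball of radius \<open>R0\<close>.\<close>

lemma zero_jumps_imp_generically_const:
  fixes u :: "'a::euclidean_space \<Rightarrow> real"
  assumes W: "affine W" "W \<noteq> {}" and u: "locally_adapted u"
    and zj: "\<And>V H n. crosses W V H n \<Longrightarrow> thin V {x. jump n u x \<noteq> 0}"
  shows "\<exists>c. thin W {x. u x \<noteq> c}"
proof -
  obtain x0 where x0: "x0 \<in> W" using W by blast
  have "\<forall>R. \<exists>\<Sigma>. finite \<Sigma> \<and> adapted_on \<Sigma> (ball 0 R) u"
    using u unfolding locally_adapted_def .
  then obtain \<Sigma> where \<Sigma>: "\<And>R. finite (\<Sigma> R)" "\<And>R. adapted_on (\<Sigma> R) (ball 0 R) u" by metis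
  define \<Sigma>' where "\<Sigma>' R = {h\<in>\<Sigma> R. \<not> vanishes_on h W}" for R
  have const: "u x = u y" if "x \<in> W" "norm x < R" "\<forall>h\<in>\<Sigma>' R. aval h x \<noteq> 0" "y \<in> W" "norm y < R" "\<forall>h\<in>\<Sigma>' R. aval h y \<noteq> 0" for x y R
    by (rule zero_jumps_imp_const_on_ball[OF W(1) u zj \<Sigma>(1) \<Sigma>(2)[of R]]) (use that in \<open>auto simp: \<Sigma>'_def\<close>)
  define R0 where "R0 = norm x0 + 1"
  have pt: "\<exists>y\<in>W. norm y < R0 \<and> (\<forall>h\<in>\<Sigma>' R0 \<union> \<Sigma>' R. aval h y \<noteq> 0)" for R
  proof -
    have "\<exists>y\<in>W \<inter> ball x0 1. \<forall>h\<in>\<Sigma>' R0 \<union> \<Sigma>' R. aval h y \<noteq> 0"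
      using \<Sigma>(1) by (intro generic_point_exists W x0) (auto simp: \<Sigma>'_def)
    then obtain y where y: "y \<in> W" "dist x0 y < 1" "\<forall>h\<in>\<Sigma>' R0 \<union> \<Sigma>' R. aval h y \<noteq> 0" by auto
    have "norm y < R0" using y(2) norm_triangle_ineq2[of y x0] by (simp add: R0_def dist_norm norm_minus_commute)
    then show ?thesis using y by blast
  qed
  obtain y0 where y0: "y0 \<in> W" "norm y0 < R0" "\<forall>h\<in>\<Sigma>' R0. aval h y0 \<noteq> 0" using pt by blast
  have "u z = u y0" if z: "z \<in> W" "norm z < R" "\<forall>h\<in>\<Sigma>' (max R R0). aval h z \<noteq> 0" for z R
  proof -
    obtain y where y: "y \<in> W" "norm y < R0" "\<forall>h\<in>\<Sigma>' R0 \<union> \<Sigma>' (max R R0). aval h y \<noteq> 0" using pt by blast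
    have "u z = u y" by (rule const[of z "max R R0"]) (use z y in auto)
    also have "u y = u y0" by (rule const[of y R0]) (use y y0 in auto)
    finally show ?thesis .
  qed
  then have "thin W {x. u x \<noteq> u y0}"
    by (intro thinI, rule_tac x="\<Sigma>' (max R R0)" in exI) (use \<Sigma>(1) in \<open>auto simp: \<Sigma>'_def\<close>)
  then show ?thesis by blast
qed

section \<open>Facets\<close>

lemma aval_uminus: "aval (- fst h, - snd h) x = - aval h x"
  by (simp add: aval_def)

lemma affine_hyperplane_section: "affine W \<Longrightarrow> affine {x\<in>W. aval h x = 0}"
proof -
  assume "affine W"
  moreover have "{x\<in>W. aval h x = 0} = W \<inter> {x. fst h \<bullet> x = snd h}" by (auto simp: aval_def)
  ultimately show ?thesis by (simp add: affine_Int affine_hyperplane)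
qed

lemma half_spaceD:
  assumes "half_space_of W V H"
  shows "\<exists>h. V = {x\<in>W. aval h x = 0} \<and> H = {x\<in>W. aval h x \<ge> 0} \<and> \<not> vanishes_on h W \<and> V \<noteq> {}"
proof -
  obtain a b where "V \<noteq> {}" "V \<noteq> W" "V = {x\<in>W. a \<bullet> x = b}" "H = {x\<in>W. a \<bullet> x \<ge> b}"
    using assms unfolding half_space_of_def by blast
  then show ?thesis by (intro exI[of _ "(a, b)"]) (auto simp: aval_def vanishes_on_def)
qed

lemma half_space_subset: "half_space_of W V H \<Longrightarrow> V \<subseteq> H"
  unfolding half_space_of_def by auto

lemma half_spaceI:
  assumes "V = {x\<in>W. aval h x = 0}" "H = {x\<in>W. aval h x \<ge> 0}" "\<not> vanishes_on h W" "V \<noteq> {}"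
  shows "half_space_of W V H"
  using assms unfolding half_space_of_def vanishes_on_def aval_def by auto

lemma crosses_imp_half_space: "crosses W V H n \<Longrightarrow> half_space_of W V H"
proof -
  assume "crosses W V H n"
  then obtain h where h: "V = {x\<in>W. aval h x = 0}" "H = {x\<in>W. aval h x \<ge> 0}" "fst h \<bullet> n > 0"
    and *: "V \<noteq> {}" "\<forall>x\<in>W. x + n \<in> W"
    unfolding crosses_def by blast
  show ?thesis by (rule half_spaceI[OF h(1,2) not_vanishes_on_crossed[OF h(1) * h(3)] *(1)])
qed

section \<open>Germs of sets and half-spaces\<close>

lemma agree_near_trans:
  assumes "agree_near x P Q" "agree_near x P Q'" shows "agree_near x Q Q'"
proof -
  obtain e e' where "e > 0" "e' > 0" "P \<inter> ball x e = Q \<inter> ball x e" "P \<inter> ball x e' = Q' \<inter> ball x e'"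
    using assms unfolding agree_near_def by blast
  then show ?thesis unfolding agree_near_def
    by (intro exI[of _ "min e e'"]) (auto simp: set_eq_iff)
qed

lemma agree_near_nearby:
  assumes "agree_near x P Q" obtains e where "e > 0" "\<And>y. dist x y < e \<Longrightarrow> agree_near y P Q"
proof -
  obtain e where e: "e > 0" "P \<inter> ball x e = Q \<inter> ball x e" using assms unfolding agree_near_def by blast
  have "agree_near y P Q" if "dist x y < e" for y
  proof -
    have "ball y (e - dist x y) \<subseteq> ball x e"
    proof
      fix z assume "z \<in> ball y (e - dist x y)"
      then show "z \<in> ball x e" using dist_triangle[of x z y] by simp
    qed
    then have "P \<inter> ball y (e - dist x y) = Q \<inter> ball y (e - dist x y)" using e(2) by blast
    then show ?thesis unfolding agree_near_def using that by (intro exI[of _ "e - dist x y"]) simp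
  qed
  then show thesis using that e(1) by blast
qed

lemma small_step_in_ball:
  fixes x w :: "'a::real_normed_vector"
  assumes "e > 0" obtains t where "t > 0" "x + t *\<^sub>R w \<in> ball x e" "x - t *\<^sub>R w \<in> ball x e"
proof -
  have "\<forall>\<^sub>F t in at_right 0. x + t *\<^sub>R w \<in> ball x e"
    by (rule eventually_at_right_in_open) (use assms in auto)
  moreover have "\<forall>\<^sub>F t in at_right 0. x - t *\<^sub>R w \<in> ball x e"
    by (rule eventually_at_right_in_open_minus) (use assms in auto)
  moreover have "\<forall>\<^sub>F t in at_right (0::real). t > 0" by (simp add: eventually_at_right_less)
  ultimately have "\<forall>\<^sub>F t in at_right 0. 0 < t \<and> x + t *\<^sub>R w \<in> ball x e \<and> x - t *\<^sub>R w \<in> ball x e"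
    by eventually_elim simp
  then show thesis using that eventually_happens'[OF trivial_limit_at_right_real] by blast
qed

lemma affine_line_minus: "affine W \<Longrightarrow> x \<in> W \<Longrightarrow> y \<in> W \<Longrightarrow> x - t *\<^sub>R (y - x) \<in> W"
  using affine_line[of W x y "- t"] by simp

lemma aval_step: "aval h x = 0 \<Longrightarrow> aval h (x + t *\<^sub>R (w - x)) = t * aval h w"
  "aval h x = 0 \<Longrightarrow> aval h (x - t *\<^sub>R (w - x)) = - t * aval h w"
  using aval_line[of h x t w] aval_line[of h x "- t" w] by auto

text \<open>Each \<open>w\<close> in \<open>W\<close> is tested by the points
  \<open>x + t (w - x)\<close> and \<open>x - t (w - x)\<close> close to \<open>x\<close>: which of
  them belong to the half-space tells the sign of its functional at \<open>w\<close>.\<close>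

lemma half_space_determined_near:
  assumes W: "affine W" and "half_space_of W V H" "half_space_of W V' H'" "x \<in> V" "x \<in> V'" "agree_near x H H'"
  shows "V = V'" "H = H'"
proof -
  obtain h where h: "V = {x\<in>W. aval h x = 0}" "H = {x\<in>W. aval h x \<ge> 0}" using half_spaceD[OF assms(2)] by blast
  obtain h' where h': "V' = {x\<in>W. aval h' x = 0}" "H' = {x\<in>W. aval h' x \<ge> 0}" using half_spaceD[OF assms(3)] by blast
  obtain e where e: "e > 0" "H \<inter> ball x e = H' \<inter> ball x e" using assms(6) unfolding agree_near_def by blast
  have x: "x \<in> W" "aval h x = 0" "aval h' x = 0" using assms h h' by auto
  have s: "aval h w \<ge> 0 \<longleftrightarrow> aval h' w \<ge> 0" "aval h w \<le> 0 \<longleftrightarrow> aval h' w \<le> 0" if w: "w \<in> W" for w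
  proof -
    obtain t where t: "t > 0" "x + t *\<^sub>R (w - x) \<in> ball x e" "x - t *\<^sub>R (w - x) \<in> ball x e"
      using small_step_in_ball[OF e(1)] by blast
    have "x + t *\<^sub>R (w - x) \<in> H \<longleftrightarrow> x + t *\<^sub>R (w - x) \<in> H'" "x - t *\<^sub>R (w - x) \<in> H \<longleftrightarrow> x - t *\<^sub>R (w - x) \<in> H'"
      using e(2) t by blast+
    then have "t * aval h w \<ge> 0 \<longleftrightarrow> t * aval h' w \<ge> 0" "t * aval h w \<le> 0 \<longleftrightarrow> t * aval h' w \<le> 0"
      using affine_line[OF W x(1) w, of t] affine_line_minus[OF W x(1) w, of t]
        aval_step[OF x(2), of t w] aval_step[OF x(3), of t w] h(2) h'(2) by auto
    then show "aval h w \<ge> 0 \<longleftrightarrow> aval h' w \<ge> 0" "aval h w \<le> 0 \<longleftrightarrow> aval h' w \<le> 0"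
      using t(1) by (simp_all add: zero_le_mult_iff mult_le_0_iff)
  qed
  show "H = H'" using s h(2) h'(2) by auto
  have "aval h w = 0 \<longleftrightarrow> aval h' w = 0" if "w \<in> W" for w using s[OF that] by linarith
  then show "V = V'" using h(1) h'(1) by auto
qed

lemma facet_points_subset: "facet_points P \<subseteq> P"
proof
  fix x assume "x \<in> facet_points P"
  then obtain V H where VH: "half_space_of (affine hull P) V H" "x \<in> V" "agree_near x P H"
    unfolding facet_points_def by blast
  obtain e where "e > 0" "P \<inter> ball x e = H \<inter> ball x e" using VH(3) unfolding agree_near_def by blast
  moreover have "x \<in> H" using half_space_subset[OF VH(1)] VH(2) by blast
  ultimately show "x \<in> P" using centre_in_ball by blast
qed

text \<open>At a point of \<open>P\<close> near \<open>x\<close> but off \<open>V\<close>,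
  \<open>P\<close> fills a neighbourhood within its affine hull, and such a germ is not a
  half-space. So near \<open>x\<close> the facet points are those of \<open>V\<close>.\<close>

lemma facet_points_near:
  assumes hs: "half_space_of (affine hull P) V H" and "x \<in> V" "agree_near x P H"
  shows "\<exists>e>0. V \<inter> ball x e \<subseteq> facet_points P \<and>
    (\<forall>y\<in>facet_points P. dist x y < e \<longrightarrow> y \<in> V \<and> agree_near y P H)"
proof -
  define W where "W = affine hull P"
  have W: "affine W" by (simp add: W_def)
  obtain h where h: "V = {x\<in>W. aval h x = 0}" "H = {x\<in>W. aval h x \<ge> 0}" using half_spaceD[OF hs] W_def by blast
  obtain e where e: "e > 0" "P \<inter> ball x e = H \<inter> ball x e" using assms(3) unfolding agree_near_def by blast
  obtain e' where e': "e' > 0" "\<And>y. dist x y < e' \<Longrightarrow> agree_near y P H" using agree_near_nearby[OF assms(3)] by blast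
  have "y \<in> V" if y: "y \<in> facet_points P" "dist x y < min e e'" for y
  proof (rule ccontr)
    assume "y \<notin> V"
    obtain V2 H2 where VH2: "half_space_of W V2 H2" "y \<in> V2" "agree_near y P H2"
      using y(1) unfolding facet_points_def W_def by blast
    obtain h2 where h2: "V2 = {x\<in>W. aval h2 x = 0}" "H2 = {x\<in>W. aval h2 x \<ge> 0}" "\<not> vanishes_on h2 W"
      using half_spaceD[OF VH2(1)] by blast
    have "y \<in> P" using y facet_points_subset by blast
    then have "y \<in> H" using e y by (auto simp: set_eq_iff)
    then have pos: "aval h y > 0" and yW: "y \<in> W" using \<open>y \<notin> V\<close> h by auto
    have "agree_near y H H2" using agree_near_trans e'(2)[of y] VH2(3) y(2) by auto
    then obtain d where d: "d > 0" "H \<inter> ball y d = H2 \<inter> ball y d" unfolding agree_near_def by blast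
    have "\<forall>\<^sub>F z in nhds y. sgn (aval h z) = sgn (aval h y)" using eventually_sgn_aval pos by (metis less_irrefl)
    then obtain d' where d': "d' > 0" "\<And>z. dist z y < d' \<Longrightarrow> sgn (aval h z) = sgn (aval h y)"
      unfolding eventually_nhds_metric by blast
    obtain w where w: "w \<in> W" "aval h2 w \<noteq> 0" using h2(3) unfolding vanishes_on_def by blast
    have dd: "min d d' > 0" using d d' by simp
    obtain t where t: "t > 0" "y + t *\<^sub>R (w - y) \<in> ball y (min d d')" "y - t *\<^sub>R (w - y) \<in> ball y (min d d')"
      using small_step_in_ball[OF dd] by blast
    have inH: "z \<in> H2" if "z \<in> W" "z \<in> ball y (min d d')" for z
    proof -
      have "aval h z > 0" using d'(2)[of z] that pos by (auto simp: dist_commute sgn_real_def split: if_splits)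
      then have "z \<in> H" using h that by auto
      then show ?thesis using d(2) that by (auto simp: set_eq_iff)
    qed
    have "aval h2 y = 0" using VH2 h2 by blast
    then have "t * aval h2 w \<ge> 0" "- t * aval h2 w \<ge> 0"
      using inH[OF affine_line[OF W yW w(1)] t(2)] inH[OF affine_line_minus[OF W yW w(1)] t(3)] h2(2) aval_step[of h2 y t w] by auto
    then have "t * aval h2 w = 0" by linarith
    then show False using t(1) w(2) by simp
  qed
  moreover have "V \<inter> ball x (min e e') \<subseteq> facet_points P"
  proof
    fix y assume "y \<in> V \<inter> ball x (min e e')"
    then have "y \<in> V" "agree_near y P H" using e'(2)[of y] by auto
    then show "y \<in> facet_points P" using hs unfolding facet_points_def by blast
  qed
  ultimately show ?thesis using e(1) e'(1,2) by (intro exI[of _ "min e e'"]) auto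
qed

text \<open>The half-space is determined by the germ of \<open>P\<close>, hence locally constant
  along the facet points, hence constant on a component. So a facet lies in one hyperplane, and
  \<open>P\<close> lies on one side of it.\<close>

lemma facet_component_half_space:
  assumes hs: "half_space_of (affine hull P) V H" and C: "C \<in> components (facet_points P)"
    and x: "x \<in> C" "x \<in> V" "agree_near x P H" and "y \<in> C"
  shows "y \<in> V \<and> agree_near y P H"
proof (rule connected_induction_simple[of C x y])
  show "connected C" using C by (rule in_components_connected)
  show "x \<in> C" "y \<in> C" "x \<in> V \<and> agree_near x P H" using assms by auto
  fix a assume a: "a \<in> C"
  then have "a \<in> facet_points P" using C in_components_subset by blast
  then obtain V' H' where VH': "half_space_of (affine hull P) V' H'" "a \<in> V'" "agree_near a P H'"
    unfolding facet_points_def by blast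
  obtain e where e: "e > 0" "\<forall>y\<in>facet_points P. dist a y < e \<longrightarrow> y \<in> V' \<and> agree_near y P H'"
    using facet_points_near[OF VH'] by blast
  have "z' \<in> V \<and> agree_near z' P H" if z: "z \<in> C \<inter> ball a e" "z' \<in> C \<inter> ball a e" "z \<in> V \<and> agree_near z P H" for z z'
  proof -
    have zf: "z \<in> facet_points P" "z' \<in> facet_points P" using z C in_components_subset by blast+
    have "z \<in> V' \<and> agree_near z P H'" "z' \<in> V' \<and> agree_near z' P H'" using e(2) zf z by auto
    moreover have "V = V'" "H = H'"
      using half_space_determined_near[OF _ hs VH'(1), of z] z(3) calculation agree_near_trans by auto
    ultimately show ?thesis by simp
  qed
  then show "\<exists>T. openin (top_of_set C) T \<and> a \<in> T \<and> (\<forall>z\<in>T. \<forall>z'\<in>T. z \<in> V \<and> agree_near z P H \<longrightarrow> z' \<in> V \<and> agree_near z' P H)"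
  proof (intro exI[of _ "C \<inter> ball a e"] conjI ballI impI)
    show "openin (top_of_set C) (C \<inter> ball a e)" by (simp add: openin_open_Int)
    show "a \<in> C \<inter> ball a e" using a e(1) by simp
  qed blast+
qed

lemma affine_hull_translate_mem:
  assumes "affine W" "x \<in> W" "y \<in> W" "z \<in> W" shows "z + (y - x) \<in> W"
  using mem_affine_3_minus[OF assms(1) assms(4) assms(3) assms(2), of 1] by simp

text \<open>The shift by \<open>y - x\<close> carries the germ of \<open>P\<close> at
  \<open>x\<close> to the germ at \<open>y\<close>; both points lie in the affine hull, which this
  shift preserves.\<close>

lemma adapted_facet_points:
  assumes "finite \<Sigma>" "adapted \<Sigma> P" shows "adapted \<Sigma> (facet_points P)"
proof -
  have "y \<in> facet_points P" if x: "x \<in> facet_points P" and xy: "same_side \<Sigma> x y" for x y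
  proof -
    define W where "W = affine hull P"
    have W: "affine W" by (simp add: W_def)
    obtain V H where VH: "half_space_of W V H" "x \<in> V" "agree_near x P H"
      using x unfolding facet_points_def W_def by blast
    obtain h where h: "V = {x\<in>W. aval h x = 0}" "H = {x\<in>W. aval h x \<ge> 0}" "\<not> vanishes_on h W" "V \<noteq> {}"
      using half_spaceD[OF VH(1)] by blast
    have xP: "x \<in> P" using x facet_points_subset by blast
    then have yP: "y \<in> P" using adapted_onD[OF assms(2)] xy by blast
    have PW: "P \<subseteq> W" by (simp add: W_def hull_subset)
    have xW: "x \<in> W" and yW: "y \<in> W" using xP yP PW by auto
    define h' where "h' = (fst h, snd h + fst h \<bullet> (y - x))"
    have h': "aval h' z = aval h (z - (y - x))" for z by (simp add: h'_def aval_def inner_diff_right)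
    define V' where "V' = {z\<in>W. aval h' z = 0}"
    define H' where "H' = {z\<in>W. aval h' z \<ge> 0}"
    have tr: "z - (y - x) \<in> W \<longleftrightarrow> z \<in> W" for z
      using affine_hull_translate_mem[OF W xW yW, of "z - (y - x)"] affine_hull_translate_mem[OF W yW xW, of z]
      by (auto simp: algebra_simps)
    have "y \<in> V'" using VH(2) h(1) yW by (simp add: V'_def h')
    moreover have "half_space_of W V' H'"
    proof (rule half_spaceI[OF V'_def H'_def])
      show "V' \<noteq> {}" using \<open>y \<in> V'\<close> by blast
      obtain w where "w \<in> W" "aval h w \<noteq> 0" using h(3) unfolding vanishes_on_def by blast
      then have "w + (y - x) \<in> W" "aval h' (w + (y - x)) \<noteq> 0" using affine_hull_translate_mem[OF W xW yW] h' by auto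
      then show "\<not> vanishes_on h' W" unfolding vanishes_on_def by blast
    qed
    moreover have "agree_near y P H'"
    proof -
      obtain e where e: "e > 0" "P \<inter> ball x e = H \<inter> ball x e" using VH(3) unfolding agree_near_def by blast
      obtain e' where e': "e' > 0" "\<And>z. norm z < e' \<Longrightarrow> same_side \<Sigma> (x + z) (y + z)"
        using same_side_translate[OF assms(1) xy] by blast
      have "z \<in> P \<longleftrightarrow> z \<in> H'" if z: "dist y z < min e e'" for z
      proof -
        have nz: "norm (z - y) < min e e'" using z by (simp add: dist_norm norm_minus_commute)
        then have "same_side \<Sigma> (x + (z - y)) (y + (z - y))" using e'(2)[of "z - y"] by simp
        then have "z \<in> P \<longleftrightarrow> x + (z - y) \<in> P" using adapted_onD[OF assms(2), of "x + (z - y)" z] by simp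
        also have "\<dots> \<longleftrightarrow> x + (z - y) \<in> H"
        proof -
          have "x + (z - y) \<in> ball x e" using nz by (simp add: dist_norm norm_minus_commute)
          then show ?thesis using e(2) by blast
        qed
        also have "\<dots> \<longleftrightarrow> z \<in> H'"
        proof -
          have eq: "x + (z - y) = z - (y - x)" by simp
          show ?thesis unfolding eq h(2) H'_def h' using tr[of z] by blast
        qed
        finally show ?thesis .
      qed
      then show ?thesis unfolding agree_near_def using e(1) e'(1) by (intro exI[of _ "min e e'"]) auto
    qed
    ultimately show ?thesis unfolding facet_points_def W_def by blast
  qed
  then show ?thesis unfolding adapted_on_def using same_side_sym by blast
qed

lemma adapted_facet:
  assumes "finite \<Sigma>" "adapted \<Sigma> P" "F \<in> facets P" shows "adapted \<Sigma> F"
proof -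
  obtain C where "C \<in> components (facet_points P)" "F = closure C" using assms(3) unfolding facets_def by blast
  then show ?thesis
    using adapted_closure[OF assms(1) adapted_component[OF adapted_facet_points[OF assms(1,2)]]] by simp
qed

lemma closed_facet: "F \<in> facets P \<Longrightarrow> closed F"
  unfolding facets_def by auto

definition facets_in :: "'a::euclidean_space set \<Rightarrow> 'a set \<Rightarrow> 'a set set" where
  "facets_in F V = {G \<in> facets F. aff_dim G = aff_dim V \<and> G \<subseteq> V}"

lemma finite_facets_in:
  assumes "finite \<Sigma>" "adapted \<Sigma> F" shows "finite (facets_in F V)"
proof (rule finite_subset[OF _ finite_adapted_sets[OF assms(1)]])
  show "facets_in F V \<subseteq> {S. adapted \<Sigma> S}" using adapted_facet[OF assms] by (auto simp: facets_in_def)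
qed

lemma facet_near_point:
  assumes "G \<in> facets_in F V" "p \<in> G" "e > 0"
  obtains C q where "C \<in> components (facet_points F)" "G = closure C" "C \<subseteq> V" "q \<in> C" "dist p q < e"
proof -
  from assms(1) obtain C where C: "C \<in> components (facet_points F)" "G = closure C" "G \<subseteq> V"
    unfolding facets_in_def facets_def by blast
  obtain q where "q \<in> C" "dist p q < e"
    using assms(2,3) C(2) closure_approachable by (metis dist_commute)
  then show thesis using that C closure_subset by blast
qed

text \<open>Near \<open>p\<close> the hyperplane \<open>V\<close> consists of facet points and is
  connected there, so it lies in one component. Any facet through \<open>p\<close> inside
  \<open>V\<close> is the closure of a component that comes close to \<open>p\<close> within
  \<open>V\<close>, and so meets the first one.\<close>

lemma unique_facet_through:
  assumes hs: "half_space_of (affine hull F) V H" and p: "p \<in> V" "agree_near p F H"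
  shows "\<exists>C\<in>components (facet_points F). closure C \<in> facets_in F V \<and> p \<in> C \<and>
    (\<forall>y\<in>C. y \<in> V \<and> agree_near y F H) \<and> (\<forall>G\<in>facets_in F V. p \<in> G \<longrightarrow> G = closure C)"
proof -
  obtain h where h: "V = {x\<in>affine hull F. aval h x = 0}" using half_spaceD[OF hs] by blast
  have Va: "affine V" unfolding h by (intro affine_hyperplane_section) simp
  obtain e where e: "e > 0" "V \<inter> ball p e \<subseteq> facet_points F" using facet_points_near[OF hs p] by blast
  have pf: "p \<in> facet_points F" using e p(1) by auto
  define C where "C = connected_component_set (facet_points F) p"
  have C: "C \<in> components (facet_points F)" "p \<in> C" using pf by (auto simp: C_def components_def)
  have cv: "convex (V \<inter> ball p e)" by (intro convex_Int affine_imp_convex Va convex_ball)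
  have VC: "V \<inter> ball p e \<subseteq> C"
    unfolding C_def by (rule connected_component_maximal) (use e p convex_connected[OF cv] in auto)
  have CV: "y \<in> V \<and> agree_near y F H" if "y \<in> C" for y
    by (rule facet_component_half_space[OF hs C(1,2) p that])
  then have clV: "closure C \<subseteq> V"
    using closure_minimal affine_closed[OF Va] by blast
  have "aff_dim V \<le> aff_dim (closure C)"
  proof -
    have "aff_dim (V \<inter> ball p e) = aff_dim V"
      by (rule aff_dim_convex_Int_open) (use affine_imp_convex[OF Va] p e in auto)
    moreover have "V \<inter> ball p e \<subseteq> closure C" using VC closure_subset by blast
    ultimately show ?thesis using aff_dim_subset by metis
  qed
  then have "aff_dim (closure C) = aff_dim V" using aff_dim_subset[OF clV] by simp
  then have "closure C \<in> facets_in F V" using C(1) clV by (auto simp: facets_in_def facets_def)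
  moreover have "G = closure C" if G: "G \<in> facets_in F V" "p \<in> G" for G
  proof -
    obtain C' q where q: "C' \<in> components (facet_points F)" "G = closure C'" "C' \<subseteq> V" "q \<in> C'" "dist p q < e"
      using facet_near_point[OF G e(1)] by blast
    then have "q \<in> C" using VC by auto
    then have "C' = C" using q C(1) components_nonoverlap by blast
    then show ?thesis using q by simp
  qed
  ultimately show ?thesis using C CV by blast
qed

lemma sum_single_facet:
  assumes "finite \<F>" "G0 \<in> \<F>" "p \<in> G0" "\<And>G. G \<in> \<F> \<Longrightarrow> p \<in> G \<Longrightarrow> G = G0"
  shows "(\<Sum>G\<in>\<F>. s G * indicator G p) = (s G0 :: real)"
proof -
  have "(\<Sum>G\<in>\<F>. s G * indicator G p) = (\<Sum>G\<in>\<F>. if G = G0 then s G0 else 0)"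
  proof (rule sum.cong[OF refl])
    fix G assume "G \<in> \<F>"
    then show "s G * indicator G p = (if G = G0 then s G0 else 0)"
      using assms(3) assms(4)[of G] by (cases "p \<in> G") auto
  qed
  then show ?thesis using assms(1,2) by simp
qed

text \<open>At a generic point of \<open>V\<close>, \<open>F\<close> fills either side of \<open>V\<close> completely or not at all; the point is an
  inner point of a facet iff it fills exactly one.\<close>

lemma jump_indicator_eq_facets:
  fixes F :: "'a::euclidean_space set"
  assumes cr: "crosses W V H n" and W: "affine hull F = W" and F: "closed F" "finite \<Sigma>" "adapted \<Sigma> F"
    and p: "p \<in> V" "\<And>h. h \<in> \<Sigma> \<Longrightarrow> aval h p = 0 \<Longrightarrow> vanishes_on h V"
  shows "jump n (indicator F) p =
    (\<Sum>G\<in>facets_in F V. (if adjoins_from F G H then 1 else -1) * indicator G p)"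
proof -
  have Wa: "affine W" using W by auto
  have FW: "F \<subseteq> W" using hull_subset[of F affine] W by simp
  obtain h0 where h0: "V = {x\<in>W. aval h0 x = 0}" "H = {x\<in>W. aval h0 x \<ge> 0}" "fst h0 \<bullet> n > 0"
    and V: "V \<noteq> {}" and nW: "\<forall>x\<in>W. x + n \<in> W"
    using cr unfolding crosses_def by blast
  have nv: "\<not> vanishes_on h0 W" by (rule not_vanishes_on_crossed[OF h0(1) V nW h0(3)])
  have hs: "half_space_of W V H" by (rule crosses_imp_half_space[OF cr])
  define H' where "H' = {x\<in>W. aval h0 x \<le> 0}"
  have hs': "half_space_of W V H'"
    by (rule half_spaceI[of _ _ "(- fst h0, - snd h0)"]) (use h0 V nv in \<open>auto simp: aval_uminus H'_def vanishes_on_def\<close>)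
  have line: "x + t *\<^sub>R n \<in> W" "x - t *\<^sub>R n \<in> W" if "x \<in> W" for x t
    using affine_translate_scale[OF Wa _ that, of n t] affine_translate_scale[OF Wa _ that, of n "-t"] nW by auto
  have al: "aval h0 (x + t *\<^sub>R n) = t * (fst h0 \<bullet> n)" "aval h0 (x - t *\<^sub>R n) = - t * (fst h0 \<bullet> n)" if "x \<in> V" for x t
    using that h0(1) aval_add[of h0 x "t *\<^sub>R n"] aval_add[of h0 x "- (t *\<^sub>R n)"] by auto
  obtain e where e: "e > 0" "\<And>x y. x \<in> W \<Longrightarrow> y \<in> W \<Longrightarrow> dist p x < e \<Longrightarrow> dist p y < e \<Longrightarrow> sgn (aval h0 x) = sgn (aval h0 y) \<Longrightarrow> same_side \<Sigma> x y"
    proof (rule same_side_near_generic_point[OF Wa h0(1) p(1) nv F(2)])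
      show "vanishes_on h V" if "h \<in> \<Sigma>" "aval h p = 0" for h
        using p(2) that by blast
    qed blast
  obtain t0 where t0: "t0 > 0" "p + t0 *\<^sub>R n \<in> ball p e" "p - t0 *\<^sub>R n \<in> ball p e"
    using small_step_in_ball[OF e(1)] by blast
  have pW: "p \<in> W" using p h0 by blast
  \<comment> \<open>One sample point on each side decides the whole side near \<open>p\<close>,
    since nearby points of \<open>W\<close> on one side share a cell.\<close>
  define above where "above \<longleftrightarrow> p + t0 *\<^sub>R n \<in> F"
  define below where "below \<longleftrightarrow> p - t0 *\<^sub>R n \<in> F"
  have sa: "z \<in> F \<longleftrightarrow> above" if z: "z \<in> W" "dist p z < e" "aval h0 z > 0" for z
  proof -
    have "aval h0 (p + t0 *\<^sub>R n) > 0" using al(1)[OF p(1)] t0(1) h0(3) by simp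
    then have "same_side \<Sigma> z (p + t0 *\<^sub>R n)" using z t0 line[OF pW] by (intro e(2)) auto
    then show ?thesis unfolding above_def using adapted_onD[OF F(3)] by blast
  qed
  have sb: "z \<in> F \<longleftrightarrow> below" if z: "z \<in> W" "dist p z < e" "aval h0 z < 0" for z
  proof -
    have "aval h0 (p - t0 *\<^sub>R n) < 0" using al(2)[OF p(1)] t0(1) h0(3) by simp
    then have "same_side \<Sigma> z (p - t0 *\<^sub>R n)" using z t0 line[OF pW] by (intro e(2)) auto
    then show ?thesis unfolding below_def using adapted_onD[OF F(3)] by blast
  qed
  have ev: "\<forall>\<^sub>F t in at_right 0. 0 < t \<and> x + t *\<^sub>R n \<in> B \<and> x - t *\<^sub>R n \<in> B" if "open B" "x \<in> B" for x B
    using eventually_at_right_in_open[OF that, of n] eventually_at_right_in_open_minus[OF that, of n]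
      eventually_at_right_less[of 0] by eventually_elim simp
  have sides: "\<forall>\<^sub>F t in at_right 0. (x + t *\<^sub>R n \<in> F \<longleftrightarrow> above) \<and> (x - t *\<^sub>R n \<in> F \<longleftrightarrow> below)" if x: "x \<in> V" "dist p x < e" for x
  proof -
    have "x \<in> W" using x h0 by blast
    have "\<forall>\<^sub>F t in at_right 0. 0 < t \<and> x + t *\<^sub>R n \<in> ball p e \<and> x - t *\<^sub>R n \<in> ball p e"
      by (rule ev) (use x in auto)
    then show ?thesis
    proof eventually_elim
      case (elim t)
      then show ?case
        using sa[OF line(1)[OF \<open>x \<in> W\<close>], of t] sb[OF line(2)[OF \<open>x \<in> W\<close>], of t] al[OF x(1), of t] h0(3) by simp
    qed
  qed
  have j: "jump n (indicator F) p = of_bool above - of_bool below"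
  proof (rule jump_eqI)
    have "\<forall>\<^sub>F t in at_right 0. (p + t *\<^sub>R n \<in> F \<longleftrightarrow> above) \<and> (p - t *\<^sub>R n \<in> F \<longleftrightarrow> below)"
      by (rule sides) (use p e in auto)
    then show "\<forall>\<^sub>F t in at_right 0. indicator F (p + t *\<^sub>R n) - indicator F (p - t *\<^sub>R n) = (of_bool above - of_bool below :: real)"
      by eventually_elim (simp add: indicator_def)
  qed
  \<comment> \<open>Closedness of \<open>F\<close> fills in the hyperplane: a point of
    \<open>V\<close> outside \<open>F\<close> would have only points outside \<open>F\<close> near
    it, on both sides.\<close>
  have mid: "x \<in> F" if x: "x \<in> V" "dist p x < e" and ab: "above \<or> below" for x
  proof (rule ccontr)
    assume "x \<notin> F"
    then have "\<forall>\<^sub>F t in at_right 0. 0 < t \<and> x + t *\<^sub>R n \<in> - F \<and> x - t *\<^sub>R n \<in> - F"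
      using F(1) by (intro ev) auto
    then have "\<forall>\<^sub>F t in at_right (0::real). False"
      using sides[OF x] by eventually_elim (use ab in auto)
    then show False by (simp add: eventually_const trivial_limit_at_right_real)
  qed
  have fin: "finite (facets_in F V)" by (rule finite_facets_in[OF F(2,3)])
  consider "above" "\<not> below" | "\<not> above" "below" | "above \<longleftrightarrow> below" by blast
  then show ?thesis
  proof cases
    case 1
    have "z \<in> F \<longleftrightarrow> z \<in> H" if z: "dist p z < e" for z
    proof (cases "z \<in> W")
      case True
      consider "aval h0 z > 0" | "aval h0 z = 0" | "aval h0 z < 0" by linarith
      then show ?thesis by cases (use True z sa sb mid 1 h0 in auto)
    qed (use FW h0 in auto)
    then have ag: "agree_near p F H" unfolding agree_near_def using e(1) by (intro exI[of _ e]) auto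
    obtain C where C: "C \<in> components (facet_points F)" "closure C \<in> facets_in F V" "p \<in> C"
      "\<forall>G\<in>facets_in F V. p \<in> G \<longrightarrow> G = closure C"
      using unique_facet_through[OF hs[folded W] p(1) ag] by blast
    have pC: "p \<in> closure C" using C(3) closure_subset by blast
    have "adjoins_from F (closure C) H" unfolding adjoins_from_def using ag pC by blast
    moreover have "(\<Sum>G\<in>facets_in F V. (if adjoins_from F G H then 1 else -1) * indicator G p) =
      (if adjoins_from F (closure C) H then 1 else -1 :: real)"
      by (rule sum_single_facet[OF fin C(2) pC]) (use C(4) in blast)
    ultimately show ?thesis using j 1 by simp
  next
    case 2
    have "z \<in> F \<longleftrightarrow> z \<in> H'" if z: "dist p z < e" for z
    proof (cases "z \<in> W")
      case True
      consider "aval h0 z > 0" | "aval h0 z = 0" | "aval h0 z < 0" by linarith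
      then show ?thesis by cases (use True z sa sb mid 2 h0 in \<open>auto simp: H'_def\<close>)
    qed (use FW in \<open>auto simp: H'_def\<close>)
    then have ag: "agree_near p F H'" unfolding agree_near_def using e(1) by (intro exI[of _ e]) auto
    obtain C where C: "C \<in> components (facet_points F)" "closure C \<in> facets_in F V" "p \<in> C"
      "\<forall>G\<in>facets_in F V. p \<in> G \<longrightarrow> G = closure C"
      "\<forall>y\<in>C. y \<in> V \<and> agree_near y F H'"
      using unique_facet_through[OF hs'[folded W] p(1) ag] by blast
    have pC: "p \<in> closure C" using C(3) closure_subset by blast
    \<comment> \<open>Contact with \<open>H\<close> at a point of the closure would spread to a
      point \<open>q\<close> of \<open>C\<close>, where the germ is that of \<open>H'\<close>. This
      would force \<open>H = H'\<close>, although \<open>q + n\<close> lies in \<open>H\<close>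
      only.\<close>
    have "\<not> adjoins_from F (closure C) H"
    proof
      assume "adjoins_from F (closure C) H"
      then obtain x where x: "x \<in> closure C" "agree_near x F H" unfolding adjoins_from_def by blast
      obtain d where d: "d > 0" "\<And>y. dist x y < d \<Longrightarrow> agree_near y F H" using agree_near_nearby[OF x(2)] by blast
      obtain q where q: "q \<in> C" "dist q x < d" using x(1) d(1) closure_approachable by blast
      have "agree_near q F H" using d(2)[of q] q(2) by (simp add: dist_commute)
      then have "agree_near q H H'" using agree_near_trans bspec[OF C(5) q(1)] by blast
      then have "H = H'" using half_space_determined_near[OF Wa hs hs', of q] bspec[OF C(5) q(1)] by blast
      moreover have "q + 1 *\<^sub>R n \<in> H" using al(1)[of q 1] line(1)[of q 1] bspec[OF C(5) q(1)] h0 by auto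
      ultimately show False using al(1)[of q 1] bspec[OF C(5) q(1)] h0(3) by (auto simp: H'_def)
    qed
    moreover have "(\<Sum>G\<in>facets_in F V. (if adjoins_from F G H then 1 else -1) * indicator G p) =
      (if adjoins_from F (closure C) H then 1 else -1 :: real)"
      by (rule sum_single_facet[OF fin C(2) pC]) (use C(4) in blast)
    ultimately show ?thesis using j 2 by simp
  next
    case 3
    \<comment> \<open>A facet through \<open>p\<close> would have a point \<open>q\<close> near
      \<open>p\<close> at which \<open>F\<close> is a half-space. Its boundary is \<open>V\<close>,
      because the facet has full dimension in \<open>V\<close>, so exactly one side would be filled;
      but here both are or neither is.\<close>
    have "p \<notin> G" if G: "G \<in> facets_in F V" for G
    proof
      assume "p \<in> G"
      obtain C q where C: "C \<in> components (facet_points F)" "G = closure C" "C \<subseteq> V" "q \<in> C" "dist p q < e"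
        using facet_near_point[OF G \<open>p \<in> G\<close> e(1)] by blast
      have "q \<in> facet_points F" using C in_components_subset by blast
      then obtain V2 H2 where VH2: "half_space_of W V2 H2" "q \<in> V2" "agree_near q F H2"
        unfolding facet_points_def W by blast
      obtain h2 where h2: "V2 = {x\<in>W. aval h2 x = 0}" "H2 = {x\<in>W. aval h2 x \<ge> 0}" "\<not> vanishes_on h2 W"
        using half_spaceD[OF VH2(1)] by blast
      have V2a: "affine V2" unfolding h2 by (rule affine_hyperplane_section[OF Wa])
      have "C \<subseteq> V2" using facet_component_half_space[OF _ C(1,4), of V2 H2] VH2 W by blast
      then have "G \<subseteq> V2" using C(2) closure_minimal affine_closed[OF V2a] by blast
      then have "affine hull G \<subseteq> V2" by (rule hull_minimal) (rule V2a)
      moreover have "affine hull G = V"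
      proof (rule affine_dim_equal)
        show "affine V" unfolding h0 by (rule affine_hyperplane_section[OF Wa])
        then show "affine hull G \<subseteq> V" using G by (auto simp: facets_in_def intro: hull_minimal[THEN subsetD])
        show "affine hull G \<noteq> {}" using \<open>p \<in> G\<close> by auto
        show "aff_dim (affine hull G) = aff_dim V" using G by (simp add: facets_in_def aff_dim_affine_hull)
      qed simp
      ultimately have "vanishes_on h2 V" using h2 by (auto simp: vanishes_on_def)
      then obtain \<kappa> where \<kappa>: "\<And>w. w \<in> W \<Longrightarrow> aval h2 w = \<kappa> * aval h0 w"
        using aval_proportional[OF Wa h0(1) V nv] by blast
      have "\<kappa> \<noteq> 0" using \<kappa> h2(3) by (auto simp: vanishes_on_def)
      have qV: "q \<in> V" and qW: "q \<in> W" using C h0 by auto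
      obtain d where d: "d > 0" "F \<inter> ball q d = H2 \<inter> ball q d" using VH2(3) unfolding agree_near_def by blast
      have "\<forall>\<^sub>F t in at_right 0. 0 < t \<and> q + t *\<^sub>R n \<in> ball q d \<and> q - t *\<^sub>R n \<in> ball q d"
        by (rule ev) (use d in auto)
      then have "\<forall>\<^sub>F t in at_right (0::real). False"
        using sides[OF qV C(5)]
      proof eventually_elim
        case (elim t)
        then have "q + t *\<^sub>R n \<in> H2 \<longleftrightarrow> q - t *\<^sub>R n \<in> H2" using d(2) 3 by (metis IntE IntI)
        then have "aval h2 (q + t *\<^sub>R n) \<ge> 0 \<longleftrightarrow> aval h2 (q - t *\<^sub>R n) \<ge> 0"
          unfolding h2(2) using line[OF qW, of t] by blast
        moreover have "aval h2 (q + t *\<^sub>R n) = \<kappa> * (t * (fst h0 \<bullet> n))" "aval h2 (q - t *\<^sub>R n) = - (\<kappa> * (t * (fst h0 \<bullet> n)))"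
          using \<kappa>[OF line(1)[OF qW, of t]] \<kappa>[OF line(2)[OF qW, of t]] al[OF qV, of t] by simp_all
        ultimately have "\<kappa> * (t * (fst h0 \<bullet> n)) = 0" by linarith
        then show ?case using \<open>\<kappa> \<noteq> 0\<close> elim h0(3) by simp
      qed
      then show False by (simp add: eventually_const trivial_limit_at_right_real)
    qed
    then have "(\<Sum>G\<in>facets_in F V. (if adjoins_from F G H then 1 else -1) * indicator G p) = (0::real)"
      by (intro sum.neutral) auto
    then show ?thesis using j 3 by simp
  qed
qed

section \<open>Iterated jumps and chains of faces\<close>

text \<open>\<open>foldr\<close> makes the jump along the direction with the largest index
  innermost: jumps are taken from the top of the flag downwards, and \<open>n r\<close> acts
  last.\<close>

definition iter_jump :: "(nat \<Rightarrow> 'a) \<Rightarrow> nat \<Rightarrow> ('a::euclidean_space \<Rightarrow> real) \<Rightarrow> 'a \<Rightarrow> real" where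
  "iter_jump n r u = foldr (\<lambda>j. jump (n j)) [r..<DIM('a)] u"

lemma iter_jump_top [simp]: "iter_jump n DIM('a) (u :: 'a::euclidean_space \<Rightarrow> real) = u"
  by (simp add: iter_jump_def)

lemma iter_jump_step:
  "r < DIM('a) \<Longrightarrow> iter_jump n r (u :: 'a::euclidean_space \<Rightarrow> real) = jump (n r) (iter_jump n (Suc r) u)"
  unfolding iter_jump_def by (subst upt_conv_Cons) simp_all

lemma adapted_on_iter_jump:
  assumes "finite \<Sigma>" "open X" "adapted_on \<Sigma> X u" shows "adapted_on \<Sigma> X (iter_jump n r u)"
proof -
  have "adapted_on \<Sigma> X (foldr (\<lambda>j. jump (n j)) js u)" for js
    by (induction js) (simp_all add: assms adapted_on_jump)
  then show ?thesis by (simp add: iter_jump_def)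
qed

lemma locally_adapted_iter_jump:
  assumes "locally_adapted u" shows "locally_adapted (iter_jump n r u)"
proof -
  have "locally_adapted (foldr (\<lambda>j. jump (n j)) js u)" for js
    by (induction js) (simp_all add: assms locally_adapted_jump)
  then show ?thesis by (simp add: iter_jump_def)
qed

lemma iter_jump_local:
  assumes "open X" "\<And>y. y \<in> X \<Longrightarrow> u y = v y" "x \<in> X" shows "iter_jump n r u x = iter_jump n r v x"
proof -
  have "\<forall>x\<in>X. foldr (\<lambda>j. jump (n j)) js u x = foldr (\<lambda>j. jump (n j)) js v x" for js
  proof (induction js)
    case (Cons j js)
    show ?case
    proof
      fix x assume "x \<in> X"
      then have "jump (n j) (foldr (\<lambda>j. jump (n j)) js u) x = jump (n j) (foldr (\<lambda>j. jump (n j)) js v) x"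
        using Cons.IH by (intro jump_local[OF assms(1)]) auto
      then show "foldr (\<lambda>j. jump (n j)) (j # js) u x = foldr (\<lambda>j. jump (n j)) (j # js) v x" by simp
    qed
  qed (use assms(2) in simp)
  then show ?thesis using assms(3) by (simp add: iter_jump_def)
qed

lemma iter_jump_translate: "iter_jump n r (\<lambda>x. u (x + l)) = (\<lambda>x. iter_jump n r u (x + l))"
proof -
  have "foldr (\<lambda>j. jump (n j)) js (\<lambda>x. u (x + l)) = (\<lambda>x. foldr (\<lambda>j. jump (n j)) js u (x + l))" for js
    by (induction js) (simp_all, intro ext jump_translate)
  then show ?thesis by (simp add: iter_jump_def)
qed

lemma iter_jump_sum:
  assumes "finite I" "\<And>i. i \<in> I \<Longrightarrow> locally_adapted (u i)"
  shows "iter_jump n r (\<lambda>x. \<Sum>i\<in>I. u i x) = (\<lambda>x. \<Sum>i\<in>I. iter_jump n r (u i) x)"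
proof -
  have la: "locally_adapted (foldr (\<lambda>j. jump (n j)) js (u i))" if "i \<in> I" for js i
    by (induction js) (simp_all add: that assms(2) locally_adapted_jump)
  have "foldr (\<lambda>j. jump (n j)) js (\<lambda>x. \<Sum>i\<in>I. u i x) = (\<lambda>x. \<Sum>i\<in>I. foldr (\<lambda>j. jump (n j)) js (u i) x)" for js
  proof (induction js)
    case (Cons j js)
    have "jump (n j) (\<lambda>x. \<Sum>i\<in>I. 1 * foldr (\<lambda>j. jump (n j)) js (u i) x) x = (\<Sum>i\<in>I. 1 * jump (n j) (foldr (\<lambda>j. jump (n j)) js (u i)) x)" for x
      by (rule jump_sum[OF assms(1) la])
    then have "jump (n j) (\<lambda>x. \<Sum>i\<in>I. foldr (\<lambda>j. jump (n j)) js (u i) x) = (\<lambda>x. \<Sum>i\<in>I. jump (n j) (foldr (\<lambda>j. jump (n j)) js (u i)) x)"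
      by (intro ext) simp
    then show ?case using Cons.IH by simp
  qed simp
  then show ?thesis by (simp add: iter_jump_def)
qed

lemma iter_jump_const:
  fixes x :: "'a::euclidean_space"
  assumes "r < DIM('a)" shows "iter_jump n r (\<lambda>_. c) x = 0"
proof -
  have "foldr (\<lambda>j. jump (n j)) (j # js) (\<lambda>_. c) = (\<lambda>_. 0)" for js j
    by (induction js arbitrary: j) (simp_all add: ext[OF jump_const])
  then show ?thesis using assms by (simp add: iter_jump_def upt_conv_Cons)
qed

lemma iter_jump_cong:
  assumes "\<And>j. r \<le> j \<Longrightarrow> n j = n' j" shows "iter_jump n r u = iter_jump n' r u"
  unfolding iter_jump_def by (rule foldr_cong) (use assms in auto)

section \<open>Flags and chains of faces\<close>

definition flag_directions :: "nat \<Rightarrow> 'a::euclidean_space flag \<Rightarrow> (nat \<Rightarrow> 'a) \<Rightarrow> bool" where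
  "flag_directions r \<Phi> n \<longleftrightarrow> (\<forall>j\<in>{r..<DIM('a)}. crosses (fst \<Phi> (Suc j)) (fst \<Phi> j) (snd \<Phi> j) (n j))"

lemma is_flagD:
  fixes \<Phi> :: "'a::euclidean_space flag"
  assumes "is_flag r \<Phi>"
  shows "r \<le> j \<Longrightarrow> j \<le> DIM('a) \<Longrightarrow> affine (fst \<Phi> j)" "r \<le> j \<Longrightarrow> j \<le> DIM('a) \<Longrightarrow> aff_dim (fst \<Phi> j) = int j"
    "fst \<Phi> (DIM('a)) = UNIV" "r \<le> j \<Longrightarrow> j < DIM('a) \<Longrightarrow> half_space_of (fst \<Phi> (Suc j)) (fst \<Phi> j) (snd \<Phi> j)"
    "r \<le> j \<Longrightarrow> j < DIM('a) \<Longrightarrow> fst \<Phi> j \<subseteq> fst \<Phi> (Suc j)"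
    "j < r \<Longrightarrow> fst \<Phi> j = {}" "DIM('a) < j \<Longrightarrow> fst \<Phi> j = {}"
    "j < r \<Longrightarrow> snd \<Phi> j = {}" "DIM('a) \<le> j \<Longrightarrow> snd \<Phi> j = {}"
  using assms unfolding is_flag_def by (auto simp: split_beta)

lemma is_flag_nonempty:
  assumes "is_flag r (\<Phi> :: 'a::euclidean_space flag)" "r \<le> j" "j \<le> DIM('a)" shows "fst \<Phi> j \<noteq> {}"
  using is_flagD(2)[OF assms] by auto

lemma flag_directions_exist:
  assumes "is_flag r (\<Phi> :: 'a::euclidean_space flag)" shows "\<exists>n. flag_directions r \<Phi> n"
proof -
  have "\<exists>m. crosses (fst \<Phi> (Suc j)) (fst \<Phi> j) (snd \<Phi> j) m" if "j \<in> {r..<DIM('a)}" for j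
  proof -
    have j: "r \<le> j" "j < DIM('a)" using that by auto
    obtain h where h: "fst \<Phi> j = {x\<in>fst \<Phi> (Suc j). aval h x = 0}" "snd \<Phi> j = {x\<in>fst \<Phi> (Suc j). aval h x \<ge> 0}"
      "\<not> vanishes_on h (fst \<Phi> (Suc j))" "fst \<Phi> j \<noteq> {}"
      using half_spaceD[OF is_flagD(4)[OF assms j]] by blast
    have "affine (fst \<Phi> (Suc j))" by (rule is_flagD(1)[OF assms]) (use j in auto)
    from crosses_hyperplane_exists[OF this h(1) h(4) h(3)] show ?thesis unfolding h(2) by blast
  qed
  then have "\<forall>j\<in>{r..<DIM('a)}. \<exists>m. crosses (fst \<Phi> (Suc j)) (fst \<Phi> j) (snd \<Phi> j) m" by blast
  from bchoice[OF this] show ?thesis unfolding flag_directions_def .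
qed

lemma face_chains_iff:
  "F \<in> face_chains r \<Phi> (A :: 'a::euclidean_space set) \<longleftrightarrow> F (DIM('a)) = A \<and>
     (\<forall>j\<in>{r..<DIM('a)}. F j \<in> facets (F (Suc j)) \<and> aff_dim (F j) = int j \<and> F j \<subseteq> fst \<Phi> j) \<and>
     (\<forall>j. j \<notin> {r..DIM('a)} \<longrightarrow> F j = {})"
  unfolding face_chains_def by (simp add: split_beta)

text \<open>A face of dimension \<open>k\<close> inside the \<open>k\<close>-dimensional
  \<open>V k\<close> spans it. Each face of a chain can thus take the place of the polytope in
  \<open>jump_indicator_eq_facets\<close>, with the same \<Sigma>.\<close>

lemma face_chain_members:
  fixes A :: "'a::euclidean_space set"
  assumes fl: "is_flag r0 \<Phi>" and A: "closed A" "finite \<Sigma>" "adapted \<Sigma> A" "affine hull A = UNIV"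
    and F: "F \<in> face_chains r \<Phi> A" and j: "r0 \<le> r" "r \<le> j" "j \<le> DIM('a)"
  shows "closed (F j) \<and> adapted \<Sigma> (F j) \<and> affine hull (F j) = fst \<Phi> j"
  using j(3)
proof (induction rule: inc_induct)
  case base
  then show ?case using F A is_flagD(3)[OF fl] by (auto simp: face_chains_iff)
next
  case (step k)
  have k: "r \<le> k" "k < DIM('a)" "r0 \<le> k" using step j by auto
  have Fk: "F k \<in> facets (F (Suc k))" "aff_dim (F k) = int k" "F k \<subseteq> fst \<Phi> k"
    using F k by (auto simp: face_chains_iff)
  have "affine hull (F k) = fst \<Phi> k"
  proof (rule affine_dim_equal)
    show V: "affine (fst \<Phi> k)" by (rule is_flagD(1)[OF fl]) (use k in auto)
    show "affine hull (F k) \<subseteq> fst \<Phi> k" by (rule hull_minimal[OF Fk(3)]) (rule V)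
    show "affine hull (F k) \<noteq> {}" using Fk(2) by auto
    have "aff_dim (fst \<Phi> k) = int k" by (rule is_flagD(2)[OF fl]) (use k in auto)
    then show "aff_dim (affine hull (F k)) = aff_dim (fst \<Phi> k)" using Fk(2) by (simp add: aff_dim_affine_hull)
  qed simp
  then show ?case using Fk(1) step.IH adapted_facet[OF A(2)] closed_facet by blast
qed

lemma finite_face_chains:
  fixes A :: "'a::euclidean_space set"
  assumes fl: "is_flag r0 \<Phi>" and A: "closed A" "finite \<Sigma>" "adapted \<Sigma> A" "affine hull A = UNIV" and "r0 \<le> r"
  shows "finite (face_chains r \<Phi> A)"
proof (rule finite_subset)
  show "face_chains r \<Phi> A \<subseteq> {F. \<forall>j. (j \<in> {r..DIM('a)} \<longrightarrow> F j \<in> {S. adapted \<Sigma> S}) \<and> (j \<notin> {r..DIM('a)} \<longrightarrow> F j = {})}"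
    using face_chain_members[OF fl A _ assms(6)] by (auto simp: face_chains_iff)
  show "finite {F. \<forall>j. (j \<in> {r..DIM('a)} \<longrightarrow> F j \<in> {S. adapted \<Sigma> S}) \<and> (j \<notin> {r..DIM('a)} \<longrightarrow> F j = {})}"
    by (rule finite_set_of_finite_funs) (use finite_adapted_sets[OF A(2)] in auto)
qed

lemma sum_face_chains_step:
  fixes A :: "'a::euclidean_space set" and g :: "(nat \<Rightarrow> 'a set) \<Rightarrow> real"
  assumes fl: "is_flag r0 \<Phi>" and A: "closed A" "finite \<Sigma>" "adapted \<Sigma> A" "affine hull A = UNIV"
    and r: "r0 \<le> r" "r < DIM('a)"
  shows "(\<Sum>F\<in>face_chains r \<Phi> A. g F) =
    (\<Sum>F\<in>face_chains (Suc r) \<Phi> A. \<Sum>G\<in>facets_in (F (Suc r)) (fst \<Phi> r). g (F(r := G)))"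
proof -
  have dim: "aff_dim (fst \<Phi> r) = int r" by (rule is_flagD(2)[OF fl]) (use r in auto)
  have fin: "finite (face_chains (Suc r) \<Phi> A)" by (rule finite_face_chains[OF fl A]) (use r in auto)
  have fin2: "finite (facets_in (F (Suc r)) (fst \<Phi> r))" if "F \<in> face_chains (Suc r) \<Phi> A" for F
    by (rule finite_facets_in[OF A(2)]) (use face_chain_members[OF fl A that, of "Suc r"] r in auto)
  have "(\<Sum>F\<in>face_chains (Suc r) \<Phi> A. \<Sum>G\<in>facets_in (F (Suc r)) (fst \<Phi> r). g (F(r := G)))
    = (\<Sum>(F, G)\<in>Sigma (face_chains (Suc r) \<Phi> A) (\<lambda>F. facets_in (F (Suc r)) (fst \<Phi> r)). g (F(r := G)))"
    by (rule sum.Sigma) (use fin fin2 in auto)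
  also have "\<dots> = (\<Sum>F\<in>face_chains r \<Phi> A. g F)"
  proof (rule sum.reindex_bij_witness[of _ "\<lambda>F. (F(r := {}), F r)" "\<lambda>(F, G). F(r := G)"])
    fix FG assume FG: "FG \<in> Sigma (face_chains (Suc r) \<Phi> A) (\<lambda>F. facets_in (F (Suc r)) (fst \<Phi> r))"
    obtain F G where [simp]: "FG = (F, G)" by (cases FG)
    have F: "F \<in> face_chains (Suc r) \<Phi> A" and G: "G \<in> facets_in (F (Suc r)) (fst \<Phi> r)" using FG by auto
    have "F r = {}" using F by (auto simp: face_chains_iff)
    then show "(\<lambda>F. (F(r := {}), F r)) (case FG of (F, G) \<Rightarrow> F(r := G)) = FG"
      by (simp add: fun_upd_idem)
    have "(F(r := G)) j \<in> facets ((F(r := G)) (Suc j)) \<and> aff_dim ((F(r := G)) j) = int j \<and> (F(r := G)) j \<subseteq> fst \<Phi> j"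
      if "j \<in> {r..<DIM('a)}" for j
    proof (cases "j = r")
      case True
      then show ?thesis using G dim by (simp add: facets_in_def)
    next
      case False
      then have "j \<in> {Suc r..<DIM('a)}" using that by auto
      then have "F j \<in> facets (F (Suc j)) \<and> aff_dim (F j) = int j \<and> F j \<subseteq> fst \<Phi> j"
        using F unfolding face_chains_iff by blast
      then show ?thesis using False that by auto
    qed
    moreover have "(F(r := G)) (DIM('a)) = A" using F r by (auto simp: face_chains_iff)
    moreover have "(F(r := G)) j = {}" if "j \<notin> {r..DIM('a)}" for j
      using F that r by (auto simp: face_chains_iff)
    ultimately show "(case FG of (F, G) \<Rightarrow> F(r := G)) \<in> face_chains r \<Phi> A"
      unfolding face_chains_iff by auto
    show "g (case FG of (F, G) \<Rightarrow> F(r := G)) = (case FG of (F, G) \<Rightarrow> g (F(r := G)))" by simp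
  next
    fix F assume F: "F \<in> face_chains r \<Phi> A"
    show "(case (F(r := {}), F r) of (F, G) \<Rightarrow> F(r := G)) = F" by simp
    have "r \<in> {r..<DIM('a)}" using r by auto
    then have "F r \<in> facets_in (F (Suc r)) (fst \<Phi> r)"
      using F dim unfolding face_chains_iff facets_in_def by auto
    moreover have "F(r := {}) \<in> face_chains (Suc r) \<Phi> A"
      using F r unfolding face_chains_iff by auto
    ultimately show "(F(r := {}), F r) \<in> Sigma (face_chains (Suc r) \<Phi> A) (\<lambda>F. facets_in (F (Suc r)) (fst \<Phi> r))"
      by simp
  qed
  finally show ?thesis by simp
qed

definition chain_coeff :: "'a::euclidean_space flag \<Rightarrow> nat \<Rightarrow> (nat \<Rightarrow> 'a set) \<Rightarrow> real" where
  "chain_coeff \<Phi> r F = (\<Prod>j=r..<DIM('a). chain_sign \<Phi> F j)"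

lemma chain_coeff_step:
  fixes \<Phi> :: "'a::euclidean_space flag"
  assumes "r < DIM('a)"
  shows "chain_coeff \<Phi> r (F(r := G)) = (if adjoins_from (F (Suc r)) G (snd \<Phi> r) then 1 else -1) * chain_coeff \<Phi> (Suc r) F"
proof -
  have "chain_coeff \<Phi> r (F(r := G)) = chain_sign \<Phi> (F(r := G)) r * (\<Prod>j=Suc r..<DIM('a). chain_sign \<Phi> (F(r := G)) j)"
    unfolding chain_coeff_def using assms by (rule prod.atLeast_Suc_lessThan)
  also have "(\<Prod>j=Suc r..<DIM('a). chain_sign \<Phi> (F(r := G)) j) = chain_coeff \<Phi> (Suc r) F"
    unfolding chain_coeff_def by (rule prod.cong) (auto simp: chain_sign_def)
  also have "chain_sign \<Phi> (F(r := G)) r = (if adjoins_from (F (Suc r)) G (snd \<Phi> r) then 1 else -1)"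
    by (simp add: chain_sign_def)
  finally show ?thesis .
qed

text \<open>Downward induction from the one-term chain at the top: by \<open>thin_jump\<close> the
  iterated jump may be replaced by the sum of face indicators, and the jump of each indicator
  produces the facets of that face, with the sign of the new link of the chain.\<close>

lemma iter_jump_eq_chains:
  fixes A :: "'a::euclidean_space set"
  assumes fl: "is_flag r0 \<Phi>" and dir: "flag_directions r0 \<Phi> n"
    and A: "closed A" "finite \<Sigma>" "adapted \<Sigma> A" "affine hull A = UNIV" and r: "r0 \<le> r" "r \<le> DIM('a)"
  shows "thin (fst \<Phi> r) {x. iter_jump n r (indicator A) x \<noteq>
    (\<Sum>F\<in>face_chains r \<Phi> A. chain_coeff \<Phi> r F * indicator (F r) x)}"
  using r(2)
proof (induction rule: inc_induct)
  case base
  have "face_chains DIM('a) \<Phi> A = {\<lambda>j. if j = DIM('a) then A else {}}"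
    by (auto simp: face_chains_iff fun_eq_iff)
  then have "{x. iter_jump n DIM('a) (indicator A) x \<noteq> (\<Sum>F\<in>face_chains DIM('a) \<Phi> A. chain_coeff \<Phi> DIM('a) F * indicator (F DIM('a)) x)} = {}"
    by (simp add: chain_coeff_def)
  then show ?case by (simp add: thinI exI[of _ "{}"])
next
  case (step k)
  have k: "r0 \<le> k" "k < DIM('a)" using step r by auto
  define V where "V = fst \<Phi> k"
  define W where "W = fst \<Phi> (Suc k)"
  have Wa: "affine W" unfolding W_def by (rule is_flagD(1)[OF fl]) (use k in auto)
  have cr: "crosses W V (snd \<Phi> k) (n k)" using dir k unfolding flag_directions_def V_def W_def by simp
  define S where "S x = (\<Sum>F\<in>face_chains (Suc k) \<Phi> A. chain_coeff \<Phi> (Suc k) F * indicator (F (Suc k)) x)" for x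
  have "thin W {x. iter_jump n (Suc k) (indicator A) x \<noteq> S x}" using step.IH unfolding W_def S_def .
  from thin_jump[OF Wa cr this]
  have t1: "thin V {x. iter_jump n k (indicator A) x \<noteq> jump (n k) S x}"
    using k by (simp add: iter_jump_step)
  have fin: "finite (face_chains (Suc k) \<Phi> A)" by (rule finite_face_chains[OF fl A]) (use k in auto)
  have mem: "closed (F (Suc k)) \<and> adapted \<Sigma> (F (Suc k)) \<and> affine hull (F (Suc k)) = W" if "F \<in> face_chains (Suc k) \<Phi> A" for F
    unfolding W_def by (rule face_chain_members[OF fl A that]) (use k in auto)
  have la: "locally_adapted (indicator (F (Suc k)) :: 'a \<Rightarrow> real)" if "F \<in> face_chains (Suc k) \<Phi> A" for F
    using mem[OF that] by (intro adapted_on_imp_locally_adapted[OF A(2)] adapted_on_indicator) simp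
  \<comment> \<open>Points generic for \<Sigma> suffice here, since every face of every chain is
    adapted to \<Sigma>.\<close>
  have t2: "jump (n k) S p = (\<Sum>F\<in>face_chains k \<Phi> A. chain_coeff \<Phi> k F * indicator (F k) p)"
    if p: "p \<in> V" "\<forall>h\<in>{h\<in>\<Sigma>. \<not> vanishes_on h V}. aval h p \<noteq> 0" for p
  proof -
    have "jump (n k) S p = (\<Sum>F\<in>face_chains (Suc k) \<Phi> A. chain_coeff \<Phi> (Suc k) F * jump (n k) (indicator (F (Suc k))) p)"
      unfolding S_def by (rule jump_sum[OF fin la])
    also have "\<dots> = (\<Sum>F\<in>face_chains (Suc k) \<Phi> A. \<Sum>G\<in>facets_in (F (Suc k)) V. chain_coeff \<Phi> k (F(k := G)) * indicator ((F(k := G)) k) p)"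
    proof (rule sum.cong[OF refl])
      fix F assume F: "F \<in> face_chains (Suc k) \<Phi> A"
      have "jump (n k) (indicator (F (Suc k))) p =
        (\<Sum>G\<in>facets_in (F (Suc k)) V. (if adjoins_from (F (Suc k)) G (snd \<Phi> k) then 1 else -1) * indicator G p)"
        by (rule jump_indicator_eq_facets[OF cr _ _ A(2)]) (use mem[OF F] p in blast)+
      then show "chain_coeff \<Phi> (Suc k) F * jump (n k) (indicator (F (Suc k))) p =
        (\<Sum>G\<in>facets_in (F (Suc k)) V. chain_coeff \<Phi> k (F(k := G)) * indicator ((F(k := G)) k) p)"
        by (simp add: chain_coeff_step[OF k(2)] sum_distrib_left mult_ac)
    qed
    also have "\<dots> = (\<Sum>F\<in>face_chains k \<Phi> A. chain_coeff \<Phi> k F * indicator (F k) p)"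
      unfolding V_def by (rule sum_face_chains_step[OF fl A k, symmetric])
    finally show ?thesis .
  qed
  have t3: "thin V {x. jump (n k) S x \<noteq> (\<Sum>F\<in>face_chains k \<Phi> A. chain_coeff \<Phi> k F * indicator (F k) x)}"
    by (intro thinI exI[of _ "{h\<in>\<Sigma>. \<not> vanishes_on h V}"]) (use A(2) t2 in auto)
  show ?case
    unfolding V_def[symmetric] by (rule thin_subset[OF thin_Un[OF t1 t3]]) auto
qed

section \<open>Volume on affine subspaces\<close>

lemma lborel_distr_reflect:
  fixes t :: "'a::euclidean_space"
  shows "distr lborel borel (\<lambda>x. t - x) = lborel"
  by (subst lborel_affine[of "-1" t]) (auto simp: density_1 one_ennreal_def[symmetric] scaleR_minus1_left)

lemma nn_integral_lborel_translate:
  fixes t :: "'a::euclidean_space"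
  assumes [measurable]: "f \<in> borel_measurable borel"
  shows "(\<integral>\<^sup>+x. f (t + x) \<partial>lborel) = (\<integral>\<^sup>+x. f x \<partial>lborel)"
    "(\<integral>\<^sup>+x. f (t - x) \<partial>lborel) = (\<integral>\<^sup>+x. f x \<partial>lborel)"
proof -
  have "(\<integral>\<^sup>+x. f x \<partial>lborel) = (\<integral>\<^sup>+x. f x \<partial>distr lborel borel ((+) t))" by (simp add: lborel_distr_plus)
  also have "\<dots> = (\<integral>\<^sup>+x. f (t + x) \<partial>lborel)" by (subst nn_integral_distr) auto
  finally show "(\<integral>\<^sup>+x. f (t + x) \<partial>lborel) = (\<integral>\<^sup>+x. f x \<partial>lborel)" by simp
  have "(\<integral>\<^sup>+x. f x \<partial>lborel) = (\<integral>\<^sup>+x. f x \<partial>distr lborel borel (\<lambda>x. t - x))" by (simp add: lborel_distr_reflect)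
  also have "\<dots> = (\<integral>\<^sup>+x. f (t - x) \<partial>lborel)" by (subst nn_integral_distr) auto
  finally show "(\<integral>\<^sup>+x. f (t - x) \<partial>lborel) = (\<integral>\<^sup>+x. f x \<partial>lborel)" by simp
qed

text \<open>Evaluating \<open>\<integral>\<integral> indicator A x * indicator B (x + T y)\<close> in both orders compares \<open>A\<close> with the unit ball,
  which \<open>T\<close> preserves.\<close>

lemma lborel_distr_orthogonal:
  fixes T :: "'a::euclidean_space \<Rightarrow> 'a"
  assumes T: "orthogonal_transformation T"
  shows "distr lborel borel T = lborel"
proof (rule measure_eqI)
  have lin: "linear T" using T by (rule orthogonal_transformation_linear)
  have Tm [measurable]: "T \<in> borel_measurable borel"
    by (intro borel_measurable_continuous_onI linear_continuous_on linear_conv_bounded_linear[THEN iffD1] lin)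
  \<comment> \<open>A right inverse of \<open>T\<close> writes \<open>x + T y\<close> as
    \<open>T (T' x + y)\<close>, after which the inner integral is a translate in
    \<open>y\<close>.\<close>
  obtain T' where T': "\<And>x. T (T' x) = x"
    using orthogonal_transformation_surj[OF T] by (metis surjD)
  show "sets (distr lborel borel T) = sets lborel" by simp
  fix A assume "A \<in> sets (distr lborel borel T)"
  then have A [measurable]: "A \<in> sets borel" by simp
  define B where "B = ball (0::'a) 1"
  have B [measurable]: "B \<in> sets borel" by (simp add: B_def)
  have TB: "T -` B = B" using orthogonal_transformation_norm[OF T] by (auto simp: B_def)
  have vA [measurable]: "T -` A \<in> sets borel" using measurable_sets[OF Tm A] by simp
  have "emeasure lborel A * emeasure lborel (T -` B) = (\<integral>\<^sup>+x. indicator A x * emeasure lborel (T -` B) \<partial>lborel)"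
    by (simp add: nn_integral_multc)
  also have "\<dots> = (\<integral>\<^sup>+x. (\<integral>\<^sup>+y. indicator A x * indicator B (x + T y) \<partial>lborel) \<partial>lborel)"
  proof (rule nn_integral_cong)
    fix x :: 'a
    have "(\<integral>\<^sup>+y. indicator B (x + T y) \<partial>lborel) = (\<integral>\<^sup>+y. indicator (T -` B) (T' x + y) \<partial>lborel)"
      by (simp add: linear_add[OF lin] T' indicator_def)
    also have "\<dots> = emeasure lborel (T -` B)"
      using nn_integral_lborel_translate(1)[of "indicator (T -` B)" "T' x"] TB by simp
    finally show "indicator A x * emeasure lborel (T -` B) = (\<integral>\<^sup>+y. indicator A x * indicator B (x + T y) \<partial>lborel)"
      by (subst nn_integral_cmult) auto
  qed
  also have "\<dots> = (\<integral>\<^sup>+y. (\<integral>\<^sup>+x. indicator A x * indicator B (x + T y) \<partial>lborel) \<partial>lborel)"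
    by (rule lborel_pair.Fubini'[symmetric]) measurable
  also have "\<dots> = (\<integral>\<^sup>+y. (\<integral>\<^sup>+x. indicator A (x - T y) * indicator B x \<partial>lborel) \<partial>lborel)"
  proof (rule nn_integral_cong)
    fix y :: 'a
    show "(\<integral>\<^sup>+x. indicator A x * indicator B (x + T y) \<partial>lborel) = (\<integral>\<^sup>+x. indicator A (x - T y) * indicator B x \<partial>lborel)"
      using nn_integral_lborel_translate(1)[of "\<lambda>x. indicator A (x - T y) * indicator B x" "T y"]
      by (simp add: add.commute)
  qed
  also have "\<dots> = (\<integral>\<^sup>+x. (\<integral>\<^sup>+y. indicator A (x - T y) * indicator B x \<partial>lborel) \<partial>lborel)"
    by (rule lborel_pair.Fubini') measurable
  also have "\<dots> = (\<integral>\<^sup>+x. emeasure lborel (T -` A) * indicator B x \<partial>lborel)"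
  proof (rule nn_integral_cong)
    fix x :: 'a
    have "(\<integral>\<^sup>+y. indicator A (x - T y) \<partial>lborel) = (\<integral>\<^sup>+y. indicator (T -` A) (T' x - y) \<partial>lborel)"
      by (simp add: linear_diff[OF lin] T' indicator_def)
    also have "\<dots> = emeasure lborel (T -` A)"
      using nn_integral_lborel_translate(2)[of "indicator (T -` A)" "T' x"] by simp
    finally show "(\<integral>\<^sup>+y. indicator A (x - T y) * indicator B x \<partial>lborel) = emeasure lborel (T -` A) * indicator B x"
      by (subst nn_integral_multc) auto
  qed
  also have "\<dots> = emeasure lborel (T -` A) * emeasure lborel B"
    by (simp add: nn_integral_cmult)
  finally have eq: "emeasure lborel A * emeasure lborel B = emeasure lborel (T -` A) * emeasure lborel B"
    unfolding TB .
  have fin: "emeasure lborel B \<noteq> \<infinity>"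
    unfolding B_def using emeasure_lborel_ball_finite[of "0::'a" 1] by simp
  have pos: "emeasure lborel B \<noteq> 0"
  proof
    assume "emeasure lborel B = 0"
    then have "negligible B" using B by (simp add: negligible_iff_null_sets null_sets_completionI null_sets_def)
    then show False using open_not_negligible[of B] by (simp add: B_def)
  qed
  have "emeasure lborel A = emeasure lborel (T -` A)"
    using eq fin pos by (auto simp: mult.commute[of _ "emeasure lborel B"] ennreal_mult_cancel_left)
  then show "emeasure (distr lborel borel T) A = emeasure lborel A"
    by (simp add: emeasure_distr)
qed

text \<open>An orthogonal map taking the standard basis to \<open>D\<close> pulls the box back to a
  product of sets of standard coordinates.\<close>

lemma emeasure_lborel_orthonormal_box:
  fixes D :: "'a::euclidean_space set"
  assumes D: "pairwise orthogonal D" "\<And>d. d \<in> D \<Longrightarrow> norm d = 1" "span D = UNIV"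
    and A: "\<And>d. d \<in> D \<Longrightarrow> A d \<in> sets borel"
  shows "emeasure lborel {x. \<forall>d\<in>D. x \<bullet> d \<in> A d} = (\<Prod>d\<in>D. emeasure lborel (A d))"
proof -
  have "0 \<notin> D" using D(2) by fastforce
  then have ind: "independent D" using pairwise_orthogonal_independent D(1) by blast
  then have finD: "finite D" by (rule independent_imp_finite)
  have "card D = DIM('a)" using dim_span_eq_card_independent[OF ind] D(3) by simp
  then obtain \<phi> where \<phi>: "bij_betw \<phi> (Basis::'a set) D"
    using finD finite_same_card_bij[OF finite_Basis finD] by auto
  have \<phi>D: "\<phi> i \<in> D" if "i \<in> Basis" for i using \<phi> that by (auto simp: bij_betw_def)
  have ip: "\<phi> i \<bullet> \<phi> j = (if i = j then 1 else 0)" if "i \<in> Basis" "j \<in> Basis" for i j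
  proof (cases "i = j")
    case True
    then show ?thesis using D(2)[OF \<phi>D[OF that(1)]] by (simp add: norm_eq_1)
  next
    case False
    then have "\<phi> i \<noteq> \<phi> j" using \<phi> that by (auto simp: bij_betw_def inj_on_def)
    then show ?thesis using False D(1) \<phi>D that by (auto simp: pairwise_def orthogonal_def)
  qed
  define T where "T x = (\<Sum>i\<in>Basis. (x \<bullet> i) *\<^sub>R \<phi> i)" for x :: 'a
  have lin: "linear T" unfolding T_def
    by (intro linear_compose_sum ballI linearI) (auto simp: inner_add_left algebra_simps)
  have Tin: "T x \<bullet> \<phi> j = x \<bullet> j" if "j \<in> Basis" for x j
  proof -
    have "T x \<bullet> \<phi> j = (\<Sum>i\<in>Basis. (x \<bullet> i) * (if i = j then 1 else 0))"
      unfolding T_def inner_sum_left by (rule sum.cong) (use ip that in auto)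
    also have "\<dots> = (\<Sum>i\<in>Basis. if i = j then x \<bullet> i else 0)" by (rule sum.cong) auto
    also have "\<dots> = x \<bullet> j" using that by simp
    finally show ?thesis .
  qed
  have "T x \<bullet> T y = x \<bullet> y" for x y
  proof -
    have "T x \<bullet> T y = (\<Sum>i\<in>Basis. (y \<bullet> i) * (T x \<bullet> \<phi> i))"
      unfolding T_def[of y] inner_sum_right by simp
    also have "\<dots> = (\<Sum>i\<in>Basis. (x \<bullet> i) * (y \<bullet> i))" by (rule sum.cong) (auto simp: Tin)
    also have "\<dots> = x \<bullet> y" by (rule euclidean_inner[symmetric])
    finally show ?thesis .
  qed
  then have "orthogonal_transformation T" unfolding orthogonal_transformation_def using lin by simp
  then have dT: "distr lborel borel T = lborel" by (rule lborel_distr_orthogonal)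
  have Tm [measurable]: "T \<in> borel_measurable borel" unfolding T_def by measurable
  have X: "{x::'a. \<forall>d\<in>D. x \<bullet> d \<in> A d} \<in> sets borel"
  proof -
    have "{x::'a. \<forall>d\<in>D. x \<bullet> d \<in> A d} = {x \<in> space borel. \<forall>d\<in>D. x \<bullet> d \<in> A d}" by simp
    also have "\<dots> \<in> sets borel"
    proof (rule sets.sets_Collect_finite_All'[OF _ finD], goal_cases)
      case (1 d)
      have "(\<lambda>x::'a. x \<bullet> d) -` A d \<inter> space borel \<in> sets borel"
        by (rule measurable_sets[OF _ A[OF 1]]) simp
      then show ?case by (simp add: vimage_def)
    qed (use \<open>card D = DIM('a)\<close> in auto)
    finally show ?thesis .
  qed
  have "emeasure lborel {x. \<forall>d\<in>D. x \<bullet> d \<in> A d} = emeasure (distr lborel borel T) {x. \<forall>d\<in>D. x \<bullet> d \<in> A d}"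
    by (simp add: dT)
  also have "\<dots> = emeasure lborel (T -` {x. \<forall>d\<in>D. x \<bullet> d \<in> A d})"
    by (subst emeasure_distr) (use X in auto)
  also have "T -` {x. \<forall>d\<in>D. x \<bullet> d \<in> A d} = {x. \<forall>i\<in>Basis. x \<bullet> i \<in> A (\<phi> i)}"
    using \<phi> by (auto simp: Tin bij_betw_def)
  also have "emeasure lborel \<dots> = (\<integral>\<^sup>+x. (\<Prod>i\<in>Basis. indicator (A (\<phi> i)) (x \<bullet> i)) \<partial>lborel)"
  proof -
    have [measurable]: "{x::'a. \<forall>i\<in>Basis. x \<bullet> i \<in> A (\<phi> i)} \<in> sets borel"
      using measurable_sets[OF Tm X] \<open>T -` {x. \<forall>d\<in>D. x \<bullet> d \<in> A d} = {x. \<forall>i\<in>Basis. x \<bullet> i \<in> A (\<phi> i)}\<close> by simp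
    have "indicator {x::'a. \<forall>i\<in>Basis. x \<bullet> i \<in> A (\<phi> i)} x = (\<Prod>i\<in>Basis. indicator (A (\<phi> i)) (x \<bullet> i) :: ennreal)" for x
    proof (cases "\<forall>i\<in>Basis. x \<bullet> i \<in> A (\<phi> i)")
      case False
      then obtain i where "i \<in> Basis" "x \<bullet> i \<notin> A (\<phi> i)" by blast
      then have "(\<Prod>i\<in>Basis. indicator (A (\<phi> i)) (x \<bullet> i) :: ennreal) = 0" by (intro prod_zero bexI[of _ i]) auto
      then show ?thesis using False by simp
    qed simp
    then show ?thesis by (simp flip: nn_integral_indicator)
  qed
  also have "\<dots> = (\<Prod>i\<in>Basis. emeasure lborel (A (\<phi> i)))"
    by (subst nn_integral_lborel_prod) (use A \<phi>D in auto)
  also have "\<dots> = (\<Prod>d\<in>D. emeasure lborel (A d))"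
    by (rule prod.reindex_bij_betw[OF \<phi>])
  finally show ?thesis .
qed

text \<open>A product measure is determined by its boxes, so
  \<open>emeasure_lborel_orthonormal_box\<close> identifies the distribution of the coordinates with
  respect to \<open>D\<close>; recombining the coordinates returns the point.\<close>

lemma lborel_eq_orthonormal:
  fixes D :: "'a::euclidean_space set"
  assumes D: "pairwise orthogonal D" "\<And>d. d \<in> D \<Longrightarrow> norm d = 1" "span D = UNIV"
  shows "lborel = distr (\<Pi>\<^sub>M d\<in>D. lborel) borel (\<lambda>t. \<Sum>d\<in>D. t d *\<^sub>R d)"
proof -
  have "0 \<notin> D" using D(2) by fastforce
  then have finD: "finite D" using pairwise_orthogonal_independent D(1) independent_imp_finite by blast
  interpret product_sigma_finite "\<lambda>_::'a. lborel :: real measure" ..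
  have cm [measurable]: "(\<lambda>x. \<lambda>d\<in>D. x \<bullet> d) \<in> measurable lborel (\<Pi>\<^sub>M d\<in>D. (lborel :: real measure))"
    by (rule measurable_restrict) simp
  have "distr lborel (\<Pi>\<^sub>M d\<in>D. lborel) (\<lambda>x. \<lambda>d\<in>D. x \<bullet> d) = (\<Pi>\<^sub>M d\<in>D. (lborel :: real measure))"
  proof (rule PiM_eqI[OF finD])
    fix A assume A: "\<And>d. d \<in> D \<Longrightarrow> A d \<in> sets (lborel :: real measure)"
    have "emeasure (distr lborel (\<Pi>\<^sub>M d\<in>D. lborel) (\<lambda>x. \<lambda>d\<in>D. x \<bullet> d)) (Pi\<^sub>E D A)
      = emeasure lborel ((\<lambda>x. \<lambda>d\<in>D. x \<bullet> d) -` Pi\<^sub>E D A \<inter> space lborel)"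
      by (rule emeasure_distr[OF cm]) (use A finD in \<open>auto intro!: sets_PiM_I_finite\<close>)
    also have "(\<lambda>x. \<lambda>d\<in>D. x \<bullet> d) -` Pi\<^sub>E D A \<inter> space lborel = {x. \<forall>d\<in>D. x \<bullet> d \<in> A d}"
      by (auto simp: PiE_iff)
    also have "emeasure lborel \<dots> = (\<Prod>d\<in>D. emeasure lborel (A d))"
      by (rule emeasure_lborel_orthonormal_box[OF D]) (use A in auto)
    finally show "emeasure (distr lborel (\<Pi>\<^sub>M d\<in>D. lborel) (\<lambda>x. \<lambda>d\<in>D. x \<bullet> d)) (Pi\<^sub>E D A) = (\<Prod>d\<in>D. emeasure lborel (A d))" .
  qed simp
  then have "distr (\<Pi>\<^sub>M d\<in>D. lborel) borel (\<lambda>t. \<Sum>d\<in>D. t d *\<^sub>R d)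
    = distr (distr lborel (\<Pi>\<^sub>M d\<in>D. lborel) (\<lambda>x. \<lambda>d\<in>D. x \<bullet> d)) borel (\<lambda>t. \<Sum>d\<in>D. t d *\<^sub>R d)"
    by simp
  also have "\<dots> = distr lborel borel ((\<lambda>t. \<Sum>d\<in>D. t d *\<^sub>R d) \<circ> (\<lambda>x. \<lambda>d\<in>D. x \<bullet> d))"
    by (rule distr_distr[OF _ cm]) measurable
  also have "(\<lambda>t. \<Sum>d\<in>D. t d *\<^sub>R d) \<circ> (\<lambda>x. \<lambda>d\<in>D. x \<bullet> d) = (\<lambda>x. x)"
  proof
    fix x :: 'a
    have "(\<Sum>d\<in>D. (x \<bullet> d) *\<^sub>R d) = x"
      by (rule orthonormal_basis_expand[OF D(1,2) _ finD]) (use D(3) in auto)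
    then show "((\<lambda>t. \<Sum>d\<in>D. t d *\<^sub>R d) \<circ> (\<lambda>x. \<lambda>d\<in>D. x \<bullet> d)) x = x" by simp
  qed
  also have "distr lborel borel (\<lambda>x. x) = (lborel :: 'a measure)"
    by (rule distr_id2) simp
  finally show ?thesis by simp
qed

section \<open>Affine subspaces thickened by a unit cube\<close>

definition orthonormal :: "'a::euclidean_space set \<Rightarrow> bool" where
  "orthonormal C \<longleftrightarrow> pairwise orthogonal C \<and> (\<forall>c\<in>C. norm c = 1)"

definition perp_space :: "'a::euclidean_space \<Rightarrow> 'a set \<Rightarrow> 'a set" where
  "perp_space p C = {x. \<forall>c\<in>C. c \<bullet> (x - p) = 0}"

text \<open>The product of \<open>perp_space p C\<close> with a unit cube in the normal directions
  \<open>C\<close>. Integrating a function of \<open>flatten p C x\<close> over it amounts to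
  integrating that function over the subspace, but with the Lebesgue measure of the whole
  space.\<close>

definition slab :: "'a::euclidean_space \<Rightarrow> 'a set \<Rightarrow> 'a set" where
  "slab p C = {x. \<forall>c\<in>C. c \<bullet> (x - p) \<in> {0..1}}"

definition flatten :: "'a::euclidean_space \<Rightarrow> 'a set \<Rightarrow> 'a \<Rightarrow> 'a" where
  "flatten p C x = x - (\<Sum>c\<in>C. (c \<bullet> (x - p)) *\<^sub>R c)"

lemma orthonormal_inner: "orthonormal C \<Longrightarrow> c \<in> C \<Longrightarrow> d \<in> C \<Longrightarrow> c \<bullet> d = (if c = d then 1 else 0)"
  by (auto simp: orthonormal_def pairwise_def orthogonal_def norm_eq_1)

lemma orthonormal_independent: "orthonormal C \<Longrightarrow> independent C"
  unfolding orthonormal_def using pairwise_orthogonal_independent by fastforce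

lemma orthonormal_finite: "orthonormal C \<Longrightarrow> finite C"
  using orthonormal_independent independent_imp_finite by blast

lemma inner_sum_orthonormal:
  assumes "orthonormal C" "d \<in> C" shows "d \<bullet> (\<Sum>c\<in>C. f c *\<^sub>R c) = f d"
proof -
  have "d \<bullet> (\<Sum>c\<in>C. f c *\<^sub>R c) = (\<Sum>c\<in>C. if c = d then f c else 0)"
    unfolding inner_sum_right by (rule sum.cong) (use orthonormal_inner[OF assms(1)] assms(2) in auto)
  then show ?thesis using assms(2) orthonormal_finite[OF assms(1)] by simp
qed

lemma flatten_in_perp_space: "orthonormal C \<Longrightarrow> flatten p C x \<in> perp_space p C"
  by (auto simp: flatten_def perp_space_def inner_diff_right inner_sum_orthonormal)

lemma flatten_perp_space [simp]: "x \<in> perp_space p C \<Longrightarrow> flatten p C x = x"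
  by (simp add: flatten_def perp_space_def)

lemma flatten_translate_along: "(\<And>c. c \<in> C \<Longrightarrow> c \<bullet> s = 0) \<Longrightarrow> flatten p C (x + s) = flatten p C x + s"
  by (simp add: flatten_def inner_diff_right inner_add_right)

lemma slab_translate_along: "(\<And>c. c \<in> C \<Longrightarrow> c \<bullet> s = 0) \<Longrightarrow> x + s \<in> slab p C \<longleftrightarrow> x \<in> slab p C"
  by (simp add: slab_def inner_diff_right inner_add_right)

lemma flatten_translate: "flatten (p + l) C (x + l) = flatten p C x + l"
  by (simp add: flatten_def)

lemma slab_translate: "x + l \<in> slab (p + l) C \<longleftrightarrow> x \<in> slab p C"
  by (simp add: slab_def)

lemma continuous_on_flatten: "continuous_on S (flatten p C)"
  unfolding flatten_def by (intro continuous_intros)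

lemma borel_measurable_flatten [measurable]: "flatten p C \<in> borel_measurable borel"
  by (intro borel_measurable_continuous_onI continuous_on_flatten)

lemma closed_slab: "closed (slab p C)"
proof -
  have "slab p C = (\<Inter>c\<in>C. {x. c \<bullet> (x - p) \<in> {0..1}})" by (auto simp: slab_def)
  moreover have "closed {x. c \<bullet> (x - p) \<in> {0..1}}" for c
  proof -
    have "closed ((\<lambda>x. c \<bullet> (x - p)) -` {0..1})"
      by (intro continuous_closed_vimage) (auto intro!: continuous_intros)
    then show ?thesis by (simp add: vimage_def)
  qed
  ultimately show ?thesis by (simp add: closed_INT)
qed

lemma borel_slab [measurable]: "slab p C \<in> sets borel"
  using closed_slab by (rule borel_closed)

lemma slab_interior_nonempty:
  assumes "orthonormal C"
  obtains q e where "e > 0" "ball q e \<subseteq> slab p C"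
proof -
  define q where "q = p + (\<Sum>c\<in>C. (1/2) *\<^sub>R c)"
  have "x \<in> slab p C" if "x \<in> ball q (1/2)" for x
  proof -
    have "c \<bullet> (x - p) \<in> {0..1}" if c: "c \<in> C" for c
    proof -
      have "c \<bullet> (x - p) = c \<bullet> (x - q) + 1/2"
        using inner_sum_orthonormal[OF assms c, of "\<lambda>_. 1/2"] by (simp add: q_def inner_diff_right inner_add_right)
      moreover have "\<bar>c \<bullet> (x - q)\<bar> \<le> norm (x - q)"
        using Cauchy_Schwarz_ineq2[of c "x - q"] assms c by (simp add: orthonormal_def)
      moreover have "norm (x - q) < 1/2" using \<open>x \<in> ball q (1/2)\<close> by (simp add: dist_norm norm_minus_commute)
      ultimately show ?thesis by auto
    qed
    then show ?thesis by (simp add: slab_def)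
  qed
  then show thesis by (intro that[of "1/2" q]) auto
qed

lemma slab_flatten_close:
  assumes "orthonormal C" "x \<in> slab p C" shows "norm (x - flatten p C x) \<le> real (card C)"
proof -
  have "norm (\<Sum>c\<in>C. (c \<bullet> (x - p)) *\<^sub>R c) \<le> (\<Sum>c\<in>C. 1)"
    by (rule order_trans[OF norm_sum sum_mono]) (use assms in \<open>auto simp: orthonormal_def slab_def\<close>)
  then show ?thesis by (simp add: flatten_def)
qed

lemma slab_flatten_bound:
  assumes "orthonormal C" "x \<in> slab p C"
  shows "norm x \<le> norm (flatten p C x) + real (card C)" "norm (flatten p C x) \<le> norm x + real (card C)"
  using slab_flatten_close[OF assms] norm_triangle_ineq2[of x "flatten p C x"]
    norm_triangle_ineq3[of x "flatten p C x"] by linarith+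

lemma orthonormal_basis_exists:
  assumes "subspace S" shows "\<exists>B. orthonormal B \<and> span B = S"
  using orthonormal_basis_subspace[OF assms] unfolding orthonormal_def by metis

text \<open>\<open>C\<close> is an orthonormal basis of the orthogonal complement of the direction
  space, and a subspace is the complement of its complement.\<close>

lemma affine_eq_perp_space:
  fixes V :: "'a::euclidean_space set"
  assumes "affine V" "p \<in> V"
  shows "\<exists>C. orthonormal C \<and> V = perp_space p C"
proof -
  define T where "T = (\<lambda>x. x - p) ` V"
  have T: "subspace T" unfolding T_def using affine_diffs_subspace_subtract[OF assms] .
  define T' where "T' = {y. \<forall>x\<in>T. orthogonal x y}"
  have "subspace T'" unfolding T'_def by (rule subspace_orthogonal_to_vectors)
  from orthonormal_basis_exists[OF this] obtain C where C: "orthonormal C" "span C = T'" by blast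
  have CT: "C \<subseteq> T'" using C(2) span_superset by blast
  have "x \<in> T" if x: "\<And>c. c \<in> C \<Longrightarrow> c \<bullet> x = 0" for x
  proof -
    obtain y z where yz: "y \<in> span T" "\<And>w. w \<in> span T \<Longrightarrow> orthogonal z w" "x = y + z"
      using orthogonal_subspace_decomp_exists[of T x] by metis
    have yT: "y \<in> T" using yz(1) T span_eq_iff by metis
    have "z \<in> T'" using yz(2) by (auto simp: T'_def span_base orthogonal_commute)
    then have zC: "z \<in> span C" using C(2) by simp
    have "orthogonal x w" if "w \<in> span C" for w
      by (rule orthogonal_to_span[OF that]) (use x in \<open>auto simp: orthogonal_def inner_commute\<close>)
    then have "x \<bullet> z = 0" using zC by (simp add: orthogonal_def)
    moreover have "y \<bullet> z = 0" using yz(2)[OF yz(1)] by (simp add: orthogonal_def inner_commute)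
    ultimately have "z \<bullet> z = 0" using yz(3) by (simp add: inner_add_left)
    then show ?thesis using yz(3) yT by simp
  qed
  moreover have "c \<bullet> x = 0" if "x \<in> T" "c \<in> C" for x c
    using CT that by (auto simp: T'_def orthogonal_def inner_commute)
  ultimately have "T = {x. \<forall>c\<in>C. c \<bullet> x = 0}" by blast
  moreover have "x \<in> V \<longleftrightarrow> x - p \<in> T" for x by (auto simp: T_def)
  ultimately have "V = perp_space p C" by (auto simp: perp_space_def)
  then show ?thesis using C(1) by blast
qed

lemma perp_space_eq_image: "perp_space p C = (\<lambda>v. p + v) ` {x. \<forall>c\<in>C. c \<bullet> x = 0}"
proof (intro set_eqI iffI)
  fix x assume "x \<in> perp_space p C"
  then show "x \<in> (\<lambda>v. p + v) ` {x. \<forall>c\<in>C. c \<bullet> x = 0}" by (intro image_eqI[of _ _ "x - p"]) (auto simp: perp_space_def)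
qed (auto simp: perp_space_def)

lemma orthonormal_frame_exists: "\<exists>p' B. orthonormal_frame (perp_space p C) p' B"
proof -
  have sub: "subspace {x. \<forall>c\<in>C. c \<bullet> x = 0}"
    by (auto simp: subspace_def inner_add_right)
  obtain B where "orthonormal B" "span B = {x. \<forall>c\<in>C. c \<bullet> x = 0}"
    using orthonormal_basis_exists[OF sub] by blast
  then have "orthonormal_frame (perp_space p C) p B"
    by (simp add: orthonormal_frame_def perp_space_eq_image orthonormal_def)
  then show ?thesis by blast
qed

lemma slab_flatten_add:
  assumes C: "orthonormal C" and q: "\<And>c. c \<in> C \<Longrightarrow> c \<bullet> (q - p) = 0" and y: "\<And>c. c \<in> C \<Longrightarrow> c \<bullet> y = 0"
  shows "flatten p C (q + (y + (\<Sum>c\<in>C. r c *\<^sub>R c))) = q + y"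
    "q + (y + (\<Sum>c\<in>C. r c *\<^sub>R c)) \<in> slab p C \<longleftrightarrow> (\<forall>c\<in>C. r c \<in> {0..1})"
proof -
  define z where "z = (\<Sum>c\<in>C. r c *\<^sub>R c)"
  have c: "c \<bullet> (q + (y + z) - p) = r c" if "c \<in> C" for c
  proof -
    have "c \<bullet> (q + (y + z) - p) = c \<bullet> (q - p) + c \<bullet> y + c \<bullet> z"
      by (simp add: inner_add_right inner_diff_right)
    then show ?thesis using q[OF that] y[OF that] inner_sum_orthonormal[OF C that, of r] by (simp add: z_def)
  qed
  have "(\<Sum>c\<in>C. (c \<bullet> (q + (y + z) - p)) *\<^sub>R c) = z"
    unfolding z_def by (rule sum.cong[OF refl]) (simp add: c[unfolded z_def])
  then show "flatten p C (q + (y + (\<Sum>c\<in>C. r c *\<^sub>R c))) = q + y"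
    unfolding flatten_def z_def[symmetric] by simp
  show "q + (y + (\<Sum>c\<in>C. r c *\<^sub>R c)) \<in> slab p C \<longleftrightarrow> (\<forall>c\<in>C. r c \<in> {0..1})"
    unfolding slab_def mem_Collect_eq z_def[symmetric] by (rule ball_cong[OF refl]) (simp only: c)
qed

text \<open>The frame \<open>B\<close> chosen in \<open>rel_volume\<close> and the normals
  \<open>C\<close> together form an orthonormal basis. In its coordinates the thickened set is the
  product of the coordinate set of \<open>F\<close> with a unit cube of measure 1, whichever frame
  the choice returns.\<close>

lemma rel_volume_eq_slab:
  fixes F :: "'a::euclidean_space set"
  assumes C: "orthonormal C" and F: "affine hull F = perp_space p C" "F \<in> sets borel"
  shows "rel_volume F = measure lborel {x\<in>slab p C. flatten p C x \<in> F}"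
proof -
  define pB where "pB = (SOME (p', B). orthonormal_frame (affine hull F) p' B)"
  obtain q B where qB: "pB = (q, B)" by (cases pB)
  obtain p' B' where "orthonormal_frame (perp_space p C) p' B'" using orthonormal_frame_exists by blast
  then have "case (p', B') of (p', B) \<Rightarrow> orthonormal_frame (affine hull F) p' B" using F(1) by simp
  then have "case pB of (p', B) \<Rightarrow> orthonormal_frame (affine hull F) p' B"
    unfolding pB_def by (rule someI)
  then have fr: "orthonormal_frame (perp_space p C) q B" unfolding qB F(1) by simp
  have B: "orthonormal B" using fr by (auto simp: orthonormal_frame_def orthonormal_def)
  have ps: "perp_space p C = (\<lambda>v. q + v) ` span B" using fr by (simp add: orthonormal_frame_def)
  have "q + 0 \<in> perp_space p C" unfolding ps using span_zero by blast
  then have qp: "c \<bullet> (q - p) = 0" if "c \<in> C" for c using that by (simp add: perp_space_def)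
  have sB: "x \<in> span B \<longleftrightarrow> (\<forall>c\<in>C. c \<bullet> x = 0)" for x
  proof -
    have "x \<in> span B \<longleftrightarrow> q + x \<in> perp_space p C" unfolding ps by auto
    also have "\<dots> \<longleftrightarrow> (\<forall>c\<in>C. c \<bullet> x + c \<bullet> (q - p) = 0)"
      by (simp add: perp_space_def inner_add_right inner_diff_right algebra_simps)
    finally show ?thesis using qp by simp
  qed
  have BC0: "b \<bullet> c = 0" if "b \<in> B" "c \<in> C" for b c
    using sB[of b] span_base[OF that(1)] that(2) by (metis inner_commute)
  have disj: "B \<inter> C = {}"
  proof -
    have "b \<notin> C" if "b \<in> B" for b
      using BC0[OF that, of b] B that orthonormal_inner[of B b b] by auto
    then show ?thesis by blast
  qed
  have finB: "finite B" and finC: "finite C" using B C orthonormal_finite by auto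
  define D where "D = B \<union> C"
  have D: "pairwise orthogonal D" "\<And>d. d \<in> D \<Longrightarrow> norm d = 1"
  proof -
    show "pairwise orthogonal D"
      using B C BC0 unfolding D_def orthonormal_def pairwise_def orthogonal_def by (metis UnE inner_commute)
    show "norm d = 1" if "d \<in> D" for d using that B C by (auto simp: D_def orthonormal_def)
  qed
  have spD: "span D = UNIV"
  proof -
    have "x \<in> span D" for x
    proof -
      have "x - (\<Sum>c\<in>C. (c \<bullet> x) *\<^sub>R c) \<in> span B"
        unfolding sB by (simp add: inner_diff_right inner_sum_orthonormal[OF C])
      then have "x - (\<Sum>c\<in>C. (c \<bullet> x) *\<^sub>R c) \<in> span D" using span_mono[of B D] by (auto simp: D_def)
      moreover have "(\<Sum>c\<in>C. (c \<bullet> x) *\<^sub>R c) \<in> span D"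
        by (intro span_sum span_scale span_base) (simp add: D_def)
      ultimately have "(x - (\<Sum>c\<in>C. (c \<bullet> x) *\<^sub>R c)) + (\<Sum>c\<in>C. (c \<bullet> x) *\<^sub>R c) \<in> span D" by (rule span_add)
      then show ?thesis by simp
    qed
    then show ?thesis by blast
  qed
  interpret product_sigma_finite "\<lambda>_::'a. lborel :: real measure" ..
  let ?MB = "\<Pi>\<^sub>M b\<in>B. (lborel :: real measure)" and ?MC = "\<Pi>\<^sub>M c\<in>C. (lborel :: real measure)"
  let ?MD = "\<Pi>\<^sub>M d\<in>B \<union> C. (lborel :: real measure)"
  interpret PB: sigma_finite_measure ?MB by (rule sigma_finite[OF finB])
  interpret PC: sigma_finite_measure ?MC by (rule sigma_finite[OF finC])
  define E where "E = {x\<in>slab p C. flatten p C x \<in> F}"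
  have Em [measurable]: "E \<in> sets borel"
  proof -
    have "E = slab p C \<inter> (flatten p C -` F \<inter> space borel)" by (auto simp: E_def)
    then show ?thesis using measurable_sets[OF borel_measurable_flatten F(2), of p C] by simp
  qed
  define X where "X = {t \<in> space ?MB. q + (\<Sum>b\<in>B. t b *\<^sub>R b) \<in> F}"
  define Y where "Y = (\<Pi>\<^sub>E c\<in>C. {0..1::real})"
  have gm [measurable]: "(\<lambda>t. \<Sum>d\<in>I. t d *\<^sub>R d) \<in> measurable (\<Pi>\<^sub>M d\<in>I. (lborel :: real measure)) borel" for I :: "'a set"
    by measurable
  have Xm: "X \<in> sets ?MB"
  proof -
    have "(\<lambda>t. q + (\<Sum>b\<in>B. t b *\<^sub>R b)) \<in> measurable ?MB borel" by measurable
    from measurable_sets[OF this F(2)] show ?thesis by (simp add: X_def vimage_def Int_def conj_commute)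
  qed
  have Ym: "Y \<in> sets ?MC" unfolding Y_def by (rule sets_PiM_I_finite[OF finC]) simp
  have "emeasure lborel E = emeasure (distr lborel borel ((+) q)) E" by (simp add: lborel_distr_plus)
  also have "\<dots> = emeasure lborel ((+) q -` E)" by (subst emeasure_distr) auto
  also have "\<dots> = emeasure (distr ?MD borel (\<lambda>t. \<Sum>d\<in>B \<union> C. t d *\<^sub>R d)) ((+) q -` E)"
    using lborel_eq_orthonormal[OF D spD] by (simp add: D_def)
  also have "\<dots> = emeasure ?MD ((\<lambda>t. \<Sum>d\<in>B \<union> C. t d *\<^sub>R d) -` ((+) q -` E) \<inter> space ?MD)"
    by (rule emeasure_distr) (auto intro: measurable_sets[of "(+) q" borel borel E, simplified])
  also have "\<dots> = emeasure (distr (?MB \<Otimes>\<^sub>M ?MC) ?MD (merge B C)) ((\<lambda>t. \<Sum>d\<in>B \<union> C. t d *\<^sub>R d) -` ((+) q -` E) \<inter> space ?MD)"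
    by (subst distr_merge[OF disj finB finC]) simp
  also have "\<dots> = emeasure (?MB \<Otimes>\<^sub>M ?MC) (merge B C -` ((\<lambda>t. \<Sum>d\<in>B \<union> C. t d *\<^sub>R d) -` ((+) q -` E) \<inter> space ?MD) \<inter> space (?MB \<Otimes>\<^sub>M ?MC))"
    by (rule emeasure_distr) (auto intro!: measurable_sets[OF gm] measurable_sets[of "(+) q" borel borel E, simplified])
  also have "merge B C -` ((\<lambda>t. \<Sum>d\<in>B \<union> C. t d *\<^sub>R d) -` ((+) q -` E) \<inter> space ?MD) \<inter> space (?MB \<Otimes>\<^sub>M ?MC) = X \<times> Y" (is "?L = _")
  proof -
    have key: "q + (\<Sum>d\<in>B \<union> C. merge B C (s, r) d *\<^sub>R d) \<in> E \<longleftrightarrow> q + (\<Sum>b\<in>B. s b *\<^sub>R b) \<in> F \<and> (\<forall>c\<in>C. r c \<in> {0..1})" for s r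
    proof -
      define y where "y = (\<Sum>b\<in>B. s b *\<^sub>R b)"
      have "(\<Sum>d\<in>B \<union> C. merge B C (s, r) d *\<^sub>R d) = (\<Sum>d\<in>B. merge B C (s, r) d *\<^sub>R d) + (\<Sum>d\<in>C. merge B C (s, r) d *\<^sub>R d)"
        by (rule sum.union_disjoint[OF finB finC disj])
      also have "(\<Sum>d\<in>B. merge B C (s, r) d *\<^sub>R d) = y"
        unfolding y_def by (rule sum.cong) (auto simp: merge_def)
      also have "(\<Sum>d\<in>C. merge B C (s, r) d *\<^sub>R d) = (\<Sum>c\<in>C. r c *\<^sub>R c)"
        using disj by (intro sum.cong) (auto simp: merge_def)
      finally have msum: "(\<Sum>d\<in>B \<union> C. merge B C (s, r) d *\<^sub>R d) = y + (\<Sum>c\<in>C. r c *\<^sub>R c)" .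
      have "y \<in> span B" unfolding y_def by (intro span_sum span_scale span_base)
      then have y0: "c \<bullet> y = 0" if "c \<in> C" for c using sB[of y] that by blast
      have "z \<in> E \<longleftrightarrow> z \<in> slab p C \<and> flatten p C z \<in> F" for z by (simp add: E_def)
      moreover note slab_flatten_add[of C q p y r, OF C qp y0]
      ultimately have "q + (y + (\<Sum>c\<in>C. r c *\<^sub>R c)) \<in> E \<longleftrightarrow> q + y \<in> F \<and> (\<forall>c\<in>C. r c \<in> {0..1})"
        by (metis (no_types, lifting))
      then show ?thesis by (subst msum) (simp only: y_def)
    qed
    have mem: "(s, r) \<in> ?L \<longleftrightarrow> (s, r) \<in> X \<times> Y" for s r
    proof -
      have "(s, r) \<in> space (?MB \<Otimes>\<^sub>M ?MC) \<Longrightarrow> merge B C (s, r) \<in> space ?MD"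
        using measurable_space[OF measurable_merge[of B C "\<lambda>_. lborel"]] by blast
      moreover have "(s, r) \<in> space (?MB \<Otimes>\<^sub>M ?MC) \<longleftrightarrow> s \<in> space ?MB \<and> r \<in> space ?MC" by (simp add: space_pair_measure)
      moreover have "r \<in> Y \<longleftrightarrow> r \<in> space ?MC \<and> (\<forall>c\<in>C. r c \<in> {0..1})"
        by (auto simp: Y_def space_PiM PiE_iff)
      ultimately show ?thesis using key[of s r] unfolding X_def by auto
    qed
    show ?thesis
    proof (rule set_eqI)
      fix sr
      show "sr \<in> ?L \<longleftrightarrow> sr \<in> X \<times> Y" by (cases sr) (simp only: mem)
    qed
  qed
  also have "emeasure (?MB \<Otimes>\<^sub>M ?MC) (X \<times> Y) = emeasure ?MB X * emeasure ?MC Y"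
    by (rule PC.emeasure_pair_measure_Times[OF Xm Ym])
  also have "emeasure ?MC Y = 1" unfolding Y_def by (subst emeasure_PiM[OF finC]) auto
  finally have "emeasure lborel E = emeasure ?MB X" by simp
  then have "measure lborel E = measure ?MB X" by (simp add: measure_def)
  moreover have "rel_volume F = measure ?MB X"
    unfolding rel_volume_def pB_def[symmetric] qB X_def by (simp add: Let_def)
  ultimately show ?thesis unfolding E_def by simp
qed

section \<open>Periodisation over a lattice\<close>

lemma integral_lborel_translate:
  fixes f :: "'a::euclidean_space \<Rightarrow> real"
  assumes [measurable]: "f \<in> borel_measurable borel"
  shows "(\<integral>x. f (x + t) \<partial>lborel) = (\<integral>x. f x \<partial>lborel)"
proof -
  have "(\<integral>x. f x \<partial>lborel) = (\<integral>x. f x \<partial>distr lborel borel ((+) t))" by (simp add: lborel_distr_plus)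
  also have "\<dots> = (\<integral>x. f (t + x) \<partial>lborel)" by (subst integral_distr) auto
  finally show ?thesis by (simp add: add.commute)
qed

lemma integrable_lborel_bounded_support:
  fixes f :: "'a::euclidean_space \<Rightarrow> real"
  assumes "f \<in> borel_measurable borel" "\<And>x. \<bar>f x\<bar> \<le> K" "\<And>x. f x \<noteq> 0 \<Longrightarrow> norm x \<le> M"
  shows "integrable lborel f"
proof (rule integrableI_bounded_set[where A="cball 0 M" and B=K])
  show "emeasure lborel (cball (0::'a) M) < \<infinity>" by (rule emeasure_lborel_cball_finite)
  show "AE x in lborel. x \<notin> cball 0 M \<longrightarrow> f x = 0" using assms(3) by (intro AE_I2) auto
qed (use assms in auto)

text \<open>Composed with \<open>flatten\<close>, a functional that is non-zero somewhere on the
  subspace becomes an affine functional on the whole space with a null zero set. Countably many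
  balls then exhaust the subspace.\<close>

lemma AE_not_in_thin:
  assumes C: "orthonormal C" and N: "thin (perp_space p C) N"
  shows "AE x in lborel. flatten p C x \<notin> N"
proof -
  have null: "AE x in lborel. aval h (flatten p C x) \<noteq> 0" if h: "\<not> vanishes_on h (perp_space p C)" for h
  proof -
    define a' where "a' = fst h - (\<Sum>c\<in>C. (fst h \<bullet> c) *\<^sub>R c)"
    define b' where "b' = snd h - (\<Sum>c\<in>C. (c \<bullet> p) * (fst h \<bullet> c))"
    have eq: "aval h (flatten p C x) = a' \<bullet> x - b'" for x
      by (simp add: aval_def flatten_def a'_def b'_def inner_diff_left inner_diff_right inner_sum_left inner_sum_right
          sum_subtractf algebra_simps)
    obtain z where z: "z \<in> perp_space p C" "aval h z \<noteq> 0" using h by (auto simp: vanishes_on_def)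
    then have "a' \<bullet> z - b' \<noteq> 0" using eq[of z] by simp
    \<comment> \<open>If \<open>a'\<close> is 0 the set is empty, a case that
      \<open>negligible_hyperplane\<close> covers as well.\<close>
    then have "a' \<noteq> 0 \<or> b' \<noteq> 0" by auto
    then have "negligible {x. a' \<bullet> x = b'}" by (rule negligible_hyperplane)
    then have "{x. a' \<bullet> x = b'} \<in> null_sets lborel"
      using closed_hyperplane[of a' b'] by (simp add: negligible_iff_null_sets null_sets_completion_iff)
    from AE_not_in[OF this] show ?thesis by (auto simp: eq elim!: eventually_mono)
  qed
  have "AE x in lborel. norm (flatten p C x) < real k \<longrightarrow> flatten p C x \<notin> N" for k
  proof -
    obtain \<Theta> where \<Theta>: "finite \<Theta>" "\<forall>h\<in>\<Theta>. \<not> vanishes_on h (perp_space p C)"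
      "\<forall>x\<in>perp_space p C. norm x < real k \<longrightarrow> (\<forall>h\<in>\<Theta>. aval h x \<noteq> 0) \<longrightarrow> x \<notin> N"
      using thinD[OF N, of "real k"] by blast
    have "AE x in lborel. \<forall>h\<in>\<Theta>. aval h (flatten p C x) \<noteq> 0"
      using \<Theta>(1,2) null by (intro AE_finite_allI) auto
    then show ?thesis
      by eventually_elim (use \<Theta>(3) flatten_in_perp_space[OF C] in blast)
  qed
  then have "AE x in lborel. \<forall>k::nat. norm (flatten p C x) < real k \<longrightarrow> flatten p C x \<notin> N"
    unfolding AE_all_countable by (rule allI)
  then show ?thesis
    by eventually_elim (use reals_Archimedean2 in blast)
qed

lemma card_translate_class:
  fixes S X :: "'a::ab_group_add set"
  assumes S: "\<And>s t. s \<in> S \<Longrightarrow> t \<in> S \<Longrightarrow> s + t \<in> S" "\<And>s. s \<in> S \<Longrightarrow> - s \<in> S" and s: "s \<in> S"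
  shows "card {t\<in>S. (x + s) + t \<in> X} = card {t\<in>S. x + t \<in> X}"
proof (rule bij_betw_same_card)
  show "bij_betw (\<lambda>t. s + t) {t\<in>S. (x + s) + t \<in> X} {t\<in>S. x + t \<in> X}"
  proof (rule bij_betwI[where g="\<lambda>t. - s + t"])
    show "(\<lambda>t. s + t) \<in> {t\<in>S. (x + s) + t \<in> X} \<rightarrow> {t\<in>S. x + t \<in> X}"
      using S(1)[OF s] by (auto simp: add.assoc)
    show "(\<lambda>t. - s + t) \<in> {t\<in>S. x + t \<in> X} \<rightarrow> {t\<in>S. (x + s) + t \<in> X}"
      using S(1)[OF S(2)[OF s]] by (auto simp: algebra_simps)
  qed auto
qed

text \<open>Unfolding without a fundamental domain: \<open>w\<close> below is a bounded weight whose \<open>S\<close>-translates add up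
  to 1 on a large ball.\<close>

lemma periodic_integral:
  fixes G :: "'a::euclidean_space \<Rightarrow> real"
  assumes S: "0 \<in> S" "\<And>s t. s \<in> S \<Longrightarrow> t \<in> S \<Longrightarrow> s + t \<in> S" "\<And>s. s \<in> S \<Longrightarrow> - s \<in> S"
    and finS: "\<And>R. finite {s\<in>S. norm s \<le> R}"
    and Q: "Q \<in> sets borel" "\<And>x s. s \<in> S \<Longrightarrow> x + s \<in> Q \<longleftrightarrow> x \<in> Q" "e > 0" "ball q e \<subseteq> Q"
    and G: "G \<in> borel_measurable borel" "\<And>x. \<bar>G x\<bar> \<le> K" "\<And>x. x \<in> Q \<Longrightarrow> G x \<noteq> 0 \<Longrightarrow> norm x \<le> \<rho>"
    and \<rho>: "norm q + e \<le> \<rho>"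
    and sum: "AE x in lborel. x \<in> Q \<longrightarrow> norm x \<le> \<rho> \<longrightarrow> (\<Sum>s\<in>{s\<in>S. norm s \<le> 2 * \<rho>}. G (x + s)) = c"
  shows "\<exists>\<kappa>>0. (\<integral>x. indicator Q x * G x \<partial>lborel) = c * \<kappa>"
proof -
  note [measurable] = Q(1) G(1)
  define X where "X = cball (0::'a) \<rho>"
  have Xm [measurable]: "X \<in> sets borel" by (simp add: X_def)
  \<comment> \<open>\<open>2 * \<rho>\<close> bounds the difference of two points of the ball
    \<open>X\<close> of radius \<rho>, so \<open>S0\<close> contains every vector of
    \<open>S\<close> that joins two points of \<open>X\<close>.\<close>
  define S0 where "S0 = {s\<in>S. norm s \<le> 2 * \<rho>}"
  have fin: "finite S0" using finS by (simp add: S0_def)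
  define N where "N x = (\<Sum>s\<in>S0. indicator X (x + s) :: real)" for x
  \<comment> \<open>For \<open>x\<close> in \<open>X\<close>, \<open>N x\<close> counts the points
    of the \<open>S\<close>-orbit of \<open>x\<close> in \<open>X\<close>, so it is constant along
    the orbit within \<open>X\<close>. Dividing by it makes the values of \<open>w\<close> along the
    orbit sum to 1.\<close>
  define w where "w x = indicator X x / N x" for x
  have inS0: "s \<in> S0" if "s \<in> S" "x \<in> X" "x + s \<in> X" for s x
  proof -
    have "norm s = norm ((x + s) - x)" by simp
    also have "\<dots> \<le> norm (x + s) + norm x" by (rule norm_triangle_ineq4)
    finally show ?thesis using that by (simp add: S0_def X_def)
  qed
  have N_card: "N x = real (card {s\<in>S. x + s \<in> X})" if "x \<in> X" for x
  proof -
    have "N x = (\<Sum>s\<in>S0. if x + s \<in> X then 1 else 0)" by (simp add: N_def indicator_def of_bool_def)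
    also have "\<dots> = (\<Sum>s\<in>{s\<in>S0. x + s \<in> X}. 1)" by (simp add: sum.If_cases[OF fin] Int_def)
    also have "{s\<in>S0. x + s \<in> X} = {s\<in>S. x + s \<in> X}"
    proof
      show "{s\<in>S. x + s \<in> X} \<subseteq> {s\<in>S0. x + s \<in> X}" using inS0 that by blast
      show "{s\<in>S0. x + s \<in> X} \<subseteq> {s\<in>S. x + s \<in> X}" by (auto simp: S0_def)
    qed
    finally show ?thesis by simp
  qed
  have "\<rho> \<ge> 0" using \<rho> Q(3) norm_ge_zero[of q] by linarith
  have "0 \<in> S0" using S(1) \<open>\<rho> \<ge> 0\<close> by (simp add: S0_def)
  have N1: "N x \<ge> 1" if "x \<in> X" for x
  proof -
    have "N x \<ge> (\<Sum>s\<in>{0}. indicator X (x + s))" unfolding N_def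
      by (rule sum_mono2) (use fin \<open>0 \<in> S0\<close> in auto)
    then show ?thesis using that by simp
  qed
  have Nt: "N (x + s) = N x" if "s \<in> S" "x \<in> X" "x + s \<in> X" for x s
    using N_card[OF that(2)] N_card[OF that(3)] card_translate_class[OF S(2,3) that(1), of x X] by simp
  have wsum: "(\<Sum>s\<in>S0. w (x + s)) = 1" if "x \<in> X" for x
  proof -
    have "(\<Sum>s\<in>S0. w (x + s)) = (\<Sum>s\<in>S0. indicator X (x + s) / N x)"
    proof (rule sum.cong[OF refl])
      fix s assume "s \<in> S0"
      then show "w (x + s) = indicator X (x + s) / N x"
        using Nt[of s x] that by (cases "x + s \<in> X") (auto simp: w_def S0_def)
    qed
    also have "\<dots> = (\<Sum>s\<in>S0. indicator X (x + s)) / N x" by (rule sum_divide_distrib[symmetric])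
    also have "\<dots> = N x / N x" by (simp only: N_def)
    finally show ?thesis using N1[OF that] by simp
  qed
  have Nm [measurable]: "N \<in> borel_measurable borel" unfolding N_def by measurable
  have wm [measurable]: "w \<in> borel_measurable borel" unfolding w_def by measurable
  have wb: "0 \<le> w x" "w x \<le> 1" for x
    using N1[of x] by (cases "x \<in> X"; simp add: w_def)+
  have wX: "x \<in> X" if "w x \<noteq> 0" for x using that by (cases "x \<in> X") (auto simp: w_def)
  have K0: "K \<ge> 0" using G(2)[of 0] by linarith
  have negS0: "- s \<in> S0" if "s \<in> S0" for s using that S(3) by (simp add: S0_def)
  have i1: "integrable lborel (\<lambda>x. indicator Q x * G x * w (x + s))" for s
  proof (rule integrable_lborel_bounded_support[where K=K and M=\<rho>])
    fix x
    have "\<bar>indicator Q x * G x * w (x + s)\<bar> = indicator Q x * \<bar>G x\<bar> * w (x + s)"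
      using wb[of "x + s"] by (simp add: abs_mult)
    also have "\<dots> \<le> 1 * K * 1"
      by (intro mult_mono) (use wb G(2) K0 in \<open>auto simp: indicator_def\<close>)
    finally show "\<bar>indicator Q x * G x * w (x + s)\<bar> \<le> K" by simp
    show "indicator Q x * G x * w (x + s) \<noteq> 0 \<Longrightarrow> norm x \<le> \<rho>" using G(3)[of x] by (cases "x \<in> Q") auto
  qed measurable
  have i2: "integrable lborel (\<lambda>x. indicator Q x * G (x - s) * w x)" for s
  proof (rule integrable_lborel_bounded_support[where K=K and M=\<rho>])
    fix x
    have "\<bar>indicator Q x * G (x - s) * w x\<bar> = indicator Q x * \<bar>G (x - s)\<bar> * w x"
      using wb[of x] by (simp add: abs_mult)
    also have "\<dots> \<le> 1 * K * 1"
      by (intro mult_mono) (use wb G(2) K0 in \<open>auto simp: indicator_def\<close>)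
    finally show "\<bar>indicator Q x * G (x - s) * w x\<bar> \<le> K" by simp
    show "indicator Q x * G (x - s) * w x \<noteq> 0 \<Longrightarrow> norm x \<le> \<rho>" using wX[of x] by (auto simp: X_def)
  qed measurable
  have i3: "integrable lborel (\<lambda>x. indicator Q x * w x)"
  proof (rule integrable_lborel_bounded_support[where K=1 and M=\<rho>])
    fix x
    show "\<bar>indicator Q x * w x\<bar> \<le> 1" using wb[of x] by (auto simp: indicator_def)
    show "indicator Q x * w x \<noteq> 0 \<Longrightarrow> norm x \<le> \<rho>" using wX[of x] by (auto simp: X_def)
  qed measurable
  \<comment> \<open>Insert the sum of \<open>w (x + s)\<close>, which is 1 on the support of
    \<open>G\<close> in \<open>Q\<close>; move the shift from \<open>w\<close> to \<open>G\<close>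
    by translation invariance; then sum over \<open>S0\<close> again. Now \<open>G\<close> adds up
    to \<open>c\<close>, and the mass of \<open>w\<close> on \<open>Q\<close> remains as
    \<kappa>.\<close>
  have "(\<integral>x. indicator Q x * G x \<partial>lborel) = (\<integral>x. (\<Sum>s\<in>S0. indicator Q x * G x * w (x + s)) \<partial>lborel)"
  proof (rule Bochner_Integration.integral_cong[OF refl])
    fix x
    show "indicator Q x * G x = (\<Sum>s\<in>S0. indicator Q x * G x * w (x + s))"
    proof (cases "x \<in> Q \<and> G x \<noteq> 0")
      case True
      then have "x \<in> X" using G(3) by (simp add: X_def)
      then show ?thesis using wsum by (simp flip: sum_distrib_left)
    qed auto
  qed
  also have "\<dots> = (\<Sum>s\<in>S0. \<integral>x. indicator Q x * G x * w (x + s) \<partial>lborel)"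
    by (rule Bochner_Integration.integral_sum) (rule i1)
  also have "\<dots> = (\<Sum>s\<in>S0. \<integral>x. indicator Q x * G (x - s) * w x \<partial>lborel)"
  proof (rule sum.cong[OF refl])
    fix s assume "s \<in> S0"
    then have "s \<in> S" by (simp add: S0_def)
    have "(\<integral>x. indicator Q x * G x * w (x + s) \<partial>lborel) = (\<integral>x. indicator Q (x + s) * G (x + s - s) * w (x + s) \<partial>lborel)"
      using Q(2)[OF \<open>s \<in> S\<close>] by (simp add: indicator_def)
    also have "\<dots> = (\<integral>x. indicator Q x * G (x - s) * w x \<partial>lborel)"
      by (rule integral_lborel_translate[of "\<lambda>x. indicator Q x * G (x - s) * w x" s]) measurable
    finally show "(\<integral>x. indicator Q x * G x * w (x + s) \<partial>lborel) = (\<integral>x. indicator Q x * G (x - s) * w x \<partial>lborel)" .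
  qed
  also have "\<dots> = (\<integral>x. (\<Sum>s\<in>S0. indicator Q x * G (x - s) * w x) \<partial>lborel)"
    by (rule Bochner_Integration.integral_sum[symmetric]) (rule i2)
  also have "\<dots> = (\<integral>x. c * (indicator Q x * w x) \<partial>lborel)"
  proof (rule integral_cong_AE)
    show "AE x in lborel. (\<Sum>s\<in>S0. indicator Q x * G (x - s) * w x) = c * (indicator Q x * w x)"
      using sum
    proof eventually_elim
      case (elim x)
      show ?case
      proof (cases "x \<in> Q \<and> x \<in> X")
        case True
        have "(\<Sum>s\<in>S0. G (x - s)) = (\<Sum>s\<in>S0. G (x + s))"
          by (rule sum.reindex_bij_witness[of _ uminus uminus]) (use negS0 in auto)
        also have "\<dots> = c" using elim True by (simp add: S0_def X_def)
        finally have "(\<Sum>s\<in>S0. G (x - s)) = c" .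
        then show ?thesis by (simp flip: sum_distrib_left sum_distrib_right)
      next
        case False
        then have "indicator Q x * w x = 0" using wX[of x] by (auto simp: indicator_def)
        then show ?thesis by auto
      qed
    qed
  qed measurable
  also have "\<dots> = c * (\<integral>x. indicator Q x * w x \<partial>lborel)" by simp
  finally have eq: "(\<integral>x. indicator Q x * G x \<partial>lborel) = c * (\<integral>x. indicator Q x * w x \<partial>lborel)" .
  \<comment> \<open>\<open>w\<close> is positive on the ball around \<open>q\<close>, which lies in
    \<open>Q\<close> and, by the bound on \<rho>, in \<open>X\<close>.\<close>
  have "(\<integral>x. indicator Q x * w x \<partial>lborel) \<noteq> 0"
  proof
    assume "(\<integral>x. indicator Q x * w x \<partial>lborel) = 0"
    then have "AE x in lborel. indicator Q x * w x = 0"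
      using integral_nonneg_eq_0_iff_AE[OF i3] wb by simp
    then have "AE x in lborel. x \<notin> ball q e"
    proof eventually_elim
      case (elim x)
      show ?case
      proof
        assume x: "x \<in> ball q e"
        then have "norm x \<le> norm q + e"
          using norm_triangle_ineq2[of x q] by (simp add: dist_norm norm_minus_commute)
        then have "x \<in> X" using \<rho> by (simp add: X_def)
        then have "w x > 0" using N1 by (simp add: w_def) (metis less_le_trans zero_less_one)
        then show False using elim x Q(4) by (auto simp: indicator_def)
      qed
    qed
    then have "ball q e \<in> null_sets lborel"
      by (subst AE_iff_null_sets) auto
    then have "negligible (ball q e)" by (simp add: negligible_iff_null_sets null_sets_completion_iff)
    then show False using open_not_negligible[of "ball q e"] Q(3) by simp
  qed
  moreover have "(\<integral>x. indicator Q x * w x \<partial>lborel) \<ge> 0" using wb by (intro integral_nonneg_AE AE_I2) simp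
  ultimately show ?thesis using eq by (intro exI[of _ "\<integral>x. indicator Q x * w x \<partial>lborel"]) simp
qed

section \<open>Lattices, and almost everywhere versus thin\<close>

lemma lattice_group:
  assumes "is_lattice L"
  shows "0 \<in> L" "x \<in> L \<Longrightarrow> y \<in> L \<Longrightarrow> x + y \<in> L" "x \<in> L \<Longrightarrow> - x \<in> L" "x \<in> L \<Longrightarrow> y \<in> L \<Longrightarrow> x - y \<in> L"
  using assms unfolding is_lattice_def
  by (auto intro: group_closure_add group_closure.diff)

text \<open>The coordinates with respect to \<open>B\<close> are integers on the lattice, and
  bounded on bounded sets because each is a linear functional.\<close>

lemma lattice_finite_bounded:
  fixes L :: "'a::euclidean_space set"
  assumes "is_lattice L" shows "finite {l\<in>L. norm l \<le> R}"
proof -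
  obtain B where B: "independent B" "card B = DIM('a)" "L = group_closure B"
    using assms unfolding is_lattice_def by blast
  have finB: "finite B" using B(1) by (rule independent_imp_finite)
  have "\<exists>g. linear g \<and> (\<forall>x\<in>B. g x = (if x = b then 1 else 0 :: real))" for b
    using linear_independent_extend[OF B(1), of "\<lambda>x. if x = b then 1 else 0"] by blast
  then obtain g where g: "\<And>b. linear (g b)" "\<And>b x. x \<in> B \<Longrightarrow> g b x = (if x = b then 1 else 0 :: real)" by metis
  have "\<exists>K. \<forall>x. norm (g b x) \<le> K * norm x" for b
    using linear_bounded[OF g(1)[of b]] by blast
  then obtain K where K: "\<And>b x. \<bar>g b x\<bar> \<le> K b * norm x" by (metis real_norm_def)
  have coords: "(\<forall>b\<in>B. g b x \<in> \<int>) \<and> x = (\<Sum>b\<in>B. g b x *\<^sub>R b)" if "x \<in> group_closure B" for x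
    using that
  proof induction
    case (base s)
    then consider "s = 0" | "s \<in> B" by blast
    then show ?case
    proof cases
      case 1
      then show ?thesis using linear_0[OF g(1)] by simp
    next
      case 2
      have "(\<Sum>b\<in>B. g b s *\<^sub>R b) = (\<Sum>b\<in>B. if b = s then b else 0)"
        by (rule sum.cong) (use g(2)[OF 2] in auto)
      then show ?thesis using 2 finB g(2)[OF 2] by auto
    qed
  next
    case (diff s t)
    have "(\<Sum>b\<in>B. g b (s - t) *\<^sub>R b) = (\<Sum>b\<in>B. g b s *\<^sub>R b) - (\<Sum>b\<in>B. g b t *\<^sub>R b)"
      by (simp add: linear_diff[OF g(1)] scaleR_diff_left sum_subtractf)
    then show ?case using diff.IH by (auto simp: linear_diff[OF g(1)])
  qed
  define I where "I b = {z::real. z \<in> \<int> \<and> \<bar>z\<bar> \<le> K b * R}" for b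
  have finI: "finite (I b)" for b
  proof -
    have "I b \<subseteq> real_of_int ` {- \<lceil>K b * R\<rceil>..\<lceil>K b * R\<rceil>}"
    proof
      fix z assume "z \<in> I b"
      then obtain k where k: "z = real_of_int k" "\<bar>real_of_int k\<bar> \<le> K b * R" by (auto simp: I_def elim!: Ints_cases)
      then have "k \<le> \<lceil>K b * R\<rceil>" "- k \<le> \<lceil>K b * R\<rceil>" by linarith+
      then show "z \<in> real_of_int ` {- \<lceil>K b * R\<rceil>..\<lceil>K b * R\<rceil>}" using k(1) by auto
    qed
    then show ?thesis using finite_surj by blast
  qed
  have "{l\<in>L. norm l \<le> R} \<subseteq> (\<lambda>z. \<Sum>b\<in>B. z b *\<^sub>R b) ` (\<Pi>\<^sub>E b\<in>B. I b)"
  proof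
    fix l assume l: "l \<in> {l\<in>L. norm l \<le> R}"
    have c: "\<forall>b\<in>B. g b l \<in> \<int>" "l = (\<Sum>b\<in>B. g b l *\<^sub>R b)" using coords[of l] l B(3) by auto
    have "g b l \<in> I b" if "b \<in> B" for b
    proof -
      have "norm l \<le> R" using l by simp
      have "0 \<le> K b"
      proof -
        have "b \<noteq> 0" using B(1) that dependent_zero by blast
        moreover have "1 \<le> K b * norm b" using K[of b b] g(2)[OF that] by simp
        ultimately show ?thesis by (metis less_le_not_le mult_nonpos_nonneg nle_le norm_ge_zero order_trans zero_less_one)
      qed
      then have "K b * norm l \<le> K b * R" using \<open>norm l \<le> R\<close> by (rule mult_left_mono[rotated])
      then show ?thesis using K[of b l] c(1) that by (simp add: I_def)
    qed
    then have "(\<lambda>b\<in>B. g b l) \<in> (\<Pi>\<^sub>E b\<in>B. I b)" by auto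
    moreover have "l = (\<Sum>b\<in>B. (\<lambda>b\<in>B. g b l) b *\<^sub>R b)" using c(2) by simp
    ultimately show "l \<in> (\<lambda>z. \<Sum>b\<in>B. z b *\<^sub>R b) ` (\<Pi>\<^sub>E b\<in>B. I b)"
      unfolding image_iff by blast
  qed
  moreover have "finite ((\<lambda>z. \<Sum>b\<in>B. z b *\<^sub>R b) ` (\<Pi>\<^sub>E b\<in>B. I b))"
    using finB finI by (intro finite_imageI finite_PiE)
  ultimately show ?thesis by (rule finite_subset)
qed

lemma lattice_countable:
  assumes "is_lattice L" shows "countable L"
proof -
  have "L = (\<Union>k::nat. {l\<in>L. norm l \<le> real k})" using real_arch_simple by blast
  moreover have "countable (\<Union>k::nat. {l\<in>L. norm l \<le> real k})"
    by (rule countable_UN) (auto intro: countable_finite lattice_finite_bounded[OF assms])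
  ultimately show ?thesis by simp
qed

text \<open>At a generic point \<open>u\<close> is constant on a whole ball, and a ball does not fit
  into a null set.\<close>

lemma AE_const_imp_thin:
  fixes u :: "'a::euclidean_space \<Rightarrow> real"
  assumes "locally_adapted u" "AE x in lebesgue. u x = c"
  shows "thin UNIV {x. u x \<noteq> c}"
proof (rule thinI)
  fix R
  obtain \<Sigma> where \<Sigma>: "finite \<Sigma>" "adapted_on \<Sigma> (ball 0 R) u"
    using spec[OF assms(1)[unfolded locally_adapted_def]] by blast
  have "u x = c" if x: "norm x < R" "\<forall>h\<in>{h\<in>\<Sigma>. \<not> vanishes_on h UNIV}. aval h x \<noteq> 0" for x
  proof (rule ccontr)
    assume "u x \<noteq> c"
    obtain e where e: "e > 0" "\<forall>z\<in>UNIV. dist z x < e \<longrightarrow> norm z < R \<and> u z = u x"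
      using locally_const_at_generic_point[OF \<Sigma>, of x UNIV] x by blast
    obtain N where N: "N \<in> null_sets lebesgue" "{x. u x \<noteq> c} \<subseteq> N"
      using assms(2) unfolding eventually_ae_filter by auto
    have "ball x e \<subseteq> {x. u x \<noteq> c}" using e(2) \<open>u x \<noteq> c\<close> by (auto simp: dist_commute)
    then have "ball x e \<subseteq> N" using N(2) by (rule subset_trans)
    moreover have "negligible N" using N(1) by (simp add: negligible_iff_null_sets)
    ultimately have "negligible (ball x e)" using negligible_subset by blast
    then show False using open_not_negligible[of "ball x e"] e(1) by simp
  qed
  then show "\<exists>\<Theta>. finite \<Theta> \<and> (\<forall>h\<in>\<Theta>. \<not> vanishes_on h UNIV) \<and>
    (\<forall>x\<in>UNIV. norm x < R \<longrightarrow> (\<forall>h\<in>\<Theta>. aval h x \<noteq> 0) \<longrightarrow> x \<notin> {x. u x \<noteq> c})"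
    using \<Sigma>(1) by (intro exI[of _ "{h\<in>\<Sigma>. \<not> vanishes_on h UNIV}"]) auto
qed

lemma thin_UNIV_imp_AE:
  assumes "thin UNIV N" shows "AE x in lebesgue. x \<notin> N"
proof -
  \<comment> \<open>With no normals \<open>flatten\<close> is the identity and the subspace is the
    whole space.\<close>
  have "AE x in lborel. flatten 0 {} x \<notin> N"
    by (rule AE_not_in_thin) (use assms in \<open>auto simp: orthonormal_def perp_space_def\<close>)
  then show ?thesis by (auto simp: flatten_def intro: AE_completion)
qed

section \<open>Translating functionals, subspaces and flags\<close>

definition shift_functional :: "'a::euclidean_space \<Rightarrow> 'a \<times> real \<Rightarrow> 'a \<times> real" where
  "shift_functional l h = (fst h, snd h - fst h \<bullet> l)"

lemma aval_shift_functional [simp]: "aval (shift_functional l h) x = aval h (x + l)"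
  by (simp add: shift_functional_def aval_def inner_add_right)

lemma adapted_on_translate:
  assumes "adapted_on \<Sigma> UNIV u" shows "adapted_on (shift_functional l ` \<Sigma>) UNIV (\<lambda>x. u (x + l))"
  unfolding adapted_on_def
proof (intro ballI impI)
  fix x y assume "same_side (shift_functional l ` \<Sigma>) x y"
  then have "same_side \<Sigma> (x + l) (y + l)" by (simp add: same_side_def)
  then show "u (x + l) = u (y + l)" using adapted_onD[OF assms] by blast
qed

lemma adapted_on_sum:
  assumes "\<And>i. i \<in> I \<Longrightarrow> adapted_on (\<Sigma> i) X (u i)"
  shows "adapted_on (\<Union>i\<in>I. \<Sigma> i) X (\<lambda>x. \<Sum>i\<in>I. u i x)"
  unfolding adapted_on_def
proof (intro ballI impI sum.cong[OF refl])
  fix x y i assume xy: "x \<in> X" "y \<in> X" "same_side (\<Union>i\<in>I. \<Sigma> i) x y" "i \<in> I"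
  then have "same_side (\<Sigma> i) x y" unfolding same_side_def by blast
  then show "u i x = u i y" using adapted_onD[OF assms[OF xy(4)]] xy by blast
qed

lemma thin_translate:
  assumes "thin ((+) l ` V) N" shows "thin V {x. x + l \<in> N}"
proof (rule thinI)
  fix R
  obtain \<Theta> where \<Theta>: "finite \<Theta>" "\<forall>h\<in>\<Theta>. \<not> vanishes_on h ((+) l ` V)"
    "\<forall>x\<in>(+) l ` V. norm x < R + norm l \<longrightarrow> (\<forall>h\<in>\<Theta>. aval h x \<noteq> 0) \<longrightarrow> x \<notin> N"
    using thinD[OF assms, of "R + norm l"] by blast
  have nv: "\<not> vanishes_on k V" if "k \<in> shift_functional l ` \<Theta>" for k
    using that \<Theta>(2) by (auto simp: vanishes_on_def add.commute)
  have "x \<notin> {x. x + l \<in> N}" if "x \<in> V" "norm x < R" "\<forall>h\<in>shift_functional l ` \<Theta>. aval h x \<noteq> 0" for x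
  proof -
    have "norm (x + l) < R + norm l" using norm_triangle_ineq[of x l] that(2) by linarith
    moreover have "x + l \<in> (+) l ` V" using that(1) by (auto simp: add.commute)
    ultimately show ?thesis using bspec[OF \<Theta>(3), of "x + l"] that(3) by simp
  qed
  then show "\<exists>\<Theta>. finite \<Theta> \<and> (\<forall>h\<in>\<Theta>. \<not> vanishes_on h V) \<and>
    (\<forall>x\<in>V. norm x < R \<longrightarrow> (\<forall>h\<in>\<Theta>. aval h x \<noteq> 0) \<longrightarrow> x \<notin> {x. x + l \<in> N})"
    using nv \<Theta>(1) by (intro exI[of _ "shift_functional l ` \<Theta>"]) blast
qed

lemma half_space_of_translate:
  assumes "half_space_of W V H" shows "half_space_of ((+) l ` W) ((+) l ` V) ((+) l ` H)"
proof -
  obtain a b where ab: "V \<noteq> {}" "V \<noteq> W" "V = {x\<in>W. a \<bullet> x = b}" "H = {x\<in>W. a \<bullet> x \<ge> b}"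
    using assms unfolding half_space_of_def by blast
  have "(+) l ` V \<noteq> {}" using ab(1) by simp
  moreover have "(+) l ` V \<noteq> (+) l ` W" using ab(2) by (simp add: inj_image_eq_iff)
  moreover have "(+) l ` V = {x\<in>(+) l ` W. a \<bullet> x = b + a \<bullet> l}" by (auto simp: ab(3) inner_add_right)
  moreover have "(+) l ` H = {x\<in>(+) l ` W. a \<bullet> x \<ge> b + a \<bullet> l}" by (auto simp: ab(4) inner_add_right)
  ultimately show ?thesis unfolding half_space_of_def by blast
qed

lemma crosses_translate:
  assumes "crosses W V H n" shows "crosses ((+) l ` W) ((+) l ` V) ((+) l ` H) n"
proof -
  obtain h where h: "V = {x\<in>W. aval h x = 0}" "H = {x\<in>W. aval h x \<ge> 0}" "fst h \<bullet> n > 0"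
    and *: "V \<noteq> {}" "\<forall>x\<in>W. x + n \<in> W"
    using assms unfolding crosses_def by blast
  have "(+) l ` V = {x\<in>(+) l ` W. aval (shift_functional (- l) h) x = 0}" by (auto simp: h(1))
  moreover have "(+) l ` H = {x\<in>(+) l ` W. aval (shift_functional (- l) h) x \<ge> 0}" by (auto simp: h(2))
  moreover have "fst (shift_functional (- l) h) \<bullet> n > 0" using h(3) by (simp add: shift_functional_def)
  moreover have "\<forall>x\<in>(+) l ` W. x + n \<in> (+) l ` W" using *(2) by (auto simp: add.assoc)
  ultimately show ?thesis unfolding crosses_def using *(1) by blast
qed

lemma fst_translate_flag: "fst (translate_flag l \<Phi>) j = (+) l ` fst \<Phi> j"
  and snd_translate_flag: "snd (translate_flag l \<Phi>) j = (+) l ` snd \<Phi> j"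
  by (simp_all add: translate_flag_def split_beta)

lemma is_flag_translate:
  assumes "is_flag r \<Phi>" shows "is_flag r (translate_flag l \<Phi>)"
proof -
  obtain V H where \<Phi>: "\<Phi> = (V, H)" by (cases \<Phi>)
  have "surj ((+) l)" by (rule surjI[of _ "\<lambda>x. x - l"]) simp
  then show ?thesis
    using assms unfolding \<Phi> is_flag_def translate_flag_def
    by (auto simp: affine_translation[symmetric] aff_dim_translation_eq image_mono intro!: half_space_of_translate)
qed

lemma flag_directions_translate:
  "flag_directions r \<Phi> n \<Longrightarrow> flag_directions r (translate_flag l \<Phi>) n"
  by (simp add: flag_directions_def fst_translate_flag snd_translate_flag crosses_translate)

lemma is_flag_mono:
  fixes \<Phi> :: "'a::euclidean_space flag"
  assumes "is_flag r \<Phi>" "r \<le> j" "j \<le> DIM('a)" shows "fst \<Phi> r \<subseteq> fst \<Phi> j"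
  using assms(2,3)
proof (induction rule: dec_induct)
  case (step i)
  then show ?case using is_flagD(5)[OF assms(1), of i] by auto
qed simp

lemma image_translate_eqI:
  fixes l l' :: "'a::ab_group_add"
  assumes "\<And>x. x \<in> X \<Longrightarrow> x + (l - l') \<in> X" "\<And>x. x \<in> X \<Longrightarrow> x + (l' - l) \<in> X"
  shows "(+) l ` X = (+) l' ` X"
proof (intro subset_antisym subsetI)
  fix y assume "y \<in> (+) l ` X"
  then obtain x where "x \<in> X" "y = l + x" by blast
  then show "y \<in> (+) l' ` X" using assms(1)[of x] by (intro image_eqI[of _ _ "x + (l - l')"]) simp_all
next
  fix y assume "y \<in> (+) l' ` X"
  then obtain x where "x \<in> X" "y = l' + x" by blast
  then show "y \<in> (+) l ` X" using assms(2)[of x] by (intro image_eqI[of _ _ "x + (l' - l)"]) simp_all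
qed

text \<open>The difference \<open>l - l'\<close> is a direction of \<open>V r\<close>, hence of
  every larger \<open>V j\<close>, and the functional of each half-space is constant along it. So
  the distinct translates of a flag correspond to the lattice modulo its vectors parallel to
  \<open>V r\<close>, and each is determined by its own lowest subspace.\<close>

lemma translate_flag_eqI:
  fixes \<Phi> :: "'a::euclidean_space flag"
  assumes fl: "is_flag r \<Phi>" "r \<le> DIM('a)" and s: "\<And>x. x \<in> fst \<Phi> r \<Longrightarrow> x + (l - l') \<in> fst \<Phi> r"
  shows "translate_flag l \<Phi> = translate_flag l' \<Phi>"
proof -
  define s where "s = l - l'"
  obtain p where p: "p \<in> fst \<Phi> r" using is_flag_nonempty[OF fl(1) order_refl fl(2)] by blast
  have inV: "x + t *\<^sub>R s \<in> fst \<Phi> j" if j: "r \<le> j" "j \<le> DIM('a)" and x: "x \<in> fst \<Phi> j" for j x t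
  proof -
    have a: "affine (fst \<Phi> j)" by (rule is_flagD(1)[OF fl(1) j])
    have "p \<in> fst \<Phi> j" "p + s \<in> fst \<Phi> j" using is_flag_mono[OF fl(1) j] p assms(3) by (auto simp: s_def)
    from mem_affine_3_minus[OF a x this(2,1), of t] show ?thesis by simp
  qed
  have V: "(+) l ` fst \<Phi> j = (+) l' ` fst \<Phi> j" for j
  proof (cases "r \<le> j \<and> j \<le> DIM('a)")
    case True
    then show ?thesis
      using inV[of j _ 1] inV[of j _ "-1"] by (intro image_translate_eqI) (auto simp: s_def)
  next
    case False
    then have "fst \<Phi> j = {}" using is_flagD(6,7)[OF fl(1), of j] by linarith
    then show ?thesis by simp
  qed
  have H: "(+) l ` snd \<Phi> j = (+) l' ` snd \<Phi> j" for j
  proof (cases "r \<le> j \<and> j < DIM('a)")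
    case True
    then have j: "r \<le> j" "j < DIM('a)" "r \<le> Suc j" "Suc j \<le> DIM('a)" "j \<le> DIM('a)" by auto
    obtain h where h: "fst \<Phi> j = {x\<in>fst \<Phi> (Suc j). aval h x = 0}" "snd \<Phi> j = {x\<in>fst \<Phi> (Suc j). aval h x \<ge> 0}"
      using half_spaceD[OF is_flagD(4)[OF fl(1) j(1,2)]] by blast
    have pj: "p \<in> fst \<Phi> j" "p + 1 *\<^sub>R s \<in> fst \<Phi> j"
      using is_flag_mono[OF fl(1) j(1,5)] p inV[OF j(1,5), of p 1] by auto
    then have "fst h \<bullet> s = 0" using aval_add[of h p s] unfolding h(1) by simp
    then have "aval h (x + t *\<^sub>R s) = aval h x" for x t by (simp add: aval_add)
    then have "x + t *\<^sub>R s \<in> snd \<Phi> j" if "x \<in> snd \<Phi> j" for x t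
      using that inV[OF j(3,4), of x t] unfolding h(2) by simp
    from this[of _ 1] this[of _ "-1"] show ?thesis by (intro image_translate_eqI) (auto simp: s_def)
  next
    case False
    then have "snd \<Phi> j = {}" using is_flagD(8,9)[OF fl(1), of j] by linarith
    then show ?thesis by simp
  qed
  show ?thesis
    by (rule prod_eqI; rule ext) (simp_all add: fst_translate_flag snd_translate_flag V H)
qed

lemma perp_space_translate: "perp_space (p + l) C = (+) l ` perp_space p C"
proof (intro subset_antisym subsetI)
  fix x assume "x \<in> perp_space (p + l) C"
  then have "x - l \<in> perp_space p C" by (simp add: perp_space_def algebra_simps)
  then show "x \<in> (+) l ` perp_space p C" by (intro image_eqI[of _ _ "x - l"]) auto
qed (auto simp: perp_space_def algebra_simps)

lemma iter_jump_outside: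
  assumes "closed X" "A \<subseteq> X" "x \<notin> X" shows "iter_jump n r (indicator A) x = 0"
proof -
  have "iter_jump n r (indicator A) x = iter_jump n r (\<lambda>_. 0) x"
    by (rule iter_jump_local[of "- X"]) (use assms in \<open>auto simp: indicator_def\<close>)
  also have "foldr (\<lambda>j. jump (n j)) js (\<lambda>_. 0) = (\<lambda>_. 0)" for js
    by (induction js) (simp_all add: ext[OF jump_const])
  then have "iter_jump n r (\<lambda>_. 0) x = 0" by (simp add: iter_jump_def)
  finally show ?thesis .
qed

lemma facet_subset: "closed P \<Longrightarrow> F \<in> facets P \<Longrightarrow> F \<subseteq> P"
proof -
  assume P: "closed P" "F \<in> facets P"
  then obtain C where C: "C \<in> components (facet_points P)" "F = closure C" unfolding facets_def by blast
  have "C \<subseteq> P" using in_components_subset[OF C(1)] facet_points_subset[of P] by blast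
  then show ?thesis using C(2) closure_minimal P(1) by blast
qed

section \<open>Hadwiger functionals\<close>

locale lattice_polytope =
  fixes A L :: "'a::euclidean_space set" and \<Sigma> :: "('a \<times> real) set" and M :: real
  assumes closed_A: "closed A" and A_bounded: "A \<subseteq> cball 0 M" and M_nonneg: "M \<ge> 0"
    and finite_\<Sigma>: "finite \<Sigma>" and adapted_A: "adapted \<Sigma> A"
    and hull_A: "affine hull A = UNIV" and lattice_L: "is_lattice L"
begin

text \<open>The tiling condition has \<open>x - l\<close>; the symmetry of \<open>L\<close> makes
  both counts equal (\<open>tiles_iff\<close>), and \<open>x + l\<close> fits the translations of
  flags.\<close>

definition count :: "'a \<Rightarrow> real" where
  "count x = real (card {l\<in>L. x + l \<in> A})"

lemma finite_L: "finite {l\<in>L. norm l \<le> R}"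
  by (rule lattice_finite_bounded[OF lattice_L])

lemma norm_translate_bound: "x + l \<in> A \<Longrightarrow> norm l \<le> norm x + M"
  using A_bounded norm_triangle_ineq4[of "x + l" x] by fastforce

lemma count_eq_sum:
  assumes "norm x + M \<le> K" shows "count x = (\<Sum>l\<in>{l\<in>L. norm l \<le> K}. indicator A (x + l))"
proof -
  have "{l\<in>L. x + l \<in> A} = {l\<in>{l\<in>L. norm l \<le> K}. x + l \<in> A}"
    using norm_translate_bound[of x] assms by fastforce
  then have "count x = (\<Sum>l\<in>{l\<in>{l\<in>L. norm l \<le> K}. x + l \<in> A}. 1)" by (simp add: count_def)
  also have "\<dots> = (\<Sum>l\<in>{l\<in>L. norm l \<le> K}. if x + l \<in> A then 1 else 0)"
    by (rule sum.inter_filter[OF finite_L])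
  finally show ?thesis by (simp add: indicator_def of_bool_def)
qed

lemma locally_adapted_indicator: "locally_adapted (\<lambda>x. indicator A (x + l) :: real)"
  using finite_\<Sigma> by (intro adapted_on_imp_locally_adapted[OF _ adapted_on_translate[OF adapted_on_indicator[OF adapted_A]]]) auto

lemma locally_adapted_count: "locally_adapted count"
  unfolding locally_adapted_def
proof
  fix R
  let ?I = "{l\<in>L. norm l \<le> R + M}"
  define \<Theta> where "\<Theta> = (\<Union>l\<in>?I. shift_functional l ` \<Sigma>)"
  have ad: "adapted_on \<Theta> UNIV (\<lambda>x. \<Sum>l\<in>?I. indicator A (x + l) :: real)"
    unfolding \<Theta>_def by (intro adapted_on_sum adapted_on_translate adapted_on_indicator adapted_A)
  have eq: "count x = (\<Sum>l\<in>?I. indicator A (x + l))" if "x \<in> ball 0 R" for x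
    using that by (intro count_eq_sum) auto
  have "adapted_on \<Theta> (ball 0 R) count"
    unfolding adapted_on_def
  proof (intro ballI impI)
    fix x y assume "x \<in> ball 0 R" "y \<in> ball 0 R" "same_side \<Theta> x y"
    then show "count x = count y" using eq[of x] eq[of y] adapted_onD[OF ad, of x y] by simp
  qed
  moreover have "finite \<Theta>" unfolding \<Theta>_def using finite_L finite_\<Sigma> by blast
  ultimately show "\<exists>\<Sigma>. finite \<Sigma> \<and> adapted_on \<Sigma> (ball 0 R) count" by blast
qed

lemma iter_jump_count:
  assumes "norm x + M < K"
  shows "iter_jump n r count x = (\<Sum>l\<in>{l\<in>L. norm l \<le> K}. iter_jump n r (indicator A) (x + l))"
proof -
  have "iter_jump n r count x = iter_jump n r (\<lambda>x. \<Sum>l\<in>{l\<in>L. norm l \<le> K}. indicator A (x + l)) x"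
    \<comment> \<open>The strict bound puts \<open>x\<close> into an open ball on which the finite
      sum equals \<open>count\<close>; a jump depends on a neighbourhood of the point.\<close>
    by (rule iter_jump_local[of "ball 0 (K - M)"]) (use assms in \<open>auto intro!: count_eq_sum\<close>)
  also have "\<dots> = (\<Sum>l\<in>{l\<in>L. norm l \<le> K}. iter_jump n r (\<lambda>x. indicator A (x + l)) x)"
    by (subst iter_jump_sum[OF finite_L locally_adapted_indicator]) (rule refl)
  finally show ?thesis by (simp add: iter_jump_translate)
qed

lemma iter_jump_A_adapted: "adapted_on \<Sigma> UNIV (iter_jump n r (indicator A))"
  by (rule adapted_on_iter_jump[OF finite_\<Sigma> open_UNIV adapted_on_indicator[OF adapted_A]])

lemma iter_jump_A_measurable: "iter_jump n r (indicator A) \<in> borel_measurable borel"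
  by (rule adapted_on_borel_measurable[OF finite_\<Sigma> iter_jump_A_adapted])

lemma iter_jump_A_support: "iter_jump n r (indicator A) x \<noteq> 0 \<Longrightarrow> norm x \<le> M"
  using iter_jump_outside[OF closed_cball A_bounded, of x n r] by auto

lemma iter_jump_A_bounded: "\<exists>K. \<forall>x. \<bar>iter_jump n r (indicator A) x\<bar> \<le> K"
proof -
  have "finite (range (iter_jump n r (indicator A)))"
    by (rule adapted_on_finite_range[OF finite_\<Sigma> iter_jump_A_adapted])
  then have "bounded (range (iter_jump n r (indicator A)))" by (rule finite_imp_bounded)
  then show ?thesis unfolding bounded_iff by auto
qed

lemma face_chain_subset:
  assumes fl: "is_flag r \<Phi>" and F: "F \<in> face_chains r \<Phi> A" and j: "r \<le> j" "j \<le> DIM('a)"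
  shows "F j \<subseteq> A"
  using j(2)
proof (induction rule: inc_induct)
  case base
  then show ?case using F by (simp add: face_chains_iff)
next
  case (step k)
  have k: "r \<le> k" "k < DIM('a)" "r \<le> Suc k" "Suc k \<le> DIM('a)" using step j by auto
  have "F k \<in> facets (F (Suc k))" using F k by (simp add: face_chains_iff)
  moreover have "closed (F (Suc k))"
    using face_chain_members[OF fl closed_A finite_\<Sigma> adapted_A hull_A F order_refl k(3,4)] by blast
  ultimately show ?case using facet_subset step.IH by blast
qed

text \<open>Each face volume is an integral over the slab, so the signed sum is the integral of the
  chain sum, and that equals the iterated jump of \<open>indicator A\<close> off a thin set.\<close>

lemma flag_weight_eq_integral:
  assumes fl: "is_flag r \<Phi>" and dir: "flag_directions r \<Phi> n" and r: "r \<le> DIM('a)"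
    and C: "orthonormal C" and V: "fst \<Phi> r = perp_space p C"
  shows "flag_weight r \<Phi> A = (\<integral>x. indicator (slab p C) x * iter_jump n r (indicator A) (flatten p C x) \<partial>lborel)"
proof -
  let ?\<F> = "face_chains r \<Phi> A"
  note A = closed_A finite_\<Sigma> adapted_A hull_A
  have mem: "closed (F r)" "affine hull (F r) = perp_space p C" "F r \<subseteq> A" if "F \<in> ?\<F>" for F
    using face_chain_members[OF fl A that order_refl order_refl r] face_chain_subset[OF fl that order_refl r] V by auto
  have Fm [measurable]: "F r \<in> sets borel" if "F \<in> ?\<F>" for F using mem(1)[OF that] by (rule borel_closed)
  have int: "integrable lborel (\<lambda>x. indicator (slab p C) x * indicator (F r) (flatten p C x) :: real)" if F: "F \<in> ?\<F>" for F
  proof (rule integrable_lborel_bounded_support[where K=1 and M="M + real (card C)"])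
    have [measurable]: "F r \<in> sets borel" by (rule Fm[OF F])
    show "(\<lambda>x. indicator (slab p C) x * indicator (F r) (flatten p C x) :: real) \<in> borel_measurable borel" by measurable
    fix x :: 'a
    show "\<bar>indicator (slab p C) x * indicator (F r) (flatten p C x) :: real\<bar> \<le> 1" by (simp add: indicator_def)
    assume "indicator (slab p C) x * indicator (F r) (flatten p C x) \<noteq> (0 :: real)"
    then have "x \<in> slab p C" "flatten p C x \<in> F r" by (auto simp: indicator_def split: if_splits)
    then show "norm x \<le> M + real (card C)"
      using slab_flatten_bound(1)[OF C] mem(3)[OF F] A_bounded by fastforce
  qed
  have vol: "rel_volume (F r) = (\<integral>x. indicator (slab p C) x * indicator (F r) (flatten p C x) \<partial>lborel)" if F: "F \<in> ?\<F>" for F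
  proof -
    have "rel_volume (F r) = measure lborel {x\<in>slab p C. flatten p C x \<in> F r}"
      by (rule rel_volume_eq_slab[OF C mem(2)[OF F] Fm[OF F]])
    also have "\<dots> = (\<integral>x. indicator {x\<in>slab p C. flatten p C x \<in> F r} x \<partial>lborel)" by simp
    also have "\<dots> = (\<integral>x. indicator (slab p C) x * indicator (F r) (flatten p C x) \<partial>lborel)"
      by (rule Bochner_Integration.integral_cong) (auto simp: indicator_def)
    finally show ?thesis .
  qed
  have "flag_weight r \<Phi> A = (\<Sum>F\<in>?\<F>. chain_coeff \<Phi> r F * (\<integral>x. indicator (slab p C) x * indicator (F r) (flatten p C x) \<partial>lborel))"
    unfolding flag_weight_def chain_coeff_def by (rule sum.cong) (use vol in auto)
  also have "\<dots> = (\<integral>x. (\<Sum>F\<in>?\<F>. chain_coeff \<Phi> r F * (indicator (slab p C) x * indicator (F r) (flatten p C x))) \<partial>lborel)"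
    using int by (subst Bochner_Integration.integral_sum) auto
  also have "\<dots> = (\<integral>x. indicator (slab p C) x * iter_jump n r (indicator A) (flatten p C x) \<partial>lborel)"
  proof (rule integral_cong_AE)
    have "thin (perp_space p C) {x. iter_jump n r (indicator A) x \<noteq> (\<Sum>F\<in>?\<F>. chain_coeff \<Phi> r F * indicator (F r) x)}"
      using iter_jump_eq_chains[OF fl dir A order_refl r] V by simp
    from AE_not_in_thin[OF C this]
    show "AE x in lborel. (\<Sum>F\<in>?\<F>. chain_coeff \<Phi> r F * (indicator (slab p C) x * indicator (F r) (flatten p C x))) =
      indicator (slab p C) x * iter_jump n r (indicator A) (flatten p C x)"
      by eventually_elim (simp add: sum_distrib_left mult_ac)
    show "(\<lambda>x. \<Sum>F\<in>?\<F>. chain_coeff \<Phi> r F * (indicator (slab p C) x * indicator (F r) (flatten p C x))) \<in> borel_measurable lborel"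
      using borel_measurable_integrable[OF int] by (intro borel_measurable_sum borel_measurable_times) auto
    show "(\<lambda>x. indicator (slab p C) x * iter_jump n r (indicator A) (flatten p C x)) \<in> borel_measurable lborel"
      using measurable_compose[OF borel_measurable_flatten iter_jump_A_measurable] by (intro borel_measurable_times) auto
  qed
  finally show ?thesis .
qed

text \<open>Distinct translates of the flag correspond to cosets of \<open>S\<close>, the lattice
  vectors parallel to \<open>V r\<close>. Pulling the weights back to the slab of the original flag
  gives a sum \<open>G\<close> over coset representatives. Summing \<open>G\<close> over
  \<open>S\<close> runs through the relevant part of \<open>L\<close> and gives the iterated jump of
  \<open>count\<close>, so that \<open>periodic_integral\<close> applies with the constant
  \<open>c\<close>.\<close>

lemma hadwiger_eq:
  assumes fl: "is_flag r \<Phi>" and dir: "flag_directions r \<Phi> n" and r: "r \<le> DIM('a)"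
    and th: "thin (fst \<Phi> r) {x. iter_jump n r count x \<noteq> c}"
  shows "\<exists>\<kappa>>0. hadwiger r \<Phi> A L = c * \<kappa>"
proof -
  note A = closed_A finite_\<Sigma> adapted_A hull_A
  have "affine (fst \<Phi> r)" by (rule is_flagD(1)[OF fl order_refl r])
  moreover obtain p where p: "p \<in> fst \<Phi> r" using is_flag_nonempty[OF fl order_refl r] by blast
  ultimately obtain C where C: "orthonormal C" and V: "fst \<Phi> r = perp_space p C"
    using affine_eq_perp_space by blast
  define S where "S = {l\<in>L. \<forall>c\<in>C. c \<bullet> l = 0}"
  have S: "0 \<in> S" "\<And>s t. s \<in> S \<Longrightarrow> t \<in> S \<Longrightarrow> s + t \<in> S" "\<And>s. s \<in> S \<Longrightarrow> - s \<in> S"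
    using lattice_group[OF lattice_L] by (auto simp: S_def inner_add_right)
  have S0: "c \<bullet> s = 0" if "s \<in> S" "c \<in> C" for s c using that by (simp add: S_def)
  have stab: "translate_flag l \<Phi> = translate_flag l' \<Phi> \<longleftrightarrow> l - l' \<in> S" if "l \<in> L" "l' \<in> L" for l l'
  proof
    assume "translate_flag l \<Phi> = translate_flag l' \<Phi>"
    then have "(+) l ` fst \<Phi> r = (+) l' ` fst \<Phi> r" by (metis fst_translate_flag)
    then have "l + p \<in> (+) l' ` perp_space p C" using p V by blast
    then obtain y where y: "y \<in> perp_space p C" "l + p = l' + y" by blast
    then have "l - l' = y - p" by (simp add: algebra_simps)
    then show "l - l' \<in> S" using y(1) lattice_group(4)[OF lattice_L that] by (simp add: S_def perp_space_def)
  next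
    assume s: "l - l' \<in> S"
    show "translate_flag l \<Phi> = translate_flag l' \<Phi>"
    proof (rule translate_flag_eqI[OF fl r])
      fix x assume "x \<in> fst \<Phi> r"
      then have "\<forall>c\<in>C. c \<bullet> (x - p) = 0" unfolding V perp_space_def by blast
      then have "\<forall>c\<in>C. c \<bullet> (x + (l - l') - p) = 0"
        using S0[OF s] by (simp add: inner_diff_right inner_add_right)
      then show "x + (l - l') \<in> fst \<Phi> r" unfolding V perp_space_def by blast
    qed
  qed
  define Orb where "Orb = (\<lambda>l. translate_flag l \<Phi>) ` L"
  \<comment> \<open>Flags without chains have weight 0. Those in \<open>Orb0\<close> are finite in
    number because their lowest subspace is the affine hull of a set adapted to \<Sigma> and
    determines the flag within the orbit.\<close>
  define Orb0 where "Orb0 = {\<Psi>\<in>Orb. face_chains r \<Psi> A \<noteq> {}}"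
  have Orb_flag: "is_flag r \<Psi>" "flag_directions r \<Psi> n" if "\<Psi> \<in> Orb" for \<Psi>
    using that is_flag_translate[OF fl] flag_directions_translate[OF dir] by (auto simp: Orb_def)
  have fin0: "finite Orb0"
  proof (rule finite_imageD)
    show "finite ((\<lambda>\<Psi>. fst \<Psi> r) ` Orb0)"
    proof (rule finite_subset)
      show "(\<lambda>\<Psi>. fst \<Psi> r) ` Orb0 \<subseteq> (\<lambda>S. affine hull S) ` {S. adapted \<Sigma> S}"
      proof (rule image_subsetI)
        fix \<Psi> assume "\<Psi> \<in> Orb0"
        then obtain F where F: "F \<in> face_chains r \<Psi> A" "\<Psi> \<in> Orb" by (auto simp: Orb0_def)
        have "adapted \<Sigma> (F r)" "affine hull (F r) = fst \<Psi> r"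
          using face_chain_members[OF Orb_flag(1)[OF F(2)] A F(1) order_refl order_refl r] by auto
        then show "fst \<Psi> r \<in> (\<lambda>S. affine hull S) ` {S. adapted \<Sigma> S}" by blast
      qed
      show "finite ((\<lambda>S. affine hull S) ` {S. adapted \<Sigma> S})" using finite_adapted_sets[OF finite_\<Sigma>] by simp
    qed
    show "inj_on (\<lambda>\<Psi>. fst \<Psi> r) Orb0"
    proof (rule inj_onI)
      fix \<Psi> \<Psi>' assume "\<Psi> \<in> Orb0" "\<Psi>' \<in> Orb0" and eq: "fst \<Psi> r = fst \<Psi>' r"
      then obtain l l' where l: "l \<in> L" "l' \<in> L" "\<Psi> = translate_flag l \<Phi>" "\<Psi>' = translate_flag l' \<Phi>"
        by (auto simp: Orb0_def Orb_def)
      have im: "(+) l ` fst \<Phi> r = (+) l' ` fst \<Phi> r" using eq l by (simp add: fst_translate_flag)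
      show "\<Psi> = \<Psi>'" unfolding l(3,4)
      proof (rule translate_flag_eqI[OF fl r])
        fix x assume "x \<in> fst \<Phi> r"
        then have "l + x \<in> (+) l' ` fst \<Phi> r" using im by blast
        then obtain y where "y \<in> fst \<Phi> r" "l + x = l' + y" by blast
        moreover have "x + (l - l') = y" using \<open>l + x = l' + y\<close> by (simp add: algebra_simps)
        ultimately show "x + (l - l') \<in> fst \<Phi> r" by simp
      qed
    qed
  qed
  have "\<forall>\<Psi>\<in>Orb0. \<exists>l\<in>L. \<Psi> = translate_flag l \<Phi>" by (auto simp: Orb0_def Orb_def)
  then obtain rep where rep: "\<And>\<Psi>. \<Psi> \<in> Orb0 \<Longrightarrow> rep \<Psi> \<in> L" "\<And>\<Psi>. \<Psi> \<in> Orb0 \<Longrightarrow> \<Psi> = translate_flag (rep \<Psi>) \<Phi>"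
    by metis
  define h where "h = iter_jump n r (indicator A)"
  have hm [measurable]: "h \<in> borel_measurable borel" unfolding h_def by (rule iter_jump_A_measurable)
  have hs: "norm x \<le> M" if "h x \<noteq> 0" for x using that iter_jump_A_support unfolding h_def by blast
  obtain K where K: "\<And>x. \<bar>h x\<bar> \<le> K" using iter_jump_A_bounded[of n r] unfolding h_def by blast
  define G where "G x = (\<Sum>\<Psi>\<in>Orb0. h (flatten p C x + rep \<Psi>))" for x
  have Gm: "G \<in> borel_measurable borel" unfolding G_def by measurable
  have weight: "flag_weight r \<Psi> A = (\<integral>x. indicator (slab p C) x * h (flatten p C x + rep \<Psi>) \<partial>lborel)" if \<Psi>: "\<Psi> \<in> Orb0" for \<Psi>
  proof -
    have O: "\<Psi> \<in> Orb" using \<Psi> by (simp add: Orb0_def)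
    have "fst \<Psi> r = (+) (rep \<Psi>) ` fst \<Phi> r" by (metis rep(2)[OF \<Psi>] fst_translate_flag)
    then have "fst \<Psi> r = perp_space (p + rep \<Psi>) C" using V by (simp add: perp_space_translate)
    from flag_weight_eq_integral[OF Orb_flag[OF O] r C this]
    have "flag_weight r \<Psi> A = (\<integral>x. indicator (slab (p + rep \<Psi>) C) x * h (flatten (p + rep \<Psi>) C x) \<partial>lborel)"
      unfolding h_def .
    \<comment> \<open>The shift by the representative turns all weights into integrals over the same
      slab.\<close>
    also have "\<dots> = (\<integral>x. indicator (slab (p + rep \<Psi>) C) (x + rep \<Psi>) * h (flatten (p + rep \<Psi>) C (x + rep \<Psi>)) \<partial>lborel)"
      by (rule integral_lborel_translate[symmetric]) measurable
    finally show ?thesis by (simp add: flatten_translate indicator_def slab_translate)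
  qed
  define P where "P = (\<Sum>\<Psi>\<in>Orb0. norm (rep \<Psi>))"
  have P: "norm (rep \<Psi>) \<le> P" if "\<Psi> \<in> Orb0" for \<Psi>
    unfolding P_def by (rule member_le_sum[OF that]) (use fin0 in auto)
  have "P \<ge> 0" unfolding P_def by (simp add: sum_nonneg)
  \<comment> \<open>\<open>M\<close> bounds the support of \<open>h\<close>, \<open>P\<close> the
    representatives, and \<open>real (card C)\<close> the distance of a slab point from its
    projection, as each normal coordinate is at most 1.\<close>
  have supp: "norm x \<le> M + P + real (card C)" if "x \<in> slab p C" "\<Psi> \<in> Orb0" "h (flatten p C x + rep \<Psi>) \<noteq> 0" for x \<Psi>
  proof -
    have "norm (flatten p C x) \<le> norm (flatten p C x + rep \<Psi>) + norm (rep \<Psi>)"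
      using norm_triangle_ineq4[of "flatten p C x + rep \<Psi>" "rep \<Psi>"] by simp
    then show ?thesis using hs[OF that(3)] P[OF that(2)] slab_flatten_bound(1)[OF C that(1)] by linarith
  qed
  have "hadwiger r \<Phi> A L = (\<Sum>\<^sub>\<infinity>\<Psi>\<in>Orb0. flag_weight r \<Psi> A)"
    unfolding hadwiger_def Orb_def[symmetric]
  proof (rule infsum_cong_neutral)
    fix \<Psi> assume "\<Psi> \<in> Orb - Orb0"
    then have "face_chains r \<Psi> A = {}" by (auto simp: Orb0_def)
    then show "flag_weight r \<Psi> A = 0" by (simp add: flag_weight_def)
  qed (auto simp: Orb0_def)
  also have "\<dots> = (\<Sum>\<Psi>\<in>Orb0. flag_weight r \<Psi> A)" using fin0 by simp
  also have "\<dots> = (\<Sum>\<Psi>\<in>Orb0. \<integral>x. indicator (slab p C) x * h (flatten p C x + rep \<Psi>) \<partial>lborel)"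
    by (rule sum.cong) (use weight in auto)
  also have "\<dots> = (\<integral>x. (\<Sum>\<Psi>\<in>Orb0. indicator (slab p C) x * h (flatten p C x + rep \<Psi>)) \<partial>lborel)"
  proof (rule Bochner_Integration.integral_sum[symmetric])
    fix \<Psi> assume \<Psi>: "\<Psi> \<in> Orb0"
    show "integrable lborel (\<lambda>x. indicator (slab p C) x * h (flatten p C x + rep \<Psi>))"
    proof (rule integrable_lborel_bounded_support[where K=K and M="M + P + real (card C)"])
      fix x
      show "\<bar>indicator (slab p C) x * h (flatten p C x + rep \<Psi>)\<bar> \<le> K"
        using K[of "flatten p C x + rep \<Psi>"] by (auto simp: indicator_def)
      show "indicator (slab p C) x * h (flatten p C x + rep \<Psi>) \<noteq> 0 \<Longrightarrow> norm x \<le> M + P + real (card C)"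
        using supp[OF _ \<Psi>, of x] by (auto simp: indicator_def split: if_splits)
    qed measurable
  qed
  also have "\<dots> = (\<integral>x. indicator (slab p C) x * G x \<partial>lborel)" by (simp add: G_def sum_distrib_left)
  finally have had: "hadwiger r \<Phi> A L = (\<integral>x. indicator (slab p C) x * G x \<partial>lborel)" .
  obtain q e where qe: "e > 0" "ball q e \<subseteq> slab p C" using slab_interior_nonempty[OF C] by blast
  define \<rho> where "\<rho> = max (norm q + e) (M + P + real (card C))"
  have "\<exists>\<kappa>>0. (\<integral>x. indicator (slab p C) x * G x \<partial>lborel) = c * \<kappa>"
  proof (rule periodic_integral[OF S _ borel_slab _ qe Gm, where K="real (card Orb0) * K" and \<rho>=\<rho>])
    show "finite {s\<in>S. norm s \<le> R}" for R
      by (rule finite_subset[OF _ finite_L[of R]]) (auto simp: S_def)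
    show "x + s \<in> slab p C \<longleftrightarrow> x \<in> slab p C" if "s \<in> S" for x s
      by (rule slab_translate_along) (use S0[OF that] in auto)
    show "\<bar>G x\<bar> \<le> real (card Orb0) * K" for x
    proof -
      have "\<bar>G x\<bar> \<le> (\<Sum>\<Psi>\<in>Orb0. \<bar>h (flatten p C x + rep \<Psi>)\<bar>)" unfolding G_def by (rule sum_abs)
      also have "\<dots> \<le> real (card Orb0) * K" by (rule sum_bounded_above) (rule K)
      finally show ?thesis .
    qed
    show "norm x \<le> \<rho>" if x: "x \<in> slab p C" "G x \<noteq> 0" for x
    proof -
      obtain \<Psi> where "\<Psi> \<in> Orb0" "h (flatten p C x + rep \<Psi>) \<noteq> 0"
        using x(2) unfolding G_def by (meson sum.neutral)
      then show ?thesis using supp[OF x(1)] unfolding \<rho>_def by fastforce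
    qed
    show "norm q + e \<le> \<rho>" by (simp add: \<rho>_def)
    \<comment> \<open>Lattice vectors whose flag has no chain are missing from \<open>G\<close>.
      They contribute nothing: their chain sum is empty, so \<open>h\<close> vanishes generically on
      that translate of \<open>V r\<close>.\<close>
    have "AE x in lborel. translate_flag l \<Phi> \<notin> Orb0 \<longrightarrow> h (flatten p C x + l) = 0" if l: "l \<in> L" for l
    proof (cases "translate_flag l \<Phi> \<in> Orb0")
      case False
      have O: "translate_flag l \<Phi> \<in> Orb" using l by (simp add: Orb_def)
      then have "face_chains r (translate_flag l \<Phi>) A = {}" using False by (simp add: Orb0_def)
      then have "thin ((+) l ` fst \<Phi> r) {x. h x \<noteq> 0}"
        using iter_jump_eq_chains[OF Orb_flag[OF O] A order_refl r] by (simp add: h_def fst_translate_flag)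
      from AE_not_in_thin[OF C thin_translate[OF this, unfolded V]] show ?thesis by (auto elim: eventually_mono)
    qed simp
    then have ae1: "AE x in lborel. \<forall>l\<in>L. translate_flag l \<Phi> \<notin> Orb0 \<longrightarrow> h (flatten p C x + l) = 0"
      unfolding AE_ball_countable[OF lattice_countable[OF lattice_L]] by blast
    have ae2: "AE x in lborel. iter_jump n r count (flatten p C x) = c"
      using AE_not_in_thin[OF C th[unfolded V]] by simp
    show "AE x in lborel. x \<in> slab p C \<longrightarrow> norm x \<le> \<rho> \<longrightarrow> (\<Sum>s\<in>{s\<in>S. norm s \<le> 2 * \<rho>}. G (x + s)) = c"
      using ae1 ae2
    proof eventually_elim
      case (elim x)
      show ?case
      proof (intro impI)
        assume x: "x \<in> slab p C" "norm x \<le> \<rho>"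
        define y where "y = flatten p C x"
        have ny: "norm y \<le> \<rho> + real (card C)" unfolding y_def using slab_flatten_bound(2)[OF C x(1)] x(2) by linarith
        define T where "T = {s\<in>S. norm s \<le> 2 * \<rho>}"
        define J where "J = (\<lambda>(s, \<Psi>). s + rep \<Psi>) ` (T \<times> Orb0)"
        have finT: "finite T" unfolding T_def by (rule finite_subset[OF _ finite_L[of "2 * \<rho>"]]) (auto simp: S_def)
        have tr: "translate_flag (s + rep \<Psi>) \<Phi> = \<Psi>" if "s \<in> S" "\<Psi> \<in> Orb0" for s \<Psi>
        proof -
          have "s + rep \<Psi> \<in> L" using that rep(1) lattice_group(2)[OF lattice_L] by (auto simp: S_def)
          then have "translate_flag (s + rep \<Psi>) \<Phi> = translate_flag (rep \<Psi>) \<Phi>"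
            using stab[of "s + rep \<Psi>" "rep \<Psi>"] rep(1)[OF that(2)] that(1) by simp
          then show ?thesis using rep(2)[OF that(2)] by simp
        qed
        have inj: "inj_on (\<lambda>(s, \<Psi>). s + rep \<Psi>) (T \<times> Orb0)"
        proof (rule inj_onI, clarify)
          fix s \<Psi> s' \<Psi>' assume a: "s \<in> T" "\<Psi> \<in> Orb0" "s' \<in> T" "\<Psi>' \<in> Orb0" "s + rep \<Psi> = s' + rep \<Psi>'"
          have "\<Psi> = \<Psi>'" using tr[of s \<Psi>] tr[of s' \<Psi>'] a by (auto simp: T_def)
          then show "s = s' \<and> \<Psi> = \<Psi>'" using a(5) by simp
        qed
        have "(\<Sum>s\<in>T. G (x + s)) = (\<Sum>s\<in>T. \<Sum>\<Psi>\<in>Orb0. h (y + (s + rep \<Psi>)))"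
        proof (rule sum.cong[OF refl])
          fix s assume "s \<in> T"
          then have "flatten p C (x + s) = y + s"
            unfolding y_def using S0 by (intro flatten_translate_along) (auto simp: T_def)
          then show "G (x + s) = (\<Sum>\<Psi>\<in>Orb0. h (y + (s + rep \<Psi>)))" by (simp add: G_def add.assoc)
        qed
        also have "\<dots> = (\<Sum>(s, \<Psi>)\<in>T \<times> Orb0. h (y + (s + rep \<Psi>)))"
          by (rule sum.cartesian_product)
        also have "\<dots> = (\<Sum>l\<in>J. h (y + l))"
          unfolding J_def by (subst sum.reindex[OF inj]) (simp add: split_beta)
        \<comment> \<open>The two index sets differ only where \<open>h\<close> vanishes: a vector
          of \<open>J\<close> beyond the bound carries \<open>y\<close> out of the ball of radius
          \<open>M\<close>, and a bounded vector with \<open>h (y + l)\<close> non-zero lies in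
          \<open>J\<close>. The \<open>+ 1\<close> meets the strict bound of
          \<open>iter_jump_count\<close>.\<close>
        also have "\<dots> = (\<Sum>l\<in>{l\<in>L. norm l \<le> norm y + M + 1}. h (y + l))"
        proof (rule sum.mono_neutral_cong)
          show "finite {l\<in>L. norm l \<le> norm y + M + 1}" by (rule finite_L)
          show "finite J" unfolding J_def using finT fin0 by simp
          have JL: "J \<subseteq> L" unfolding J_def using rep(1) lattice_group(2)[OF lattice_L] by (auto simp: T_def S_def)
          show "h (y + l) = 0" if "l \<in> J - {l\<in>L. norm l \<le> norm y + M + 1}" for l
          proof (rule ccontr)
            assume "h (y + l) \<noteq> 0"
            then have "norm (y + l) \<le> M" by (rule hs)
            then have "norm l \<le> norm y + M" using norm_triangle_ineq4[of "y + l" y] by simp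
            then show False using that JL by auto
          qed
          show "h (y + l) = 0" if l: "l \<in> {l\<in>L. norm l \<le> norm y + M + 1} - J" for l
          proof (rule ccontr)
            assume nz: "h (y + l) \<noteq> 0"
            have lL: "l \<in> L" using l by simp
            define \<Psi> where "\<Psi> = translate_flag l \<Phi>"
            have \<Psi>0: "\<Psi> \<in> Orb0" using elim(1) lL nz unfolding y_def \<Psi>_def by blast
            define s where "s = l - rep \<Psi>"
            have sS: "s \<in> S" unfolding s_def
              using stab[OF lL rep(1)[OF \<Psi>0]] rep(2)[OF \<Psi>0] \<Psi>_def by simp
            have "norm s = norm ((y + l) - (y + rep \<Psi>))" by (simp add: s_def)
            also have "\<dots> \<le> norm (y + l) + norm (y + rep \<Psi>)" by (rule norm_triangle_ineq4)
            also have "\<dots> \<le> M + ((\<rho> + real (card C)) + P)"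
              using hs[OF nz] norm_triangle_ineq[of y "rep \<Psi>"] ny P[OF \<Psi>0] by linarith
            \<comment> \<open>Here the radius \<open>2 * \<rho>\<close> of the sum over
              \<open>S\<close> is seen to suffice, since \<rho> dominates
              \<open>M + P + real (card C)\<close>.\<close>
            also have "\<dots> \<le> 2 * \<rho>"
            proof -
              have "M + P + real (card C) \<le> \<rho>" by (simp add: \<rho>_def)
              then show ?thesis by linarith
            qed
            finally have "s \<in> T" using sS by (simp add: T_def)
            then have "(\<lambda>(s, \<Psi>). s + rep \<Psi>) (s, \<Psi>) \<in> J" unfolding J_def using \<Psi>0 by blast
            then show False using l by (simp add: s_def)
          qed
        qed simp
        also have "\<dots> = iter_jump n r count y" unfolding h_def by (rule iter_jump_count[symmetric]) simp
        also have "\<dots> = c" using elim(2) by (simp add: y_def)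
        finally show "(\<Sum>s\<in>{s\<in>S. norm s \<le> 2 * \<rho>}. G (x + s)) = c" by (simp add: T_def)
      qed
    qed
  qed
  then show ?thesis using had by simp
qed

section \<open>The two implications\<close>

lemma tiles_iff: "tiles_at_level A L k \<longleftrightarrow> (AE x in lebesgue. count x = real k)"
proof -
  have "((\<lambda>l. indicator A (x - l) :: real) has_sum count x) L" for x
  proof (rule has_sum_finite_neutralI)
    let ?B = "{l\<in>L. x - l \<in> A}"
    have bij: "bij_betw uminus ?B {l\<in>L. x + l \<in> A}"
      by (rule bij_betwI[where g=uminus]) (use lattice_group(3)[OF lattice_L] in auto)
    have "finite {l\<in>L. x + l \<in> A}"
      by (rule finite_subset[OF _ finite_L[of "norm x + M"]]) (use norm_translate_bound in auto)
    then show "finite ?B" using bij bij_betw_finite by blast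
    show "?B \<subseteq> L" by auto
    show "indicator A (x - l) = (0::real)" if "l \<in> L - ?B" for l using that by auto
    have "card ?B = card {l\<in>L. x + l \<in> A}" using bij by (rule bij_betw_same_card)
    then show "count x = (\<Sum>l\<in>?B. indicator A (x - l))" by (simp add: count_def)
  qed
  then have "((\<lambda>l. indicator A (x - l) :: real) has_sum real k) L \<longleftrightarrow> count x = real k" for x
    by (metis has_sum_unique)
  then show ?thesis by (simp add: tiles_at_level_def)
qed

text \<open>Off thin sets \<open>count\<close> may be replaced by a constant, jump after jump; below
  the top dimension at least one jump is taken, and the result is 0.\<close>

lemma tiling_imp_hadwiger_zero:
  assumes "tiles_at_level A L k" and fl: "is_flag r \<Phi>" and r: "r < DIM('a)"
  shows "hadwiger r \<Phi> A L = 0"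
proof -
  obtain n where dir: "flag_directions r \<Phi> n" using flag_directions_exist[OF fl] by blast
  have "thin UNIV {x. count x \<noteq> real k}"
    using assms(1) by (intro AE_const_imp_thin locally_adapted_count) (simp add: tiles_iff)
  then have base: "thin (fst \<Phi> DIM('a)) {x. iter_jump n DIM('a) count x \<noteq> iter_jump n DIM('a) (\<lambda>_. real k) x}"
    using is_flagD(3)[OF fl] by simp
  have "thin (fst \<Phi> r) {x. iter_jump n r count x \<noteq> iter_jump n r (\<lambda>_. real k) x}"
    using less_imp_le[OF r]
  proof (induction rule: inc_induct)
    case base
    then show ?case using \<open>thin (fst \<Phi> DIM('a)) _\<close> .
  next
    case (step j)
    have j: "r \<le> Suc j" "Suc j \<le> DIM('a)" "j \<in> {r..<DIM('a)}" using step by auto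
    have "crosses (fst \<Phi> (Suc j)) (fst \<Phi> j) (snd \<Phi> j) (n j)" using dir j(3) unfolding flag_directions_def by blast
    from thin_jump[OF is_flagD(1)[OF fl j(1,2)] this step.IH] show ?case
      using step by (simp add: iter_jump_step)
  qed
  then have "thin (fst \<Phi> r) {x. iter_jump n r count x \<noteq> 0}" by (simp add: iter_jump_const[OF r])
  from hadwiger_eq[OF fl dir _ this] show ?thesis using r by auto
qed

text \<open>Any hyperplane of the lowest subspace extends the flag by one step, and by induction the
  jump across it is generically a constant. The functional of the extended flag is a positive
  multiple of that constant, which is therefore 0; having no jumps, the function one dimension
  higher is generically constant. The induction starts at a single point.\<close>

lemma hadwiger_zero_imp_generically_const:
  assumes zero: "\<And>r \<Phi>. r < DIM('a) \<Longrightarrow> is_flag r \<Phi> \<Longrightarrow> hadwiger r \<Phi> A L = 0"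
    and "is_flag r \<Phi>" "flag_directions r \<Phi> n" "r \<le> DIM('a)"
  shows "\<exists>c. thin (fst \<Phi> r) {x. iter_jump n r count x \<noteq> c}"
  using assms(2-4)
proof (induction r arbitrary: \<Phi> n)
  case 0
  have "aff_dim (fst \<Phi> 0) = 0" using is_flagD(2)[OF 0(1), of 0] by simp
  then obtain a where "fst \<Phi> 0 = {a}" using aff_dim_eq_0 by blast
  then have "thin (fst \<Phi> 0) {x. iter_jump n 0 count x \<noteq> iter_jump n 0 count a}"
    by (intro thinI exI[of _ "{}"]) simp
  then show ?case by blast
next
  case (Suc r)
  define W where "W = fst \<Phi> (Suc r)"
  have W: "affine W" "W \<noteq> {}" "aff_dim W = int (Suc r)"
    unfolding W_def using is_flagD(1,2)[OF Suc.prems(1), of "Suc r"] is_flag_nonempty[OF Suc.prems(1), of "Suc r"] Suc.prems(3) by auto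
  have rd: "r < DIM('a)" using Suc.prems(3) by simp
  show ?case unfolding W_def[symmetric]
  proof (rule zero_jumps_imp_generically_const[OF W(1,2)])
    show "locally_adapted (iter_jump n (Suc r) count)"
      by (rule locally_adapted_iter_jump[OF locally_adapted_count])
    fix V H m assume cr: "crosses W V H m"
    \<comment> \<open>Index \<open>r\<close> is empty in a flag that starts at \<open>Suc r\<close>;
      filling it leaves the upper part of the flag and its directions as they were.\<close>
    define \<Phi>' where "\<Phi>' = ((fst \<Phi>)(r := V), (snd \<Phi>)(r := H))"
    define n' where "n' = n(r := m)"
    have hs: "half_space_of W V H" by (rule crosses_imp_half_space[OF cr])
    obtain h where h: "V = {x\<in>W. aval h x = 0}" "\<not> vanishes_on h W" "V \<noteq> {}"
      using half_spaceD[OF hs] by blast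
    have Va: "affine V" unfolding h(1) by (rule affine_hyperplane_section[OF W(1)])
    have "V = W \<inter> {x. fst h \<bullet> x = snd h}" by (auto simp: h(1) aval_def)
    moreover have "\<not> W \<subseteq> {x. fst h \<bullet> x = snd h}" using h(2) by (auto simp: vanishes_on_def aval_def)
    ultimately have Vd: "aff_dim V = int r"
      using aff_dim_affine_Int_hyperplane[OF W(1), of "fst h" "snd h"] h(3) W(3) by simp
    have fl': "is_flag r \<Phi>'"
    proof -
      have "affine (fst \<Phi>' j) \<and> aff_dim (fst \<Phi>' j) = int j" if "j \<in> {r..DIM('a)}" for j
        using that Va Vd is_flagD(1,2)[OF Suc.prems(1), of j] by (cases "j = r") (auto simp: \<Phi>'_def)
      moreover have "fst \<Phi>' j \<subseteq> fst \<Phi>' (Suc j) \<and> half_space_of (fst \<Phi>' (Suc j)) (fst \<Phi>' j) (snd \<Phi>' j)" if "j \<in> {r..<DIM('a)}" for j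
        using that hs h(1) is_flagD(4,5)[OF Suc.prems(1), of j] by (cases "j = r") (auto simp: \<Phi>'_def W_def)
      moreover have "fst \<Phi>' DIM('a) = UNIV" using is_flagD(3)[OF Suc.prems(1)] rd by (simp add: \<Phi>'_def)
      moreover have "fst \<Phi>' j = {}" if "j \<notin> {r..DIM('a)}" for j
        using that rd is_flagD(6,7)[OF Suc.prems(1), of j] by (auto simp: \<Phi>'_def)
      moreover have "snd \<Phi>' j = {}" if "j \<notin> {r..<DIM('a)}" for j
        using that rd is_flagD(8,9)[OF Suc.prems(1), of j] by (auto simp: \<Phi>'_def)
      ultimately show ?thesis unfolding is_flag_def by (simp add: split_beta)
    qed
    have dir': "flag_directions r \<Phi>' n'"
      unfolding flag_directions_def
    proof
      fix j assume j: "j \<in> {r..<DIM('a)}"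
      show "crosses (fst \<Phi>' (Suc j)) (fst \<Phi>' j) (snd \<Phi>' j) (n' j)"
        using j cr Suc.prems(2) by (cases "j = r") (auto simp: \<Phi>'_def n'_def W_def flag_directions_def)
    qed
    obtain c where c: "thin (fst \<Phi>' r) {x. iter_jump n' r count x \<noteq> c}"
      using Suc.IH[OF fl' dir'] rd by auto
    obtain \<kappa> where "\<kappa> > 0" "hadwiger r \<Phi>' A L = c * \<kappa>"
      using hadwiger_eq[OF fl' dir' _ c] rd by auto
    then have "c = 0" using zero[OF rd fl'] by simp
    have "iter_jump n' r count = jump m (iter_jump n' (Suc r) count)"
      using iter_jump_step[OF rd, of n' count] by (simp add: n'_def)
    also have "iter_jump n' (Suc r) count = iter_jump n (Suc r) count"
      by (rule iter_jump_cong) (simp add: n'_def)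
    finally have "iter_jump n' r count = jump m (iter_jump n (Suc r) count)" .
    then show "thin V {x. jump m (iter_jump n (Suc r) count) x \<noteq> 0}"
      using c \<open>c = 0\<close> by (simp add: \<Phi>'_def)
  qed
qed

text \<open>The flag made of the whole space alone involves no jump, so \<open>count\<close> itself
  is generically constant. Its value at a generic point of \<open>A\<close> is a positive integer,
  since the zero vector is counted there.\<close>

lemma hadwiger_zero_imp_tiling:
  assumes zero: "\<And>r \<Phi>. r < DIM('a) \<Longrightarrow> is_flag r \<Phi> \<Longrightarrow> hadwiger r \<Phi> A L = 0"
    and int: "interior A \<noteq> {}"
  shows "\<exists>k>0. tiles_at_level A L k"
proof -
  define \<Phi> :: "'a flag" where "\<Phi> = (\<lambda>j. if j = DIM('a) then UNIV else {}, \<lambda>_. {})"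
  have "is_flag DIM('a) \<Phi>" by (auto simp: is_flag_def \<Phi>_def)
  moreover have "flag_directions DIM('a) \<Phi> (\<lambda>_. 0)" by (simp add: flag_directions_def)
  ultimately obtain c where "thin (fst \<Phi> DIM('a)) {x. iter_jump (\<lambda>_. 0) DIM('a) count x \<noteq> c}"
    using hadwiger_zero_imp_generically_const[OF zero] by blast
  then have th: "thin UNIV {x. count x \<noteq> c}" by (simp add: \<Phi>_def)
  obtain x e where "e > 0" "ball x e \<subseteq> A" using int by (meson mem_interior ex_in_conv)
  then obtain y where y: "y \<in> A" "count y = c"
    using thin_dense[OF affine_UNIV UNIV_I _ th, of e x] by blast
  define k where "k = card {l\<in>L. y + l \<in> A}"
  have "finite {l\<in>L. y + l \<in> A}"
    by (rule finite_subset[OF _ finite_L[of "norm y + M"]]) (use norm_translate_bound in auto)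
  moreover have "0 \<in> {l\<in>L. y + l \<in> A}" using y(1) lattice_group(1)[OF lattice_L] by simp
  ultimately have "k > 0" unfolding k_def using card_gt_0_iff by blast
  moreover have "c = real k" using y(2) by (simp add: count_def k_def)
  then have "tiles_at_level A L k" using thin_UNIV_imp_AE[OF th] by (simp add: tiles_iff)
  ultimately show ?thesis by blast
qed

end

theorem theorem1p1:
  fixes A L :: "(real ^ 'n) set"
  assumes "general_polytope A" and "is_lattice L"
  shows "(\<exists>k>0. tiles_at_level A L k) \<longleftrightarrow>
         (\<forall>r \<Phi>. r \<le> CARD('n) - 1 \<and> is_flag r \<Phi> \<longrightarrow> hadwiger r \<Phi> A L = 0)"
proof -
  obtain \<Sigma> where \<Sigma>: "finite \<Sigma>" "adapted \<Sigma> A" using adapted_general_polytope[OF assms(1)] by blast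
  obtain T where T: "finite T" "T \<noteq> {}" "\<forall>S\<in>T. int DIM(real ^ 'n) simplex S" "A = \<Union>T"
    using assms(1) unfolding general_polytope_def by blast
  have "compact (\<Union>T)" by (rule compact_Union) (use T(1,3) compact_simplex in blast)+
  then have "compact A" using T(4) by simp
  then have clA: "closed A" and "bounded A" by (rule compact_imp_closed, rule compact_imp_bounded)
  then obtain M where M: "M > 0" "\<forall>x\<in>A. norm x \<le> M" using bounded_pos by blast
  obtain S where S: "S \<in> T" "int DIM(real ^ 'n) simplex S" using T(2,3) by blast
  have "aff_dim S = int DIM(real ^ 'n)" using aff_dim_simplex[OF S(2)] .
  then have "affine hull S = UNIV" using aff_dim_eq_full by blast
  moreover from this have "interior S \<noteq> {}"
    using rel_interior_interior[of S] rel_interior_eq_empty[OF convex_simplex[OF S(2)]] by auto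
  moreover have "S \<subseteq> A" using S(1) T(4) by blast
  ultimately have hull: "affine hull A = UNIV" and int: "interior A \<noteq> {}"
    using hull_mono[of S A affine] interior_mono[of S A] by auto
  interpret lattice_polytope A L \<Sigma> M
  proof
    show "A \<subseteq> cball 0 M" using M(2) by auto
    show "0 \<le> M" using M(1) by simp
  qed (fact clA \<Sigma> hull assms(2))+
  \<comment> \<open>The difference \<open>CARD('n) - 1\<close> is truncated, so it bounds
    \<open>r\<close> strictly below the dimension only because the dimension is positive.\<close>
  have "CARD('n) > 0" by simp
  then have r: "r \<le> CARD('n) - 1 \<longleftrightarrow> r < DIM(real ^ 'n)" for r
    unfolding DIM_cart DIM_real mult_1_right by linarith
  show ?thesis
    using tiling_imp_hadwiger_zero hadwiger_zero_imp_tiling[OF _ int] unfolding r by blast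
qed

end
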